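(* Suppose that $\Lambda$ is a proper, source-free topological $k$-graph, and $c$ is a continuous $\mathbb{T}$-valued $2$-cocycle on $\Lambda$. For each $n\in\mathbb{N}^k$, let $X_n$ be the $C_0(\Lambda^0)$-correspondence associated to the topological graph $\Lambda_n=(\Lambda^0,\Lambda^n,r|_{\Lambda^n},s|_{\Lambda^n})$. For $f\in X_m$ and $g\in X_n$, define $fg\colon\Lambda^{m+n}\to\mathbb{C}$ by $$(fg)(\lambda):=c(\lambda(0,m),\lambda(m,m+n))\,f(\lambda(0,m))\,g(\lambda(m,m+n)).$$ Then $fg\in X_{m+n}$, and under this multiplication, the family $X:=\bigsqcup_{n\in\mathbb{N}^k}X_n$ of $C_0(\Lambda^0)$-correspondences is a product system over $\mathbb{N}^k$.
   Context: $\mathbb{N}=\{0,1,2,\dots\}$, $k\ge1$, $e_1,\dots,e_k$ are the standard generators of $\mathbb{N}^k$, $\le$ is the coordinatewise order. A topological $k$-graph is a pair $(\Lambda,d)$ (written $\Lambda$) consisting of a small category $\Lambda=(\mathrm{Obj}(\Lambda),\mathrm{Mor}(\Lambda),r,s,\circ)$ ($r$ = codomain, $s$ = domain) and a functor $d\colon\Lambda\to\mathbb{N}^k$ such that: (i) $\mathrm{Obj}(\Lambda)$ and $\mathrm{Mor}(\Lambda)$ are second-countable, locally compact Hausdorff spaces; (ii) $r,s\colon\mathrm{Mor}(\Lambda)\to\mathrm{Obj}(\Lambda)$ are continuous and $s$ is a local homeomorphism; (iii) composition $\Lambda\times_c\Lambda:=\{(\lambda,\mu):s(\lambda)=r(\mu)\}\to\Lambda$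 is continuous and open ($\Lambda\times_c\Lambda$ having the subspace topology of the product topology); (iv) $d$ is continuous, $\mathbb{N}^k$ being discrete; (v) whenever $d(\lambda)=m+n$ there is a unique $(\mu,\nu)\in\Lambda\times_c\Lambda$ with $\lambda=\mu\nu$, $d(\mu)=m$, $d(\nu)=n$. We write $\lambda\in\Lambda$ for morphisms, $\Lambda^n:=d^{-1}(n)$, and identify $\mathrm{Obj}(\Lambda)$ with $\Lambda^0$. $\Lambda$ is source-free if for all $v\in\Lambda^0$ and all $i$ there is $\lambda\in\Lambda^{e_i}$ with $r(\lambda)=v$; $\Lambda$ is proper if for each $m\in\mathbb{N}^k$ preimages of compact subsets of $\Lambda^0$ under $r|_{\Lambda^m}$ are compact in $\Lambda^m$. For $m\le n\le d(\lambda)$, $\lambda(m,n)\in\Lambda^{n-m}$ is the unique path with $\lambda=\alpha\,\lambda(m,n)\,\gamma$, $d(\alpha)=m$, $d(\gamma)=d(\lambda)-n$. A continuous $\mathbb{T}$-valued $2$-cocycle on $\Lambda$ is a continuous map $c\colon\Lambda\times_c\Lambda\to\mathbb{T}$ with $c(\lambda,\mu)c(\lambda\mu,\nu)=c(\lambda,\mu\nu)c(\mu,\nu)$ whenever $s(\lambda)=r(\mu)$, $s(\mu)=r(\nu)$, and $c(\lambda,s(\lambda))=c(r(\lambda),\lambda)=1$ for all $\lambda$. A $C^*$-correspondence over a $C^*$-algebra $A$ ($A$-correspondence) is a right Hilbert $A$-module $X$ with a left action of $A$ given by a homomorphism $\phi\colon A\to\mathcal{L}(X)$ into the adjointable operators.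 A topological graph $E=(E^0,E^1,r,s)$ consists of locally compact Hausdorff spaces $E^0,E^1$, a continuous map $r\colon E^1\to E^0$ and a local homeomorphism $s\colon E^1\to E^0$. Its associated $C_0(E^0)$-correspondence $X(E)$ consists of all $f\in C(E^1)$ with $\langle f,f\rangle\in C_0(E^0)$ (equivalently, it is the completion of $C_c(E^1)$), where $\langle f,g\rangle(v)=\sum_{e\in s^{-1}(v)}\overline{f(e)}g(e)$, $(g\cdot f)(e)=g(r(e))f(e)$, $(f\cdot g)(e)=f(e)g(s(e))$ for $g\in C_0(E^0)$. A product system over $\mathbb{N}^k$ with coefficient algebra $A$ is a semigroup $X=\bigsqcup_{n\in\mathbb{N}^k}X_n$ such that each $X_n$ is an $A$-correspondence; $X_0$ is a copy of ${}_AA_A$; for nonzero $m,n\in\mathbb{N}^k$ the multiplication map $X_m\times X_n\to X_{m+n}$, $x\otimes y\mapsto xy$, extends to an isomorphism of $A$-correspondences $X_m\otimes_AX_n\cong X_{m+n}$; and $ax=a\cdot x$, $xa=x\cdot a$ for all $x\in X$, $a\in X_0$. *)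

theory Defs
  imports "HOL-Analysis.Analysis"
begin

section \<open>C*-algebras and C*-correspondences\<close>

text \<open>
  All algebraic structures live on explicit carrier sets; the operations are only constrained
  on the carriers.
\<close>

locale complex_space_on =
  fixes V :: "'v set" and zero :: 'v and add :: "'v \<Rightarrow> 'v \<Rightarrow> 'v" and scale :: "complex \<Rightarrow> 'v \<Rightarrow> 'v"
  assumes zero_closed: "zero \<in> V"
    and add_closed: "x \<in> V \<Longrightarrow> y \<in> V \<Longrightarrow> add x y \<in> V"
    and scale_closed: "x \<in> V \<Longrightarrow> scale z x \<in> V"
    and add_assoc: "x \<in> V \<Longrightarrow> y \<in> V \<Longrightarrow> t \<in> V \<Longrightarrow> add (add x y) t = add x (add y t)"
    and add_commute: "x \<in> V \<Longrightarrow> y \<in> V \<Longrightarrow> add x y = add y x"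
    and add_zero: "x \<in> V \<Longrightarrow> add x zero = x"
    and add_inverse: "x \<in> V \<Longrightarrow> \<exists>y\<in>V. add x y = zero"
    and scale_add: "x \<in> V \<Longrightarrow> y \<in> V \<Longrightarrow> scale z (add x y) = add (scale z x) (scale z y)"
    and add_scale: "x \<in> V \<Longrightarrow> scale (z + w) x = add (scale z x) (scale w x)"
    and scale_scale: "x \<in> V \<Longrightarrow> scale z (scale w x) = scale (z * w) x"
    and scale_one: "x \<in> V \<Longrightarrow> scale 1 x = x"

definition cauchy_wrt :: "('v \<Rightarrow> 'v \<Rightarrow> real) \<Rightarrow> (nat \<Rightarrow> 'v) \<Rightarrow> bool" where
  "cauchy_wrt \<delta> u \<longleftrightarrow> (\<forall>\<epsilon>>0. \<exists>N. \<forall>i\<ge>N. \<forall>j\<ge>N. \<delta> (u i) (u j) < \<epsilon>)"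

definition complete_wrt :: "('v \<Rightarrow> 'v \<Rightarrow> real) \<Rightarrow> 'v set \<Rightarrow> bool" where
  "complete_wrt \<delta> V \<longleftrightarrow>
     (\<forall>u. range u \<subseteq> V \<and> cauchy_wrt \<delta> u \<longrightarrow> (\<exists>l\<in>V. (\<lambda>i. \<delta> (u i) l) \<longlonglongrightarrow> 0))"

record 'a cstar_structure =
  ca_set :: "'a set"
  ca_zero :: 'a
  ca_add :: "'a \<Rightarrow> 'a \<Rightarrow> 'a"
  ca_scale :: "complex \<Rightarrow> 'a \<Rightarrow> 'a"
  ca_mult :: "'a \<Rightarrow> 'a \<Rightarrow> 'a"
  ca_star :: "'a \<Rightarrow> 'a"
  ca_norm :: "'a \<Rightarrow> real"

definition ca_dist :: "'a cstar_structure \<Rightarrow> 'a \<Rightarrow> 'a \<Rightarrow> real" where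
  "ca_dist A a b = ca_norm A (ca_add A a (ca_scale A (- 1) b))"

text \<open>C*-algebras, not necessarily unital and possibly zero.\<close>

locale cstar_algebra =
  complex_space_on "ca_set A" "ca_zero A" "ca_add A" "ca_scale A"
  for A :: "'a cstar_structure" +
  assumes mult_closed: "a \<in> ca_set A \<Longrightarrow> b \<in> ca_set A \<Longrightarrow> ca_mult A a b \<in> ca_set A"
    and mult_assoc: "a \<in> ca_set A \<Longrightarrow> b \<in> ca_set A \<Longrightarrow> c \<in> ca_set A \<Longrightarrow>
      ca_mult A (ca_mult A a b) c = ca_mult A a (ca_mult A b c)"
    and mult_add: "a \<in> ca_set A \<Longrightarrow> b \<in> ca_set A \<Longrightarrow> c \<in> ca_set A \<Longrightarrow>
      ca_mult A a (ca_add A b c) = ca_add A (ca_mult A a b) (ca_mult A a c)"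
    and add_mult: "a \<in> ca_set A \<Longrightarrow> b \<in> ca_set A \<Longrightarrow> c \<in> ca_set A \<Longrightarrow>
      ca_mult A (ca_add A a b) c = ca_add A (ca_mult A a c) (ca_mult A b c)"
    and scale_mult: "a \<in> ca_set A \<Longrightarrow> b \<in> ca_set A \<Longrightarrow>
      ca_mult A (ca_scale A z a) b = ca_scale A z (ca_mult A a b)"
    and mult_scale: "a \<in> ca_set A \<Longrightarrow> b \<in> ca_set A \<Longrightarrow>
      ca_mult A a (ca_scale A z b) = ca_scale A z (ca_mult A a b)"
    and star_closed: "a \<in> ca_set A \<Longrightarrow> ca_star A a \<in> ca_set A"
    and star_star: "a \<in> ca_set A \<Longrightarrow> ca_star A (ca_star A a) = a"
    and star_add: "a \<in> ca_set A \<Longrightarrow> b \<in> ca_set A \<Longrightarrow>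
      ca_star A (ca_add A a b) = ca_add A (ca_star A a) (ca_star A b)"
    and star_scale: "a \<in> ca_set A \<Longrightarrow> ca_star A (ca_scale A z a) = ca_scale A (cnj z) (ca_star A a)"
    and star_mult: "a \<in> ca_set A \<Longrightarrow> b \<in> ca_set A \<Longrightarrow>
      ca_star A (ca_mult A a b) = ca_mult A (ca_star A b) (ca_star A a)"
    and norm_nonneg: "a \<in> ca_set A \<Longrightarrow> 0 \<le> ca_norm A a"
    and norm_eq_zero: "a \<in> ca_set A \<Longrightarrow> ca_norm A a = 0 \<longleftrightarrow> a = ca_zero A"
    and norm_triangle: "a \<in> ca_set A \<Longrightarrow> b \<in> ca_set A \<Longrightarrow>
      ca_norm A (ca_add A a b) \<le> ca_norm A a + ca_norm A b"
    and norm_scale: "a \<in> ca_set A \<Longrightarrow> ca_norm A (ca_scale A z a) = cmod z * ca_norm A a"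
    and norm_mult: "a \<in> ca_set A \<Longrightarrow> b \<in> ca_set A \<Longrightarrow>
      ca_norm A (ca_mult A a b) \<le> ca_norm A a * ca_norm A b"
    and cstar_identity: "a \<in> ca_set A \<Longrightarrow> ca_norm A (ca_mult A (ca_star A a) a) = (ca_norm A a)\<^sup>2"
    and complete: "complete_wrt (ca_dist A) (ca_set A)"

text \<open>
  Inner products are linear in the second variable.  In \<open>co_right X x a\<close> and \<open>co_left X a x\<close> the
  coefficient \<open>a\<close> acts from the right and from the left, respectively.
\<close>

record ('a, 'x) correspondence =
  co_set :: "'x set"
  co_zero :: 'x
  co_add :: "'x \<Rightarrow> 'x \<Rightarrow> 'x"
  co_scale :: "complex \<Rightarrow> 'x \<Rightarrow> 'x"
  co_inner :: "'x \<Rightarrow> 'x \<Rightarrow> 'a"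
  co_right :: "'x \<Rightarrow> 'a \<Rightarrow> 'x"
  co_left :: "'a \<Rightarrow> 'x \<Rightarrow> 'x"

definition co_dist :: "'a cstar_structure \<Rightarrow> ('a, 'x) correspondence \<Rightarrow> 'x \<Rightarrow> 'x \<Rightarrow> real" where
  "co_dist A X x y =
     (let w = co_add X x (co_scale X (- 1) y) in sqrt (ca_norm A (co_inner X w w)))"

locale hilbert_module =
  cstar_algebra A + X: complex_space_on "co_set X" "co_zero X" "co_add X" "co_scale X"
  for A :: "'a cstar_structure" and X :: "('a, 'x) correspondence" +
  assumes right_closed: "x \<in> co_set X \<Longrightarrow> a \<in> ca_set A \<Longrightarrow> co_right X x a \<in> co_set X"
    and right_add: "x \<in> co_set X \<Longrightarrow> a \<in> ca_set A \<Longrightarrow> b \<in> ca_set A \<Longrightarrow>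
      co_right X x (ca_add A a b) = co_add X (co_right X x a) (co_right X x b)"
    and add_right: "x \<in> co_set X \<Longrightarrow> y \<in> co_set X \<Longrightarrow> a \<in> ca_set A \<Longrightarrow>
      co_right X (co_add X x y) a = co_add X (co_right X x a) (co_right X y a)"
    and right_mult: "x \<in> co_set X \<Longrightarrow> a \<in> ca_set A \<Longrightarrow> b \<in> ca_set A \<Longrightarrow>
      co_right X x (ca_mult A a b) = co_right X (co_right X x a) b"
    and right_scale: "x \<in> co_set X \<Longrightarrow> a \<in> ca_set A \<Longrightarrow>
      co_right X x (ca_scale A z a) = co_scale X z (co_right X x a)"
    and scale_right: "x \<in> co_set X \<Longrightarrow> a \<in> ca_set A \<Longrightarrow>
      co_right X (co_scale X z x) a = co_scale X z (co_right X x a)"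
    and inner_closed: "x \<in> co_set X \<Longrightarrow> y \<in> co_set X \<Longrightarrow> co_inner X x y \<in> ca_set A"
    and inner_add: "x \<in> co_set X \<Longrightarrow> y \<in> co_set X \<Longrightarrow> y' \<in> co_set X \<Longrightarrow>
      co_inner X x (co_add X y y') = ca_add A (co_inner X x y) (co_inner X x y')"
    and inner_scale: "x \<in> co_set X \<Longrightarrow> y \<in> co_set X \<Longrightarrow>
      co_inner X x (co_scale X z y) = ca_scale A z (co_inner X x y)"
    and inner_right: "x \<in> co_set X \<Longrightarrow> y \<in> co_set X \<Longrightarrow> a \<in> ca_set A \<Longrightarrow>
      co_inner X x (co_right X y a) = ca_mult A (co_inner X x y) a"
    and inner_star: "x \<in> co_set X \<Longrightarrow> y \<in> co_set X \<Longrightarrow>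
      ca_star A (co_inner X x y) = co_inner X y x"
    and inner_positive: "x \<in> co_set X \<Longrightarrow>
      \<exists>b\<in>ca_set A. co_inner X x x = ca_mult A (ca_star A b) b"
    and inner_definite: "x \<in> co_set X \<Longrightarrow> co_inner X x x = ca_zero A \<Longrightarrow> x = co_zero X"
    and complete_module: "complete_wrt (co_dist A X) (co_set X)"

definition adjoint_pair :: "('a, 'x) correspondence \<Rightarrow> ('x \<Rightarrow> 'x) \<Rightarrow> ('x \<Rightarrow> 'x) \<Rightarrow> bool" where
  "adjoint_pair X T S \<longleftrightarrow>
     T ` co_set X \<subseteq> co_set X \<and> S ` co_set X \<subseteq> co_set X \<and>
     (\<forall>x\<in>co_set X. \<forall>y\<in>co_set X. co_inner X (T x) y = co_inner X x (S y))"

text \<open>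
  The assumptions on the left action say that \<open>\<phi> a = co_left X a\<close> is a *-homomorphism into the
  adjointable operators; \<open>left_star\<close> contains both the adjointability of \<open>\<phi> a\<close> and
  \<open>\<phi> (a*) = (\<phi> a)*\<close>.
\<close>

locale cstar_correspondence = hilbert_module A X
  for A :: "'a cstar_structure" and X :: "('a, 'x) correspondence" +
  assumes left_star: "a \<in> ca_set A \<Longrightarrow> adjoint_pair X (co_left X a) (co_left X (ca_star A a))"
    and left_add: "a \<in> ca_set A \<Longrightarrow> b \<in> ca_set A \<Longrightarrow> x \<in> co_set X \<Longrightarrow>
      co_left X (ca_add A a b) x = co_add X (co_left X a x) (co_left X b x)"
    and left_scale: "a \<in> ca_set A \<Longrightarrow> x \<in> co_set X \<Longrightarrow>
      co_left X (ca_scale A z a) x = co_scale X z (co_left X a x)"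
    and left_mult: "a \<in> ca_set A \<Longrightarrow> b \<in> ca_set A \<Longrightarrow> x \<in> co_set X \<Longrightarrow>
      co_left X (ca_mult A a b) x = co_left X a (co_left X b x)"

text \<open>The correspondence usually written \<open>\<^sub>AA\<^sub>A\<close>.\<close>

definition self_correspondence :: "'a cstar_structure \<Rightarrow> ('a, 'a) correspondence" where
  "self_correspondence A =
     \<lparr>co_set = ca_set A, co_zero = ca_zero A, co_add = ca_add A, co_scale = ca_scale A,
      co_inner = (\<lambda>a b. ca_mult A (ca_star A a) b), co_right = ca_mult A, co_left = ca_mult A\<rparr>"

definition correspondence_iso ::
  "'a cstar_structure \<Rightarrow> ('a, 'x) correspondence \<Rightarrow> ('a, 'y) correspondence \<Rightarrow> ('x \<Rightarrow> 'y) \<Rightarrow> bool" where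
  "correspondence_iso A X Y U \<longleftrightarrow>
     bij_betw U (co_set X) (co_set Y) \<and>
     (\<forall>x\<in>co_set X. \<forall>y\<in>co_set X. U (co_add X x y) = co_add Y (U x) (U y)) \<and>
     (\<forall>z. \<forall>x\<in>co_set X. U (co_scale X z x) = co_scale Y z (U x)) \<and>
     (\<forall>x\<in>co_set X. \<forall>y\<in>co_set X. co_inner Y (U x) (U y) = co_inner X x y) \<and>
     (\<forall>x\<in>co_set X. \<forall>a\<in>ca_set A. U (co_right X x a) = co_right Y (U x) a) \<and>
     (\<forall>a\<in>ca_set A. \<forall>x\<in>co_set X. U (co_left X a x) = co_left Y a (U x))"


section \<open>The balanced tensor product of correspondences\<close>

text \<open>
  \<open>X \<otimes>\<^sub>A Y\<close> is the separated completion of the formal finite sums of elementary tensors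
  \<open>x \<otimes> y\<close> for the \<open>A\<close>-valued form determined by
  \<open>\<langle>x \<otimes> y, x' \<otimes> y'\<rangle> = \<langle>y, \<langle>x, x'\<rangle> \<cdot> y'\<rangle>\<close>.  A formal sum is the list of its summands \<open>(x, y)\<close>, and
  an element of the completion is a class of Cauchy sequences of such lists.  Bilinearity of \<open>\<otimes>\<close>
  and the balancing relation \<open>x \<cdot> a \<otimes> y = x \<otimes> a \<cdot> y\<close> need not be imposed separately, since the
  differences involved are null vectors of the form.
\<close>

definition formal_sums :: "('a, 'x) correspondence \<Rightarrow> ('a, 'y) correspondence \<Rightarrow> ('x \<times> 'y) list set" where
  "formal_sums X Y = lists (co_set X \<times> co_set Y)"

definition formal_inner ::
  "'a cstar_structure \<Rightarrow> ('a, 'x) correspondence \<Rightarrow> ('a, 'y) correspondence \<Rightarrow>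
   ('x \<times> 'y) list \<Rightarrow> ('x \<times> 'y) list \<Rightarrow> 'a" where
  "formal_inner A X Y u v =
     foldr (ca_add A)
       [co_inner Y y (co_left Y (co_inner X x x') y'). (x, y) \<leftarrow> u, (x', y') \<leftarrow> v] (ca_zero A)"

definition formal_scale :: "('a, 'x) correspondence \<Rightarrow> complex \<Rightarrow> ('x \<times> 'y) list \<Rightarrow> ('x \<times> 'y) list" where
  "formal_scale X z u = map (\<lambda>(x, y). (co_scale X z x, y)) u"

definition formal_dist ::
  "'a cstar_structure \<Rightarrow> ('a, 'x) correspondence \<Rightarrow> ('a, 'y) correspondence \<Rightarrow>
   ('x \<times> 'y) list \<Rightarrow> ('x \<times> 'y) list \<Rightarrow> real" where
  "formal_dist A X Y u v =
     (let w = u @ formal_scale X (- 1) v in sqrt (ca_norm A (formal_inner A X Y w w)))"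

definition formal_cauchy ::
  "'a cstar_structure \<Rightarrow> ('a, 'x) correspondence \<Rightarrow> ('a, 'y) correspondence \<Rightarrow>
   (nat \<Rightarrow> ('x \<times> 'y) list) set" where
  "formal_cauchy A X Y = {u. range u \<subseteq> formal_sums X Y \<and> cauchy_wrt (formal_dist A X Y) u}"

definition tensor_rel ::
  "'a cstar_structure \<Rightarrow> ('a, 'x) correspondence \<Rightarrow> ('a, 'y) correspondence \<Rightarrow>
   (nat \<Rightarrow> ('x \<times> 'y) list) rel" where
  "tensor_rel A X Y =
     {(u, v). u \<in> formal_cauchy A X Y \<and> v \<in> formal_cauchy A X Y \<and>
              (\<lambda>i. formal_dist A X Y (u i) (v i)) \<longlonglongrightarrow> 0}"

definition tensor_class ::
  "'a cstar_structure \<Rightarrow> ('a, 'x) correspondence \<Rightarrow> ('a, 'y) correspondence \<Rightarrow>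
   (nat \<Rightarrow> ('x \<times> 'y) list) \<Rightarrow> (nat \<Rightarrow> ('x \<times> 'y) list) set" where
  "tensor_class A X Y u = tensor_rel A X Y `` {u}"

definition tensor_rep :: "(nat \<Rightarrow> ('x \<times> 'y) list) set \<Rightarrow> nat \<Rightarrow> ('x \<times> 'y) list" where
  "tensor_rep P = (SOME u. u \<in> P)"

definition tensor_product ::
  "'a cstar_structure \<Rightarrow> ('a, 'x) correspondence \<Rightarrow> ('a, 'y) correspondence \<Rightarrow>
   ('a, (nat \<Rightarrow> ('x \<times> 'y) list) set) correspondence" where
  "tensor_product A X Y =
     \<lparr>co_set = formal_cauchy A X Y // tensor_rel A X Y,
      co_zero = tensor_class A X Y (\<lambda>_. []),
      co_add = (\<lambda>P Q. tensor_class A X Y (\<lambda>i. tensor_rep P i @ tensor_rep Q i)),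
      co_scale = (\<lambda>z P. tensor_class A X Y (\<lambda>i. formal_scale X z (tensor_rep P i))),
      co_inner = (\<lambda>P Q. THE a. a \<in> ca_set A \<and>
        (\<lambda>i. ca_dist A (formal_inner A X Y (tensor_rep P i) (tensor_rep Q i)) a) \<longlonglongrightarrow> 0),
      co_right = (\<lambda>P a. tensor_class A X Y
        (\<lambda>i. map (\<lambda>(x, y). (x, co_right Y y a)) (tensor_rep P i))),
      co_left = (\<lambda>a P. tensor_class A X Y
        (\<lambda>i. map (\<lambda>(x, y). (co_left X a x, y)) (tensor_rep P i)))\<rparr>"

definition elementary_tensor ::
  "'a cstar_structure \<Rightarrow> ('a, 'x) correspondence \<Rightarrow> ('a, 'y) correspondence \<Rightarrow>
   'x \<Rightarrow> 'y \<Rightarrow> (nat \<Rightarrow> ('x \<times> 'y) list) set" where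
  "elementary_tensor A X Y x y = tensor_class A X Y (\<lambda>_. [(x, y)])"


section \<open>Product systems\<close>

text \<open>
  \<open>\<nat>\<^sup>k\<close> is rendered as \<open>nat ^ 'k\<close>; its generators are \<open>axis i 1\<close>.  The disjoint union of the fibres
  \<open>X n\<close> consists of pairs \<open>(n, x)\<close>, and \<open>M m n\<close> is the multiplication \<open>X m \<times> X n \<rightarrow> X (m + n)\<close>.
\<close>

definition disjoint_union :: "('n \<Rightarrow> ('a, 'x) correspondence) \<Rightarrow> ('n \<times> 'x) set" where
  "disjoint_union X = (SIGMA n:UNIV. co_set (X n))"

definition graded_mult ::
  "('n::plus \<Rightarrow> 'n \<Rightarrow> 'x \<Rightarrow> 'x \<Rightarrow> 'x) \<Rightarrow> 'n \<times> 'x \<Rightarrow> 'n \<times> 'x \<Rightarrow> 'n \<times> 'x" where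
  "graded_mult M p q = (fst p + fst q, M (fst p) (fst q) (snd p) (snd q))"

definition semigroup_on :: "'s set \<Rightarrow> ('s \<Rightarrow> 's \<Rightarrow> 's) \<Rightarrow> bool" where
  "semigroup_on S op \<longleftrightarrow>
     (\<forall>p\<in>S. \<forall>q\<in>S. op p q \<in> S) \<and>
     (\<forall>p\<in>S. \<forall>q\<in>S. \<forall>t\<in>S. op (op p q) t = op p (op q t))"

text \<open>
  The map \<open>\<iota>\<close> is the identification of the coefficient algebra \<open>A\<close> with its copy \<open>X 0\<close>.
\<close>

definition product_system ::
  "'a cstar_structure \<Rightarrow> (nat ^ 'k \<Rightarrow> ('a, 'x) correspondence) \<Rightarrow>
   (nat ^ 'k \<Rightarrow> nat ^ 'k \<Rightarrow> 'x \<Rightarrow> 'x \<Rightarrow> 'x) \<Rightarrow> ('a \<Rightarrow> 'x) \<Rightarrow> bool" where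
  "product_system A X M \<iota> \<longleftrightarrow>
     cstar_algebra A \<and>
     (\<forall>n. cstar_correspondence A (X n)) \<and>
     semigroup_on (disjoint_union X) (graded_mult M) \<and>
     correspondence_iso A (self_correspondence A) (X 0) \<iota> \<and>
     (\<forall>m n. m \<noteq> 0 \<longrightarrow> n \<noteq> 0 \<longrightarrow>
       (\<exists>U. correspondence_iso A (tensor_product A (X m) (X n)) (X (m + n)) U \<and>
            (\<forall>x\<in>co_set (X m). \<forall>y\<in>co_set (X n).
               U (elementary_tensor A (X m) (X n) x y) = M m n x y))) \<and>
     (\<forall>n. \<forall>a\<in>ca_set A. \<forall>x\<in>co_set (X n).
       M 0 n (\<iota> a) x = co_left (X n) a x \<and> M n 0 x (\<iota> a) = co_right (X n) x a)"


section \<open>The correspondence of a topological graph\<close>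

text \<open>
  Functions on a topological space \<open>T\<close> are total functions that vanish outside \<open>topspace T\<close>.
  In particular the supremum in \<open>C0_algebra\<close>, taken over the whole type, is the supremum norm
  over \<open>topspace T\<close>, and it is \<open>0\<close> if the space is empty.
\<close>

definition C0_functions :: "'v topology \<Rightarrow> ('v \<Rightarrow> complex) set" where
  "C0_functions T =
     {g. continuous_map T euclidean g \<and> (\<forall>v. v \<notin> topspace T \<longrightarrow> g v = 0) \<and>
         (\<forall>\<epsilon>>0. compactin T {v \<in> topspace T. \<epsilon> \<le> cmod (g v)})}"

definition C0_algebra :: "'v topology \<Rightarrow> ('v \<Rightarrow> complex) cstar_structure" where
  "C0_algebra T =
     \<lparr>ca_set = C0_functions T, ca_zero = (\<lambda>_. 0), ca_add = (\<lambda>g h v. g v + h v),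
      ca_scale = (\<lambda>z g v. z * g v), ca_mult = (\<lambda>g h v. g v * h v),
      ca_star = (\<lambda>g v. cnj (g v)), ca_norm = (\<lambda>g. SUP v. cmod (g v))\<rparr>"

text \<open>Only the restrictions of \<open>tg_rng\<close> and \<open>tg_src\<close> to the edge space are meaningful.\<close>

record ('v, 'e) topological_graph =
  tg_vertices :: "'v topology"
  tg_edges :: "'e topology"
  tg_rng :: "'e \<Rightarrow> 'v"
  tg_src :: "'e \<Rightarrow> 'v"

definition source_fibre :: "('v, 'e) topological_graph \<Rightarrow> 'v \<Rightarrow> 'e set" where
  "source_fibre E v = {e \<in> topspace (tg_edges E). tg_src E e = v}"

definition graph_inner :: "('v, 'e) topological_graph \<Rightarrow> ('e \<Rightarrow> complex) \<Rightarrow> ('e \<Rightarrow> complex) \<Rightarrow> 'v \<Rightarrow> complex" where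
  "graph_inner E f g v =
     (if v \<in> topspace (tg_vertices E) then \<Sum>\<^sub>\<infinity>e\<in>source_fibre E v. cnj (f e) * g e else 0)"

text \<open>
  Summability over the source fibres is stated explicitly, as \<open>infsum\<close> returns \<open>0\<close> on families
  that are not summable.
\<close>

definition graph_functions :: "('v, 'e) topological_graph \<Rightarrow> ('e \<Rightarrow> complex) set" where
  "graph_functions E =
     {f. continuous_map (tg_edges E) euclidean f \<and>
         (\<forall>e. e \<notin> topspace (tg_edges E) \<longrightarrow> f e = 0) \<and>
         (\<forall>v\<in>topspace (tg_vertices E). (\<lambda>e. cnj (f e) * f e) summable_on source_fibre E v) \<and>
         graph_inner E f f \<in> C0_functions (tg_vertices E)}"

definition graph_correspondence ::
  "('v, 'e) topological_graph \<Rightarrow> ('v \<Rightarrow> complex, 'e \<Rightarrow> complex) correspondence" where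
  "graph_correspondence E =
     \<lparr>co_set = graph_functions E, co_zero = (\<lambda>_. 0), co_add = (\<lambda>f g e. f e + g e),
      co_scale = (\<lambda>z f e. z * f e), co_inner = graph_inner E,
      co_right = (\<lambda>f g e. f e * g (tg_src E e)), co_left = (\<lambda>g f e. g (tg_rng E e) * f e)\<rparr>"


section \<open>Topological higher-rank graphs\<close>

text \<open>
  \<open>kg_rng\<close> is the codomain and \<open>kg_src\<close> the domain map, so that \<open>kg_comp \<Lambda> \<kappa> \<mu>\<close> is meaningful when
  \<open>kg_src \<Lambda> \<kappa> = kg_rng \<Lambda> \<mu>\<close>; \<open>kg_id \<Lambda> v\<close> is the identity morphism at the object \<open>v\<close>.
\<close>

record ('o, 'm, 'k) topological_k_graph =
  kg_obj :: "'o topology"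
  kg_mor :: "'m topology"
  kg_rng :: "'m \<Rightarrow> 'o"
  kg_src :: "'m \<Rightarrow> 'o"
  kg_id :: "'o \<Rightarrow> 'm"
  kg_comp :: "'m \<Rightarrow> 'm \<Rightarrow> 'm"
  kg_deg :: "'m \<Rightarrow> nat ^ 'k"

definition composable_pairs :: "('o, 'm, 'k::finite) topological_k_graph \<Rightarrow> ('m \<times> 'm) set" where
  "composable_pairs \<Lambda> =
     {(\<kappa>, \<mu>). \<kappa> \<in> topspace (kg_mor \<Lambda>) \<and> \<mu> \<in> topspace (kg_mor \<Lambda>) \<and> kg_src \<Lambda> \<kappa> = kg_rng \<Lambda> \<mu>}"

definition composable_topology :: "('o, 'm, 'k::finite) topological_k_graph \<Rightarrow> ('m \<times> 'm) topology" where
  "composable_topology \<Lambda> =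
     subtopology (prod_topology (kg_mor \<Lambda>) (kg_mor \<Lambda>)) (composable_pairs \<Lambda>)"

definition local_homeomorphism :: "'a topology \<Rightarrow> 'b topology \<Rightarrow> ('a \<Rightarrow> 'b) \<Rightarrow> bool" where
  "local_homeomorphism T S f \<longleftrightarrow>
     (\<forall>x\<in>topspace T. \<exists>U. openin T U \<and> x \<in> U \<and> openin S (f ` U) \<and>
        homeomorphic_map (subtopology T U) (subtopology S (f ` U)) f)"

definition is_category :: "('o, 'm, 'k::finite) topological_k_graph \<Rightarrow> bool" where
  "is_category \<Lambda> \<longleftrightarrow>
     (let Obj = topspace (kg_obj \<Lambda>); Mor = topspace (kg_mor \<Lambda>) in
      kg_rng \<Lambda> ` Mor \<subseteq> Obj \<and> kg_src \<Lambda> ` Mor \<subseteq> Obj \<and> kg_id \<Lambda> ` Obj \<subseteq> Mor \<and>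
      (\<forall>v\<in>Obj. kg_rng \<Lambda> (kg_id \<Lambda> v) = v \<and> kg_src \<Lambda> (kg_id \<Lambda> v) = v) \<and>
      (\<forall>(\<kappa>, \<mu>)\<in>composable_pairs \<Lambda>.
         kg_comp \<Lambda> \<kappa> \<mu> \<in> Mor \<and>
         kg_rng \<Lambda> (kg_comp \<Lambda> \<kappa> \<mu>) = kg_rng \<Lambda> \<kappa> \<and> kg_src \<Lambda> (kg_comp \<Lambda> \<kappa> \<mu>) = kg_src \<Lambda> \<mu>) \<and>
      (\<forall>\<kappa>\<in>Mor. kg_comp \<Lambda> (kg_id \<Lambda> (kg_rng \<Lambda> \<kappa>)) \<kappa> = \<kappa> \<and>
                kg_comp \<Lambda> \<kappa> (kg_id \<Lambda> (kg_src \<Lambda> \<kappa>)) = \<kappa>) \<and>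
      (\<forall>\<kappa> \<mu> \<nu>. (\<kappa>, \<mu>) \<in> composable_pairs \<Lambda> \<longrightarrow> (\<mu>, \<nu>) \<in> composable_pairs \<Lambda> \<longrightarrow>
         kg_comp \<Lambda> (kg_comp \<Lambda> \<kappa> \<mu>) \<nu> = kg_comp \<Lambda> \<kappa> (kg_comp \<Lambda> \<mu> \<nu>)))"

definition degree_functor :: "('o, 'm, 'k::finite) topological_k_graph \<Rightarrow> bool" where
  "degree_functor \<Lambda> \<longleftrightarrow>
     (\<forall>v\<in>topspace (kg_obj \<Lambda>). kg_deg \<Lambda> (kg_id \<Lambda> v) = 0) \<and>
     (\<forall>(\<kappa>, \<mu>)\<in>composable_pairs \<Lambda>. kg_deg \<Lambda> (kg_comp \<Lambda> \<kappa> \<mu>) = kg_deg \<Lambda> \<kappa> + kg_deg \<Lambda> \<mu>)"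

definition is_topological_k_graph :: "('o, 'm, 'k::finite) topological_k_graph \<Rightarrow> bool" where
  "is_topological_k_graph \<Lambda> \<longleftrightarrow>
     is_category \<Lambda> \<and> degree_functor \<Lambda> \<and>
     (second_countable (kg_obj \<Lambda>) \<and> locally_compact_space (kg_obj \<Lambda>) \<and> Hausdorff_space (kg_obj \<Lambda>)) \<and>
     (second_countable (kg_mor \<Lambda>) \<and> locally_compact_space (kg_mor \<Lambda>) \<and> Hausdorff_space (kg_mor \<Lambda>)) \<and>
     continuous_map (kg_mor \<Lambda>) (kg_obj \<Lambda>) (kg_rng \<Lambda>) \<and>
     continuous_map (kg_mor \<Lambda>) (kg_obj \<Lambda>) (kg_src \<Lambda>) \<and>
     local_homeomorphism (kg_mor \<Lambda>) (kg_obj \<Lambda>) (kg_src \<Lambda>) \<and>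
     continuous_map (composable_topology \<Lambda>) (kg_mor \<Lambda>) (\<lambda>(\<kappa>, \<mu>). kg_comp \<Lambda> \<kappa> \<mu>) \<and>
     open_map (composable_topology \<Lambda>) (kg_mor \<Lambda>) (\<lambda>(\<kappa>, \<mu>). kg_comp \<Lambda> \<kappa> \<mu>) \<and>
     continuous_map (kg_mor \<Lambda>) (discrete_topology UNIV) (kg_deg \<Lambda>) \<and>
     (\<forall>\<kappa>\<in>topspace (kg_mor \<Lambda>). \<forall>m n. kg_deg \<Lambda> \<kappa> = m + n \<longrightarrow>
        (\<exists>!p. p \<in> composable_pairs \<Lambda> \<and> \<kappa> = kg_comp \<Lambda> (fst p) (snd p) \<and>
              kg_deg \<Lambda> (fst p) = m \<and> kg_deg \<Lambda> (snd p) = n))"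

definition kg_paths :: "('o, 'm, 'k::finite) topological_k_graph \<Rightarrow> nat ^ 'k \<Rightarrow> 'm set" where
  "kg_paths \<Lambda> n = {\<kappa> \<in> topspace (kg_mor \<Lambda>). kg_deg \<Lambda> \<kappa> = n}"

definition source_free :: "('o, 'm, 'k::finite) topological_k_graph \<Rightarrow> bool" where
  "source_free \<Lambda> \<longleftrightarrow>
     (\<forall>v\<in>topspace (kg_obj \<Lambda>). \<forall>i. \<exists>\<kappa>\<in>kg_paths \<Lambda> (axis i 1). kg_rng \<Lambda> \<kappa> = v)"

definition proper_k_graph :: "('o, 'm, 'k::finite) topological_k_graph \<Rightarrow> bool" where
  "proper_k_graph \<Lambda> \<longleftrightarrow>
     (\<forall>m K. compactin (kg_obj \<Lambda>) K \<longrightarrow>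
        compactin (subtopology (kg_mor \<Lambda>) (kg_paths \<Lambda> m)) {\<kappa> \<in> kg_paths \<Lambda> m. kg_rng \<Lambda> \<kappa> \<in> K})"

text \<open>The segment \<open>\<kappa>(m, n)\<close>, for \<open>m \<le> n \<le> d(\<kappa>)\<close>.\<close>

definition kg_segment ::
  "('o, 'm, 'k::finite) topological_k_graph \<Rightarrow> 'm \<Rightarrow> nat ^ 'k \<Rightarrow> nat ^ 'k \<Rightarrow> 'm" where
  "kg_segment \<Lambda> \<kappa> m n =
     (THE \<beta>. \<beta> \<in> kg_paths \<Lambda> (n - m) \<and>
       (\<exists>\<alpha>\<in>kg_paths \<Lambda> m. \<exists>\<gamma>\<in>kg_paths \<Lambda> (kg_deg \<Lambda> \<kappa> - n).
          kg_src \<Lambda> \<alpha> = kg_rng \<Lambda> \<beta> \<and> kg_src \<Lambda> \<beta> = kg_rng \<Lambda> \<gamma> \<and>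
          \<kappa> = kg_comp \<Lambda> (kg_comp \<Lambda> \<alpha> \<beta>) \<gamma>))"

definition continuous_cocycle ::
  "('o, 'm, 'k::finite) topological_k_graph \<Rightarrow> ('m \<times> 'm \<Rightarrow> complex) \<Rightarrow> bool" where
  "continuous_cocycle \<Lambda> c \<longleftrightarrow>
     continuous_map (composable_topology \<Lambda>) (top_of_set (sphere 0 1)) c \<and>
     (\<forall>\<kappa> \<mu> \<nu>. (\<kappa>, \<mu>) \<in> composable_pairs \<Lambda> \<longrightarrow> (\<mu>, \<nu>) \<in> composable_pairs \<Lambda> \<longrightarrow>
        c (\<kappa>, \<mu>) * c (kg_comp \<Lambda> \<kappa> \<mu>, \<nu>) = c (\<kappa>, kg_comp \<Lambda> \<mu> \<nu>) * c (\<mu>, \<nu>)) \<and>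
     (\<forall>\<kappa>\<in>topspace (kg_mor \<Lambda>).
        c (\<kappa>, kg_id \<Lambda> (kg_src \<Lambda> \<kappa>)) = 1 \<and> c (kg_id \<Lambda> (kg_rng \<Lambda> \<kappa>), \<kappa>) = 1)"

text \<open>
  The vertex space of \<open>\<Lambda>\<^sub>n\<close> is the object space, identified with the space \<open>kg_paths \<Lambda> 0\<close> of
  identity morphisms.
\<close>

definition kg_level :: "('o, 'm, 'k::finite) topological_k_graph \<Rightarrow> nat ^ 'k \<Rightarrow> ('o, 'm) topological_graph" where
  "kg_level \<Lambda> n =
     \<lparr>tg_vertices = kg_obj \<Lambda>, tg_edges = subtopology (kg_mor \<Lambda>) (kg_paths \<Lambda> n),
      tg_rng = kg_rng \<Lambda>, tg_src = kg_src \<Lambda>\<rparr>"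

definition kg_correspondence ::
  "('o, 'm, 'k::finite) topological_k_graph \<Rightarrow> nat ^ 'k \<Rightarrow>
   ('o \<Rightarrow> complex, 'm \<Rightarrow> complex) correspondence" where
  "kg_correspondence \<Lambda> n = graph_correspondence (kg_level \<Lambda> n)"

definition twisted_product ::
  "('o, 'm, 'k::finite) topological_k_graph \<Rightarrow> ('m \<times> 'm \<Rightarrow> complex) \<Rightarrow> nat ^ 'k \<Rightarrow> nat ^ 'k \<Rightarrow>
   ('m \<Rightarrow> complex) \<Rightarrow> ('m \<Rightarrow> complex) \<Rightarrow> 'm \<Rightarrow> complex" where
  "twisted_product \<Lambda> c m n f g \<kappa> =
     (if \<kappa> \<in> kg_paths \<Lambda> (m + n)
      then c (kg_segment \<Lambda> \<kappa> 0 m, kg_segment \<Lambda> \<kappa> m (m + n)) *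
           f (kg_segment \<Lambda> \<kappa> 0 m) * g (kg_segment \<Lambda> \<kappa> m (m + n))
      else 0)"

text \<open>
  The identification of functions on the object space with functions on the identity morphisms:
  on \<open>kg_paths \<Lambda> 0\<close> the map \<open>kg_rng \<Lambda>\<close> is the inverse of \<open>kg_id \<Lambda>\<close>.
\<close>

definition vertex_embedding ::
  "('o, 'm, 'k::finite) topological_k_graph \<Rightarrow> ('o \<Rightarrow> complex) \<Rightarrow> 'm \<Rightarrow> complex" where
  "vertex_embedding \<Lambda> a \<kappa> = (if \<kappa> \<in> kg_paths \<Lambda> 0 then a (kg_rng \<Lambda> \<kappa>) else 0)"

end

theory Submission
  imports Defs
begin

text \<open>
  By unique factorisation, composition is a homeomorphism from the composable pairs of degrees \<open>m\<close>
  and \<open>n\<close> onto the paths of degree \<open>m + n\<close>.  Summing over the source fibre of \<open>v\<close> therefore means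
  summing over the second factor \<open>\<nu>\<close> and then over the first factors ending at the range of \<open>\<nu>\<close>; as
  \<open>|c| = 1\<close>, this gives \<open>\<langle>fg, f'g'\<rangle> = \<langle>g, \<langle>f, f'\<rangle> \<cdot> g'\<rangle>\<close>, so \<open>f \<otimes> g \<mapsto> fg\<close> is a well-defined isometry on
  the balanced tensor product.  Associativity is the cocycle identity.

  For surjectivity it suffices to reach compactly supported functions, and by a partition of unity
  those supported where both factors lie in open sets on which the source map is injective.  There the
  first factor of \<open>\<mu>\<nu>\<close> is a continuous function of \<open>\<nu>\<close>, so such a function is exactly a product of a
  cut-off function in \<open>\<mu>\<close> and a function of \<open>\<nu>\<close>.
\<close>

section \<open>Continuity and neighbourhood filters\<close>

text \<open>Fibres of the source map may be infinite, and membership in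
  \<open>graph_functions\<close> only gives continuity of \<open>\<langle>f, f\<rangle>\<close>.
  This says nothing directly about cross terms, so even closure under addition needs an argument of
  Dini type: a continuous nonnegative function with continuous fibrewise sums has uniformly small
  tails near each vertex, and whatever it dominates inherits continuous fibrewise sums. The majorant
  in use is \<open>B * (|f|\<^sup>2 + |g|\<^sup>2)\<close>. The same tails give density of the
  compactly supported functions.

  The tensor product consists of classes of Cauchy sequences of formal sums, with operations defined
  through chosen representatives. The choices become harmless by sending a function \<open>f\<close>
  to the class of all sequences whose images converge to \<open>f\<close>: completeness of the
  target shows that every class arises in this way, density that no such class is empty, and
  definiteness of the norm that different functions give different classes. The isomorphism is the
  inverse of this map.\<close>

lemma eventually_nhdsin_openin:
  assumes "openin T U" "x \<in> U" "\<And>y. y \<in> U \<Longrightarrow> P y"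
  shows "eventually P (nhdsin T x)"
  unfolding eventually_nhdsin using assms by blast

lemma filterlim_nhdsin:
  assumes "continuous_map T S f" "x \<in> topspace T"
  shows "filterlim f (nhdsin S (f x)) (nhdsin T x)"
proof (unfold filterlim_iff, intro allI impI)
  fix P assume P: "eventually P (nhdsin S (f x))"
  have "f x \<in> topspace S" using continuous_map_image_subset_topspace[OF assms(1)] assms(2) by blast
  then obtain U where U: "openin S U" "f x \<in> U" "\<forall>y\<in>U. P y"
    using P unfolding eventually_nhdsin by auto
  show "eventually (\<lambda>y. P (f y)) (nhdsin T x)"
    by (rule eventually_nhdsin_openin[of T "{y \<in> topspace T. f y \<in> U}"])
      (use U assms openin_continuous_map_preimage[OF assms(1) U(1)] in simp_all)
qed

lemma nhdsin_euclidean: "nhdsin euclidean y = nhds y"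
  by (simp add: nhdsin_def nhds_def)

text \<open>With continuity phrased as convergence along \<open>nhdsin\<close>, the limit rules for
  sums, products, norms and quotients apply to maps out of an abstract topology.\<close>

lemma continuous_map_iff_nhdsin:
  fixes f :: "'a \<Rightarrow> 'b::topological_space"
  shows "continuous_map T euclidean f \<longleftrightarrow> (\<forall>x\<in>topspace T. (f \<longlongrightarrow> f x) (nhdsin T x))"
proof
  assume "continuous_map T euclidean f"
  from filterlim_nhdsin[OF this] show "\<forall>x\<in>topspace T. (f \<longlongrightarrow> f x) (nhdsin T x)"
    unfolding nhdsin_euclidean by blast
next
  assume *: "\<forall>x\<in>topspace T. (f \<longlongrightarrow> f x) (nhdsin T x)"
  have "openin T {x \<in> topspace T. f x \<in> U}" if U: "open U" for U
  proof (subst openin_subopen, intro ballI)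
    fix x assume x: "x \<in> {x \<in> topspace T. f x \<in> U}"
    with * have "(f \<longlongrightarrow> f x) (nhdsin T x)" by blast
    then have "eventually (\<lambda>y. f y \<in> U) (nhdsin T x)"
      by (rule topological_tendstoD) (use U x in blast)+
    then obtain S where S: "openin T S" "x \<in> S" "\<forall>y\<in>S. f y \<in> U"
      using x unfolding eventually_nhdsin by blast
    then have "S \<subseteq> {x \<in> topspace T. f x \<in> U}" using openin_subset[OF S(1)] by blast
    with S show "\<exists>S. openin T S \<and> x \<in> S \<and> S \<subseteq> {x \<in> topspace T. f x \<in> U}" by blast
  qed
  then show "continuous_map T euclidean f" by (simp add: continuous_map_def)
qed

lemma continuous_map_times:
  fixes f :: "'a \<Rightarrow> 'b::real_normed_algebra"
  assumes "continuous_map T euclidean f" "continuous_map T euclidean g"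
  shows "continuous_map T euclidean (\<lambda>x. f x * g x)"
  using assms unfolding continuous_map_iff_nhdsin by (intro ballI tendsto_mult) blast+

lemma continuous_map_compose_cont:
  fixes f :: "'a \<Rightarrow> 'b::topological_space" and h :: "'b \<Rightarrow> 'c::topological_space"
  assumes "continuous_map T euclidean f" "continuous_on UNIV h"
  shows "continuous_map T euclidean (\<lambda>x. h (f x))"
  using continuous_map_compose[of T euclidean f euclidean h] assms
  by (simp add: o_def)

lemma continuous_map_of_realD:
  assumes "continuous_map T euclidean (\<lambda>v. complex_of_real (h v))"
  shows "continuous_map T euclidean h"
  using continuous_map_compose_cont[OF assms continuous_on_Re[OF continuous_on_id]] by simp

lemma continuous_map_cong_topspace:
  assumes "continuous_map T S f" "\<And>x. x \<in> topspace T \<Longrightarrow> f x = g x"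
  shows "continuous_map T S g"
  using assms continuous_map_eq by blast

lemma nhdsin_open_subtopology:
  assumes "openin T U" "x \<in> U"
  shows "nhdsin (subtopology T U) x = nhdsin T x"
proof (rule filter_eqI)
  fix P
  have xT: "x \<in> topspace T" using assms openin_subset by blast
  show "eventually P (nhdsin (subtopology T U) x) \<longleftrightarrow> eventually P (nhdsin T x)"
  proof
    assume "eventually P (nhdsin (subtopology T U) x)"
    then obtain S where "openin (subtopology T U) S" "x \<in> S" "\<forall>y\<in>S. P y"
      using xT assms unfolding eventually_nhdsin by auto
    then show "eventually P (nhdsin T x)"
      using assms eventually_nhdsin_openin[of T S x P] by (simp add: openin_open_subtopology)
  next
    assume "eventually P (nhdsin T x)"
    then obtain S where S: "openin T S" "x \<in> S" "\<forall>y\<in>S. P y"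
      using xT unfolding eventually_nhdsin by auto
    then have "openin (subtopology T U) (S \<inter> U)"
      using assms by (auto simp: openin_open_subtopology)
    with S assms(2) show "eventually P (nhdsin (subtopology T U) x)"
      using eventually_nhdsin_openin[of "subtopology T U" "S \<inter> U" x P] by simp
  qed
qed

text \<open>Continuity is local, and \<open>O'\<close> together with the complement of
  \<open>K\<close> covers the space; on that complement the function is constantly 0. It serves for
  functions given by a formula that makes sense only on \<open>O'\<close>.\<close>

lemma continuous_map_glue_zero:
  fixes f :: "'a \<Rightarrow> 'b::{zero,topological_space}"
  assumes O: "openin T O'" and K: "closedin T K" "K \<subseteq> O'"
    and f: "continuous_map (subtopology T O') euclidean f"
    and z: "\<And>x. x \<in> topspace T \<Longrightarrow> x \<notin> K \<Longrightarrow> f x = 0"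
  shows "continuous_map T euclidean f"
  unfolding continuous_map_iff_nhdsin
proof
  fix x assume x: "x \<in> topspace T"
  show "(f \<longlongrightarrow> f x) (nhdsin T x)"
  proof (cases "x \<in> O'")
    case True
    have "(f \<longlongrightarrow> f x) (nhdsin (subtopology T O') x)"
      using f x True by (simp add: continuous_map_iff_nhdsin)
    then show ?thesis using O True by (simp add: nhdsin_open_subtopology)
  next
    case False
    then have xK: "x \<in> topspace T - K" using K x by auto
    have "eventually (\<lambda>y. f x = f y) (nhdsin T x)"
      by (rule eventually_nhdsin_openin[of T "topspace T - K"])
        (use K xK z in \<open>simp_all add: openin_diff\<close>)
    then show ?thesis
      by (rule Lim_transform_eventually[OF tendsto_const])
  qed
qed

section \<open>Bump functions and partitions of unity on locally compact Hausdorff spaces\<close>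

lemma bump_function:
  assumes T: "locally_compact_space T" "Hausdorff_space T"
    and L: "compactin T L" "L \<subseteq> U" "openin T U"
  obtains \<phi> :: "'a \<Rightarrow> real" and C where "continuous_map T euclidean \<phi>" "\<And>x. 0 \<le> \<phi> x" "\<And>x. \<phi> x \<le> 1"
    "\<And>x. x \<in> L \<Longrightarrow> \<phi> x = 1" "compactin T C" "C \<subseteq> U" "\<And>x. x \<in> topspace T \<Longrightarrow> x \<notin> C \<Longrightarrow> \<phi> x = 0"
proof -
  \<comment> \<open>Taking the compact neighbourhood of \<open>L\<close> inside the open subspace
    \<open>U\<close>, rather than in \<open>T\<close>, is what gives
    \<open>C \<subseteq> U\<close>.\<close>
  define S where "S = subtopology T U"
  have S: "locally_compact_space S" "Hausdorff_space S"
    unfolding S_def using assms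
    by (auto intro: locally_compact_space_open_subset Hausdorff_space_subtopology)
  have "compactin S L" using L by (simp add: S_def compactin_subtopology)
  then obtain V C where VC: "openin S V" "compactin S C" "L \<subseteq> V" "V \<subseteq> C"
    using S locally_compact_space_compact_closed_compact[of S] by blast
  have V: "openin T V" "V \<subseteq> U" using VC(1) L(3) by (auto simp: S_def openin_open_subtopology)
  have C: "compactin T C" "C \<subseteq> U" using VC(2) by (auto simp: S_def compactin_subtopology)
  have "completely_regular_space T"
    using T locally_compact_Hausdorff_imp_regular_space locally_compact_regular_imp_completely_regular_space
    by blast
  moreover have "closedin T (topspace T - V)" using V by auto
  moreover have "disjnt L (topspace T - V)" using VC by (auto simp: disjnt_def)
  ultimately obtain g :: "'a \<Rightarrow> real" where g: "continuous_map T (top_of_set {0..1}) g"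
      "g ` (topspace T - V) \<subseteq> {0}" "g ` L \<subseteq> {1}"
    using Urysohn_completely_regular_compact_closed[of 0 1 T L "topspace T - V"] L by auto
  have g': "continuous_map T euclidean g" "g ` topspace T \<subseteq> {0..1}"
    using g(1) by (auto simp: continuous_map_in_subtopology)
  have "L \<subseteq> topspace T" using L compactin_subset_topspace by blast
  \<comment> \<open>Off the carrier the Urysohn function is unconstrained; the value 0 there makes
    the bounds \<open>0 \<le> \<phi> x\<close> and \<open>\<phi> x \<le> 1\<close> hold for all
    \<open>x\<close>.\<close>
  show thesis
  proof (rule that[of "\<lambda>x. if x \<in> topspace T then g x else 0"])
    show "continuous_map T euclidean (\<lambda>x. if x \<in> topspace T then g x else 0)"
      by (rule continuous_map_cong_topspace[OF g'(1)]) auto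
  qed (use g g' C VC \<open>L \<subseteq> topspace T\<close> in force)+
qed

text \<open>A partition of unity, multiplied by \<open>h\<close>.\<close>

lemma decompose_compact_support:
  fixes h :: "'a \<Rightarrow> complex"
  assumes T: "locally_compact_space T" "Hausdorff_space T"
    and h: "continuous_map T euclidean h" "\<And>x. x \<notin> L \<Longrightarrow> h x = 0" and L: "compactin T L"
    and O: "\<And>x. x \<in> L \<Longrightarrow> openin T (O' x) \<and> x \<in> O' x"
  obtains J hh C where "finite J" "J \<subseteq> L" "\<And>j. j \<in> J \<Longrightarrow> continuous_map T euclidean (hh j)"
    "\<And>j. j \<in> J \<Longrightarrow> compactin T (C j) \<and> C j \<subseteq> O' j"
    "\<And>j x. j \<in> J \<Longrightarrow> x \<notin> C j \<Longrightarrow> hh j x = 0" "\<And>x. h x = (\<Sum>j\<in>J. hh j x)"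
proof -
  have LT: "L \<subseteq> topspace T" using L compactin_subset_topspace by blast
  have "\<exists>\<phi> C. continuous_map T euclidean \<phi> \<and> (\<forall>x. 0 \<le> \<phi> x) \<and> \<phi> j = (1::real) \<and> compactin T C \<and> C \<subseteq> O' j
      \<and> (\<forall>x. x \<in> topspace T \<longrightarrow> x \<notin> C \<longrightarrow> \<phi> x = 0)" if j: "j \<in> L" for j
  proof -
    have "compactin T {j}" "{j} \<subseteq> O' j" "openin T (O' j)" using O[OF j] j LT by auto
    from bump_function[OF T this] obtain \<phi> :: "'a \<Rightarrow> real" and C where
      "continuous_map T euclidean \<phi>" "\<And>x. 0 \<le> \<phi> x"
      "\<And>x. x \<in> {j} \<Longrightarrow> \<phi> x = 1" "compactin T C" "C \<subseteq> O' j" "\<And>x. x \<in> topspace T \<Longrightarrow> x \<notin> C \<Longrightarrow> \<phi> x = 0"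
      by metis
    then show ?thesis by blast
  qed
  then have "\<forall>j\<in>L. \<exists>p. continuous_map T euclidean (fst p) \<and> (\<forall>x. 0 \<le> fst p x) \<and> fst p j = (1::real) \<and>
      compactin T (snd p) \<and> snd p \<subseteq> O' j \<and> (\<forall>x. x \<in> topspace T \<longrightarrow> x \<notin> snd p \<longrightarrow> fst p x = 0)"
    by (metis fst_conv snd_conv)
  from bchoice[OF this] obtain p where p: "\<forall>j\<in>L. continuous_map T euclidean (fst (p j)) \<and>
      (\<forall>x. 0 \<le> fst (p j) x) \<and> fst (p j) j = (1::real) \<and> compactin T (snd (p j)) \<and> snd (p j) \<subseteq> O' j \<and>
      (\<forall>x. x \<in> topspace T \<longrightarrow> x \<notin> snd (p j) \<longrightarrow> fst (p j) x = 0)"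
    by blast
  define \<phi> C where "\<phi> j = fst (p j)" and "C j = snd (p j)" for j
  have \<phi>: "\<And>j. j \<in> L \<Longrightarrow> continuous_map T euclidean (\<phi> j)"
     "\<And>j x. j \<in> L \<Longrightarrow> 0 \<le> \<phi> j x" "\<And>j. j \<in> L \<Longrightarrow> \<phi> j j = (1::real)"
    and C: "\<And>j. j \<in> L \<Longrightarrow> compactin T (C j) \<and> C j \<subseteq> O' j"
      "\<And>j x. j \<in> L \<Longrightarrow> x \<in> topspace T \<Longrightarrow> x \<notin> C j \<Longrightarrow> \<phi> j x = 0"
    using p unfolding \<phi>_def C_def by blast+
  define P where "P j = {x \<in> topspace T. \<phi> j x \<in> {1/2<..}}" for j
  have "openin T (P j)" if "j \<in> L" for j
    unfolding P_def using \<phi>(1)[OF that] by (rule openin_continuous_map_preimage) auto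
  moreover have "L \<subseteq> \<Union>(P ` L)" using LT \<phi>(3) by (force simp: P_def)
  ultimately have "\<exists>F. finite F \<and> F \<subseteq> P ` L \<and> L \<subseteq> \<Union>F"
    using L unfolding compactin_def by (metis imageE)
  then obtain J where J: "finite J" "J \<subseteq> L" "L \<subseteq> \<Union>(P ` J)"
    by (metis finite_subset_image)
  \<comment> \<open>Truncating below at 1/2 keeps the denominator positive on all of
    \<open>T\<close>, and changes nothing on \<open>L\<close>, where the choice of the sets
    \<open>P j\<close> makes the sum exceed 1/2.\<close>
  define \<Phi> where "\<Phi> x = max (1/2) (\<Sum>j\<in>J. \<phi> j x)" for x
  have "continuous_map T euclidean \<Phi>"
    using \<phi>(1) J unfolding \<Phi>_def continuous_map_iff_nhdsin
    by (intro ballI tendsto_max tendsto_const tendsto_sum) blast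
  have \<Phi>pos: "\<Phi> x > 0" for x by (auto simp: \<Phi>_def)
  have \<Phi>L: "\<Phi> x = (\<Sum>j\<in>J. \<phi> j x)" if "x \<in> L" for x
  proof -
    from J that obtain j where "j \<in> J" "x \<in> P j" by blast
    then have j: "j \<in> J" "\<phi> j x > 1/2" by (auto simp: P_def)
    have "\<phi> j x \<le> (\<Sum>j\<in>J. \<phi> j x)"
      by (rule member_le_sum) (use j J \<phi> in auto)
    then show ?thesis using j by (auto simp: \<Phi>_def)
  qed
  define hh where "hh j x = h x * of_real (\<phi> j x / \<Phi> x)" for j x
  show thesis
  proof (rule that[of J hh C])
    show "continuous_map T euclidean (hh j)" if "j \<in> J" for j
    proof -
      have "\<Phi> x \<noteq> 0" for x using \<Phi>pos[of x] by simp
      then show ?thesis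
        using h(1) \<phi>(1)[of j] J that \<open>continuous_map T euclidean \<Phi>\<close>
        unfolding hh_def continuous_map_iff_nhdsin
        by (intro ballI tendsto_mult tendsto_of_real tendsto_divide) blast+
    qed
    show "hh j x = 0" if "j \<in> J" "x \<notin> C j" for j x
      using h(2)[of x] C(2)[of j x] J that LT by (cases "x \<in> L") (auto simp: hh_def)
    show "h x = (\<Sum>j\<in>J. hh j x)" for x
    proof (cases "x \<in> L")
      case True
      then show ?thesis using \<Phi>pos[of x] \<Phi>L[OF True]
        by (simp add: hh_def flip: sum_distrib_left of_real_sum sum_divide_distrib)
    next
      case False
      then show ?thesis using h(2) by (simp add: hh_def)
    qed
  qed (use J C in auto)
qed

lemma continuous_map_uniform_limit:
  fixes f :: "'a \<Rightarrow> complex"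
  assumes "\<And>\<epsilon>. \<epsilon> > 0 \<Longrightarrow> \<exists>g. continuous_map T euclidean g \<and> (\<forall>x\<in>topspace T. cmod (f x - g x) \<le> \<epsilon>)"
  shows "continuous_map T euclidean f"
  unfolding continuous_map_iff_nhdsin
proof (intro ballI tendstoI)
  fix x \<epsilon> assume x: "x \<in> topspace T" and e: "\<epsilon> > (0::real)"
  \<comment> \<open>Three errors of at most \<open>\<epsilon>/4\<close> each leave room for the
    strict inequality.\<close>
  have "\<epsilon>/4 > 0" using e by simp
  from assms[OF this] obtain g
    where g: "continuous_map T euclidean g" "\<forall>x\<in>topspace T. cmod (f x - g x) \<le> \<epsilon>/4" by blast
  have "(g \<longlongrightarrow> g x) (nhdsin T x)"
    using g(1) x by (simp add: continuous_map_iff_nhdsin)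
  then have "eventually (\<lambda>y. dist (g y) (g x) < \<epsilon>/4) (nhdsin T x)"
    by (rule tendstoD) (use e in simp)
  moreover have "eventually (\<lambda>y. y \<in> topspace T) (nhdsin T x)"
    by (rule eventually_nhdsin_openin[of T "topspace T"]) (use x in auto)
  ultimately show "eventually (\<lambda>y. dist (f y) (f x) < \<epsilon>) (nhdsin T x)"
  proof eventually_elim
    case (elim y)
    have "f y - f x = (f y - g y) + (g y - g x) - (f x - g x)" by simp
    then have "cmod (f y - f x) \<le> cmod (f y - g y) + cmod (g y - g x) + cmod (f x - g x)"
      using norm_triangle_ineq[of "f y - g y" "g y - g x"] norm_triangle_ineq4[of "(f y - g y) + (g y - g x)" "f x - g x"]
      by simp
    moreover have "cmod (f x - g x) \<le> \<epsilon>/4" "cmod (f y - g y) \<le> \<epsilon>/4" using g(2) x elim by auto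
    ultimately show ?case using elim e by (simp add: dist_norm)
  qed
qed

section \<open>Square-summable functions\<close>

definition square_summable :: "('e \<Rightarrow> complex) \<Rightarrow> 'e set \<Rightarrow> bool" where
  "square_summable f S \<longleftrightarrow> (\<lambda>e. (cmod (f e))\<^sup>2) summable_on S"

definition l2norm :: "('e \<Rightarrow> complex) \<Rightarrow> 'e set \<Rightarrow> real" where
  "l2norm f S = sqrt (\<Sum>\<^sub>\<infinity>e\<in>S. (cmod (f e))\<^sup>2)"

lemma l2norm_nonneg [simp]: "0 \<le> l2norm f S"
  by (simp add: l2norm_def infsum_nonneg)

lemma l2norm_squared: "(l2norm f S)\<^sup>2 = (\<Sum>\<^sub>\<infinity>e\<in>S. (cmod (f e))\<^sup>2)"
  by (simp add: l2norm_def infsum_nonneg)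

lemma L2_set_le_l2norm:
  assumes "square_summable f S" "finite F" "F \<subseteq> S"
  shows "L2_set (\<lambda>e. cmod (f e)) F \<le> l2norm f S"
  unfolding L2_set_def l2norm_def
  by (rule real_sqrt_le_mono, rule finite_sum_le_infsum) (use assms in \<open>auto simp: square_summable_def\<close>)

text \<open>Bounds over finite subsets are the working form: there \<open>L2_set\<close> already
  satisfies the triangle and Cauchy-Schwarz inequalities, and a common bound \<open>B\<close> gives
  summability here and the norm estimate in \<open>l2norm_leI\<close>.\<close>

lemma square_summableI:
  assumes "\<And>F. finite F \<Longrightarrow> F \<subseteq> S \<Longrightarrow> L2_set (\<lambda>e. cmod (f e)) F \<le> B"
  shows "square_summable f S"
  unfolding square_summable_def
proof (rule nonneg_bounded_partial_sums_imp_summable_on)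
  have "(\<Sum>e\<in>F. (cmod (f e))\<^sup>2) \<le> B\<^sup>2" if "finite F" "F \<subseteq> S" for F
    using assms[OF that] real_sqrt_le_iff[of "\<Sum>e\<in>F. (cmod (f e))\<^sup>2" "B\<^sup>2"]
    by (simp add: L2_set_def) (metis abs_ge_self order_trans real_sqrt_abs real_sqrt_le_iff)
  then show "\<forall>\<^sub>F F in finite_subsets_at_top S. (\<Sum>e\<in>F. (cmod (f e))\<^sup>2) \<le> B\<^sup>2"
    by (auto intro: eventually_finite_subsets_at_top_weakI)
qed auto

lemma l2norm_leI:
  assumes "\<And>F. finite F \<Longrightarrow> F \<subseteq> S \<Longrightarrow> L2_set (\<lambda>e. cmod (f e)) F \<le> B"
  shows "l2norm f S \<le> B"
proof -
  have B: "0 \<le> B" using assms[of "{}"] by simp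
  have "(\<Sum>\<^sub>\<infinity>e\<in>S. (cmod (f e))\<^sup>2) \<le> B\<^sup>2"
  proof (rule infsum_le_finite_sums)
    show "(\<lambda>e. (cmod (f e))\<^sup>2) summable_on S"
      using square_summableI[OF assms] by (simp add: square_summable_def)
    show "(\<Sum>e\<in>F. (cmod (f e))\<^sup>2) \<le> B\<^sup>2" if "finite F" "F \<subseteq> S" for F
      using assms[OF that] by (simp add: L2_set_def sqrt_le_D)
  qed
  then show ?thesis using B by (simp add: l2norm_def real_le_lsqrt infsum_nonneg)
qed

lemma cmod_le_l2norm:
  assumes "square_summable f S" "e \<in> S"
  shows "cmod (f e) \<le> l2norm f S"
  using L2_set_le_l2norm[OF assms(1), of "{e}"] assms(2) by (simp add: L2_set_def)

lemma
  assumes f: "square_summable f S" and g: "square_summable g S"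
  shows square_summable_add: "square_summable (\<lambda>e. f e + g e) S"
    and l2norm_triangle: "l2norm (\<lambda>e. f e + g e) S \<le> l2norm f S + l2norm g S"
proof -
  have *: "L2_set (\<lambda>e. cmod (f e + g e)) F \<le> l2norm f S + l2norm g S" if "finite F" "F \<subseteq> S" for F
  proof -
    have "L2_set (\<lambda>e. cmod (f e + g e)) F \<le> L2_set (\<lambda>e. cmod (f e) + cmod (g e)) F"
      by (rule L2_set_mono) (auto simp: norm_triangle_ineq)
    also have "\<dots> \<le> L2_set (\<lambda>e. cmod (f e)) F + L2_set (\<lambda>e. cmod (g e)) F"
      by (rule L2_set_triangle_ineq)
    also have "\<dots> \<le> l2norm f S + l2norm g S"
      using L2_set_le_l2norm that f g by (intro add_mono) auto
    finally show ?thesis .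
  qed
  show "square_summable (\<lambda>e. f e + g e) S" using * by (rule square_summableI)
  show "l2norm (\<lambda>e. f e + g e) S \<le> l2norm f S + l2norm g S" using * by (rule l2norm_leI)
qed

lemma
  assumes f: "square_summable f S" and B: "0 \<le> B" "\<And>e. e \<in> S \<Longrightarrow> cmod (g e) \<le> B * cmod (f e)"
  shows square_summable_dominated: "square_summable g S"
    and l2norm_dominated: "l2norm g S \<le> B * l2norm f S"
proof -
  have *: "L2_set (\<lambda>e. cmod (g e)) F \<le> B * l2norm f S" if F: "finite F" "F \<subseteq> S" for F
  proof -
    have "L2_set (\<lambda>e. cmod (g e)) F \<le> L2_set (\<lambda>e. B * cmod (f e)) F"
      by (rule L2_set_mono) (use F B in auto)
    also have "\<dots> = B * L2_set (\<lambda>e. cmod (f e)) F"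
      using B by (simp add: L2_set_right_distrib)
    also have "\<dots> \<le> B * l2norm f S"
      using L2_set_le_l2norm F f B by (intro mult_left_mono) auto
    finally show ?thesis .
  qed
  show "square_summable g S" using * by (rule square_summableI)
  show "l2norm g S \<le> B * l2norm f S" using * by (rule l2norm_leI)
qed

text \<open>Cauchy-Schwarz on every finite subset bounds the sums of absolute values by one number,
  so absolute summability and the estimate come out together.\<close>

lemma
  assumes f: "square_summable f S" and g: "square_summable g S"
  shows summable_cnj_mult: "(\<lambda>e. cnj (f e) * g e) summable_on S"
    and infsum_cnj_mult_le: "cmod (\<Sum>\<^sub>\<infinity>e\<in>S. cnj (f e) * g e) \<le> l2norm f S * l2norm g S"
proof -
  have *: "(\<Sum>e\<in>F. norm (cnj (f e) * g e)) \<le> l2norm f S * l2norm g S" if F: "finite F" "F \<subseteq> S" for F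
  proof -
    have "(\<Sum>e\<in>F. norm (cnj (f e) * g e)) = (\<Sum>e\<in>F. \<bar>cmod (f e)\<bar> * \<bar>cmod (g e)\<bar>)"
      by (simp add: norm_mult)
    also have "\<dots> \<le> L2_set (\<lambda>e. cmod (f e)) F * L2_set (\<lambda>e. cmod (g e)) F"
      by (rule L2_set_mult_ineq)
    also have "\<dots> \<le> l2norm f S * l2norm g S"
      using L2_set_le_l2norm F f g by (intro mult_mono) auto
    finally show ?thesis .
  qed
  have abs: "(\<lambda>e. norm (cnj (f e) * g e)) summable_on S"
    by (rule nonneg_bounded_partial_sums_imp_summable_on[where C = "l2norm f S * l2norm g S"])
      (use * in \<open>auto intro: eventually_finite_subsets_at_top_weakI\<close>)
  then show "(\<lambda>e. cnj (f e) * g e) summable_on S" by (rule abs_summable_summable)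
  have "cmod (\<Sum>\<^sub>\<infinity>e\<in>S. cnj (f e) * g e) \<le> (\<Sum>\<^sub>\<infinity>e\<in>S. norm (cnj (f e) * g e))"
    using abs by (rule norm_infsum_bound)
  also have "\<dots> \<le> l2norm f S * l2norm g S"
    using abs * by (rule infsum_le_finite_sums)
  finally show "cmod (\<Sum>\<^sub>\<infinity>e\<in>S. cnj (f e) * g e) \<le> l2norm f S * l2norm g S" .
qed

lemma mult_le_sum_squares:
  fixes x y :: real
  assumes "0 \<le> x" "0 \<le> y"
  shows "x * y \<le> x\<^sup>2 + y\<^sup>2"
proof -
  have "x * y \<le> 2 * x * y" using assms by simp
  also have "\<dots> \<le> x\<^sup>2 + y\<^sup>2" by (rule sum_squares_bound)
  finally show ?thesis .
qed

lemma cnj_mult_self_infsum: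
  assumes "square_summable f S"
  shows "(\<Sum>\<^sub>\<infinity>e\<in>S. cnj (f e) * f e) = of_real ((l2norm f S)\<^sup>2)"
proof -
  have "cnj (f e) * f e = of_real ((cmod (f e))\<^sup>2)" for e
    using complex_norm_square[of "f e"] by (simp add: mult.commute)
  then have "(\<Sum>\<^sub>\<infinity>e\<in>S. cnj (f e) * f e) = (\<Sum>\<^sub>\<infinity>e\<in>S. of_real ((cmod (f e))\<^sup>2))" by simp
  also have "\<dots> = of_real (\<Sum>\<^sub>\<infinity>e\<in>S. (cmod (f e))\<^sup>2)"
    using assms unfolding square_summable_def by (intro infsumI has_sum_of_real has_sum_infsum)
  finally show ?thesis by (simp only: l2norm_squared)
qed

text \<open>Summability of a complex family is unconditional, hence absolute, and the absolute
  values here are the squares.\<close>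

lemma square_summable_iff:
  "square_summable f S \<longleftrightarrow> (\<lambda>e. cnj (f e) * f e) summable_on S"
proof
  assume "square_summable f S"
  then show "(\<lambda>e. cnj (f e) * f e) summable_on S" by (simp add: summable_cnj_mult)
next
  assume "(\<lambda>e. cnj (f e) * f e) summable_on S"
  then have "(\<lambda>e. norm (cnj (f e) * f e)) summable_on S"
    by (rule summable_on_iff_abs_summable_on_complex[THEN iffD1])
  then show "square_summable f S" by (simp add: square_summable_def norm_mult power2_eq_square)
qed

section \<open>Functions vanishing at infinity\<close>

abbreviation (input) supnorm :: "('v \<Rightarrow> complex) \<Rightarrow> real" where
  "supnorm g \<equiv> (SUP v. cmod (g v))"

lemma C0_continuous: "g \<in> C0_functions T \<Longrightarrow> continuous_map T euclidean g"
  and C0_outside: "g \<in> C0_functions T \<Longrightarrow> v \<notin> topspace T \<Longrightarrow> g v = 0"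
  and C0_compact: "g \<in> C0_functions T \<Longrightarrow> \<epsilon> > 0 \<Longrightarrow> compactin T {v \<in> topspace T. \<epsilon> \<le> cmod (g v)}"
  by (auto simp: C0_functions_def)

text \<open>Superlevel sets of a continuous function are closed, so it is enough to enclose each of
  them in some compact set.\<close>

lemma C0_I:
  assumes c: "continuous_map T euclidean g" and o: "\<And>v. v \<notin> topspace T \<Longrightarrow> g v = 0"
    and k: "\<And>\<epsilon>. \<epsilon> > 0 \<Longrightarrow> \<exists>K. compactin T K \<and> {v \<in> topspace T. \<epsilon> \<le> cmod (g v)} \<subseteq> K"
  shows "g \<in> C0_functions T"
proof -
  have "compactin T {v \<in> topspace T. \<epsilon> \<le> cmod (g v)}" if "\<epsilon> > 0" for \<epsilon>
  proof -
    have "continuous_map T euclidean (\<lambda>v. cmod (g v))"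
      by (intro continuous_map_compose_cont[OF c] continuous_intros)
    then have "closedin T {v \<in> topspace T. cmod (g v) \<in> {\<epsilon>..}}"
      by (rule closedin_continuous_map_preimage) auto
    moreover obtain K where "compactin T K" "{v \<in> topspace T. \<epsilon> \<le> cmod (g v)} \<subseteq> K"
      using k[OF \<open>\<epsilon> > 0\<close>] by blast
    ultimately show ?thesis using closed_compactin by auto
  qed
  then show ?thesis using c o by (auto simp: C0_functions_def)
qed

lemma C0_bdd:
  assumes "g \<in> C0_functions T"
  shows "bdd_above (range (\<lambda>v. cmod (g v)))"
proof -
  let ?K = "{v \<in> topspace T. 1 \<le> cmod (g v)}"
  have "compactin euclidean (g ` ?K)"
    using C0_compact[OF assms, of 1] C0_continuous[OF assms] image_compactin by fastforce
  then have "bounded (g ` ?K)" by (simp add: compact_imp_bounded)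
  then obtain B where B: "\<And>v. v \<in> ?K \<Longrightarrow> cmod (g v) \<le> B" by (auto simp: bounded_iff)
  have "cmod (g v) \<le> max 1 B" for v
    using B[of v] C0_outside[OF assms, of v] by (cases "v \<in> topspace T") force+
  then show ?thesis by (rule bdd_aboveI2)
qed

lemma cmod_le_supnorm:
  assumes "g \<in> C0_functions T"
  shows "cmod (g v) \<le> supnorm g"
  using C0_bdd[OF assms] by (auto intro: cSUP_upper)

lemma supnorm_leI: "(\<And>v. cmod (g v) \<le> B) \<Longrightarrow> supnorm g \<le> B"
  by (rule cSUP_least) auto

lemma supnorm_nonneg: "g \<in> C0_functions T \<Longrightarrow> 0 \<le> supnorm g"
  using cmod_le_supnorm[of g T undefined] norm_ge_zero order_trans by blast

lemma C0_dominated: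
  assumes c: "continuous_map T euclidean g" and o: "\<And>v. v \<notin> topspace T \<Longrightarrow> g v = 0"
    and f: "f \<in> C0_functions T" and B: "\<And>v. v \<in> topspace T \<Longrightarrow> cmod (g v) \<le> B * cmod (f v)"
  shows "g \<in> C0_functions T"
proof (rule C0_I[OF c o])
  fix \<epsilon> :: real assume e: "\<epsilon> > 0"
  \<comment> \<open>\<open>B\<close> may be 0 or negative, and the threshold
    \<open>\<epsilon> / ?B\<close> has to be positive.\<close>
  let ?B = "max B 1"
  have "\<epsilon> / ?B \<le> cmod (f v)" if "v \<in> topspace T" "\<epsilon> \<le> cmod (g v)" for v
  proof -
    have "\<epsilon> \<le> B * cmod (f v)" using that B[of v] by linarith
    also have "\<dots> \<le> ?B * cmod (f v)" by (rule mult_right_mono) auto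
    finally show ?thesis by (simp add: pos_divide_le_eq mult.commute)
  qed
  then show "\<exists>K. compactin T K \<and> {v \<in> topspace T. \<epsilon> \<le> cmod (g v)} \<subseteq> K"
    using C0_compact[OF f, of "\<epsilon> / ?B"] e by (intro exI[of _ "{v \<in> topspace T. \<epsilon> / ?B \<le> cmod (f v)}"]) auto
qed

lemma C0_zero: "(\<lambda>_. 0) \<in> C0_functions T"
  by (rule C0_I) (auto intro: exI[of _ "{}"])

lemma C0_add:
  assumes f: "f \<in> C0_functions T" and g: "g \<in> C0_functions T"
  shows "(\<lambda>v. f v + g v) \<in> C0_functions T"
proof (rule C0_I)
  show "continuous_map T euclidean (\<lambda>v. f v + g v)"
    using C0_continuous[OF f] C0_continuous[OF g]
    unfolding continuous_map_iff_nhdsin by (intro ballI tendsto_add) blast+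
  fix \<epsilon> :: real assume e: "\<epsilon> > 0"
  have "\<epsilon>/2 \<le> cmod (f v) \<or> \<epsilon>/2 \<le> cmod (g v)" if "\<epsilon> \<le> cmod (f v + g v)" for v
    using norm_triangle_ineq[of "f v" "g v"] that by linarith
  then show "\<exists>K. compactin T K \<and> {v \<in> topspace T. \<epsilon> \<le> cmod (f v + g v)} \<subseteq> K"
    using C0_compact[OF f, of "\<epsilon>/2"] C0_compact[OF g, of "\<epsilon>/2"] e
    by (intro exI[of _ "{v \<in> topspace T. \<epsilon>/2 \<le> cmod (f v)} \<union> {v \<in> topspace T. \<epsilon>/2 \<le> cmod (g v)}"])
      (auto intro: compactin_Un)
qed (use C0_outside[OF f] C0_outside[OF g] in auto)

lemma C0_bounded_mult:
  assumes f: "f \<in> C0_functions T" and g: "continuous_map T euclidean g"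
    and B: "\<And>v. v \<in> topspace T \<Longrightarrow> cmod (g v) \<le> B"
  shows "(\<lambda>v. g v * f v) \<in> C0_functions T"
proof (rule C0_dominated[OF _ _ f])
  show "continuous_map T euclidean (\<lambda>v. g v * f v)"
    using C0_continuous[OF f] g by (rule continuous_map_times[rotated])
  show "v \<in> topspace T \<Longrightarrow> cmod (g v * f v) \<le> B * cmod (f v)" for v
    using B by (simp add: norm_mult mult_right_mono)
qed (simp add: C0_outside[OF f])

lemma C0_mult:
  assumes f: "f \<in> C0_functions T" and g: "g \<in> C0_functions T"
  shows "(\<lambda>v. g v * f v) \<in> C0_functions T"
  by (rule C0_bounded_mult[OF f C0_continuous[OF g]]) (rule cmod_le_supnorm[OF g])

lemma C0_scale:
  assumes f: "f \<in> C0_functions T"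
  shows "(\<lambda>v. z * f v) \<in> C0_functions T"
  by (rule C0_bounded_mult[OF f, of "\<lambda>_. z" "cmod z"]) auto

text \<open>The last assumption is continuity of \<open>h\<close> at its zero 0. The two uses are
  complex conjugation and the square root of the modulus; the latter turns
  \<open>\<langle>f, f\<rangle>\<close> into the fibrewise norm of \<open>f\<close>.\<close>

lemma C0_compose:
  assumes f: "f \<in> C0_functions T" and h: "continuous_on UNIV h" "h 0 = 0"
    and B: "\<And>\<epsilon>. \<epsilon> > 0 \<Longrightarrow> \<exists>\<delta>>0. \<forall>z. cmod z < \<delta> \<longrightarrow> cmod (h z) < \<epsilon>"
  shows "(\<lambda>v. h (f v)) \<in> C0_functions T"
proof (rule C0_I)
  show "continuous_map T euclidean (\<lambda>v. h (f v))"
    using C0_continuous[OF f] h(1) by (rule continuous_map_compose_cont)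
  fix \<epsilon> :: real assume "\<epsilon> > 0"
  then obtain \<delta> where d: "\<delta> > 0" "\<And>z. cmod z < \<delta> \<Longrightarrow> cmod (h z) < \<epsilon>" using B by blast
  have "{v \<in> topspace T. \<epsilon> \<le> cmod (h (f v))} \<subseteq> {v \<in> topspace T. \<delta> \<le> cmod (f v)}"
    using d(2) by (auto simp: not_less[symmetric])
  then show "\<exists>K. compactin T K \<and> {v \<in> topspace T. \<epsilon> \<le> cmod (h (f v))} \<subseteq> K"
    using C0_compact[OF f d(1)] by blast
qed (use h C0_outside[OF f] in auto)

lemma C0_uniform_limit:
  assumes "\<And>\<epsilon>. \<epsilon> > 0 \<Longrightarrow> \<exists>g\<in>C0_functions T. \<forall>v. cmod (f v - g v) \<le> \<epsilon>"
  shows "f \<in> C0_functions T"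
proof (rule C0_I)
  show "continuous_map T euclidean f"
  proof (rule continuous_map_uniform_limit)
    fix \<epsilon> :: real assume "\<epsilon> > 0"
    then obtain g where "g \<in> C0_functions T" "\<forall>v. cmod (f v - g v) \<le> \<epsilon>" using assms by blast
    then show "\<exists>g. continuous_map T euclidean g \<and> (\<forall>x\<in>topspace T. cmod (f x - g x) \<le> \<epsilon>)"
      using C0_continuous by (intro exI[of _ g]) simp
  qed
  fix \<epsilon> :: real assume e: "\<epsilon> > 0"
  obtain g where g: "g \<in> C0_functions T" "\<And>v. cmod (f v - g v) \<le> \<epsilon>/2"
    using assms[of "\<epsilon>/2"] e by auto
  have "\<epsilon>/2 \<le> cmod (g v)" if "\<epsilon> \<le> cmod (f v)" for v
    using norm_triangle_sub[of "f v" "g v"] g(2)[of v] that by linarith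
  then show "\<exists>K. compactin T K \<and> {v \<in> topspace T. \<epsilon> \<le> cmod (f v)} \<subseteq> K"
    using C0_compact[OF g(1), of "\<epsilon>/2"] e by (intro exI[of _ "{v \<in> topspace T. \<epsilon>/2 \<le> cmod (g v)}"]) auto
next
  fix v assume v: "v \<notin> topspace T"
  have "cmod (f v) \<le> \<epsilon>" if "\<epsilon> > 0" for \<epsilon>
  proof -
    obtain g where "g \<in> C0_functions T" "cmod (f v - g v) \<le> \<epsilon>" using assms[OF \<open>\<epsilon> > 0\<close>] by blast
    then show ?thesis using C0_outside[of g T v] v by simp
  qed
  then show "f v = 0" using field_le_epsilon[of "cmod (f v)" 0] by auto
qed

section \<open>The C*-algebra of functions vanishing at infinity\<close>

lemma C0_algebra_simps [simp]:
  "ca_set (C0_algebra T) = C0_functions T" "ca_zero (C0_algebra T) = (\<lambda>_. 0)"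
  "ca_add (C0_algebra T) = (\<lambda>g h v. g v + h v)" "ca_scale (C0_algebra T) = (\<lambda>z g v. z * g v)"
  "ca_mult (C0_algebra T) = (\<lambda>g h v. g v * h v)" "ca_star (C0_algebra T) = (\<lambda>g v. cnj (g v))"
  "ca_norm (C0_algebra T) = (\<lambda>g. SUP v. cmod (g v))"
  by (simp_all add: C0_algebra_def)

lemma ca_dist_C0: "ca_dist (C0_algebra T) f g = (SUP v. cmod (f v - g v))"
  by (simp add: ca_dist_def)

lemma C0_diff:
  assumes "f \<in> C0_functions T" "g \<in> C0_functions T"
  shows "(\<lambda>v. f v - g v) \<in> C0_functions T"
  using C0_add[OF assms(1) C0_scale[OF assms(2), of "-1"]] by simp

lemma C0_cnj:
  assumes "f \<in> C0_functions T"
  shows "(\<lambda>v. cnj (f v)) \<in> C0_functions T"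
  by (rule C0_compose[OF assms]) (auto intro!: continuous_intros)

lemma C0_complete: "complete_wrt (ca_dist (C0_algebra T)) (C0_functions T)"
  unfolding complete_wrt_def
proof (intro allI impI, elim conjE)
  fix u :: "nat \<Rightarrow> 'a \<Rightarrow> complex"
  assume "range u \<subseteq> C0_functions T" and c: "cauchy_wrt (ca_dist (C0_algebra T)) u"
  then have u: "u i \<in> C0_functions T" for i by auto
  have "\<exists>N. \<forall>i\<ge>N. \<forall>j\<ge>N. \<forall>v. cmod (u i v - u j v) < \<epsilon>" if "\<epsilon> > 0" for \<epsilon>
    using c that cmod_le_supnorm[OF C0_diff[OF u u]]
    unfolding cauchy_wrt_def ca_dist_C0 by (meson order_le_less_trans)
  note c' = this
  have "Cauchy (\<lambda>i. u i v)" for v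
    unfolding Cauchy_def dist_norm using c' by blast
  then have l: "(\<lambda>i. u i v) \<longlonglongrightarrow> l v" if "l = (\<lambda>v. lim (\<lambda>i. u i v))" for v l
    unfolding that by (simp add: Cauchy_convergent_iff convergent_LIMSEQ_iff)
  define l where "l = (\<lambda>v. lim (\<lambda>i. u i v))"
  note l = l[OF l_def]
  have lim: "\<exists>N. \<forall>i\<ge>N. \<forall>v. cmod (u i v - l v) \<le> \<epsilon>" if "\<epsilon> > 0" for \<epsilon>
  proof -
    obtain N where N: "\<And>i j v. i \<ge> N \<Longrightarrow> j \<ge> N \<Longrightarrow> cmod (u i v - u j v) < \<epsilon>"
      using c' \<open>\<epsilon> > 0\<close> by meson
    have "cmod (u i v - l v) \<le> \<epsilon>" if "i \<ge> N" for i v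
    proof (rule tendsto_upperbound)
      show "(\<lambda>j. cmod (u i v - u j v)) \<longlonglongrightarrow> cmod (u i v - l v)"
        by (intro tendsto_intros l)
      show "\<forall>\<^sub>F j in sequentially. cmod (u i v - u j v) \<le> \<epsilon>"
        unfolding eventually_sequentially using N[OF that] by (meson less_imp_le)
    qed auto
    then show ?thesis by blast
  qed
  have lC: "l \<in> C0_functions T"
  proof (rule C0_uniform_limit)
    fix \<epsilon> :: real assume "\<epsilon> > 0"
    then obtain N where "\<And>v. cmod (u N v - l v) \<le> \<epsilon>" using lim by blast
    then show "\<exists>g\<in>C0_functions T. \<forall>v. cmod (l v - g v) \<le> \<epsilon>"
      using u by (intro bexI[of _ "u N"]) (auto simp: norm_minus_commute)
  qed
  have "(\<lambda>i. ca_dist (C0_algebra T) (u i) l) \<longlonglongrightarrow> 0"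
    unfolding ca_dist_C0
  proof (rule LIMSEQ_I)
    fix \<epsilon> :: real assume e: "\<epsilon> > 0"
    then obtain N where N: "\<And>i v. i \<ge> N \<Longrightarrow> cmod (u i v - l v) \<le> \<epsilon>/2" using lim[of "\<epsilon>/2"] by auto
    have "norm ((SUP v. cmod (u i v - l v)) - 0) < \<epsilon>" if "i \<ge> N" for i
      using supnorm_leI[of "\<lambda>v. u i v - l v", OF N[OF that]] supnorm_nonneg[OF C0_diff[OF u lC]] e by simp
    then show "\<exists>N. \<forall>i\<ge>N. norm ((SUP v. cmod (u i v - l v)) - 0) < \<epsilon>" by blast
  qed
  with lC show "\<exists>l\<in>C0_functions T. (\<lambda>i. ca_dist (C0_algebra T) (u i) l) \<longlonglongrightarrow> 0" by blast
qed

text \<open>Convergence in the supremum norm forces pointwise convergence, whose limits are unique.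
  The inner product of the tensor product is a definite description of such a limit, and uniqueness
  is what makes the description denote.\<close>

lemma ca_dist_C0_unique:
  assumes f: "\<And>i. f i \<in> C0_functions T" and a: "a \<in> C0_functions T" and b: "b \<in> C0_functions T"
    and lim: "(\<lambda>i. ca_dist (C0_algebra T) (f i) a) \<longlonglongrightarrow> 0" "(\<lambda>i. ca_dist (C0_algebra T) (f i) b) \<longlonglongrightarrow> 0"
  shows "a = b"
proof
  fix v
  have conv: "(\<lambda>i. f i v) \<longlonglongrightarrow> c v" if c: "c \<in> C0_functions T" and "(\<lambda>i. ca_dist (C0_algebra T) (f i) c) \<longlonglongrightarrow> 0" for c
  proof -
    have "cmod (f i v - c v) \<le> ca_dist (C0_algebra T) (f i) c" for i
      unfolding ca_dist_C0 by (rule cmod_le_supnorm[OF C0_diff[OF f c]])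
    then have "(\<lambda>i. f i v - c v) \<longlonglongrightarrow> 0"
      by (intro Lim_null_comparison[OF _ that(2)]) simp
    then show ?thesis by (simp add: LIM_zero_iff)
  qed
  show "a v = b v" using LIMSEQ_unique[OF conv[OF a lim(1)] conv[OF b lim(2)]] .
qed

lemma cstar_algebra_C0: "cstar_algebra (C0_algebra T)"
proof (unfold_locales, goal_cases)
  \<comment> \<open>Goal 7 is the additive inverse, goals 23 to 28 are the norm axioms and goal 29
    is completeness; the others are closure facts and pointwise identities.\<close>
  case (7 x)
  then show ?case by (intro bexI[of _ "\<lambda>v. - x v"]) (use C0_scale[of x T "-1"] in auto)
next
  case (23 a)
  then show ?case by (simp add: supnorm_nonneg)
next
  case (24 a)
  show ?case
  proof
    assume "ca_norm (C0_algebra T) a = 0"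
    then have "cmod (a v) \<le> 0" for v using cmod_le_supnorm[of a T v] 24 by simp
    then show "a = ca_zero (C0_algebra T)" by auto
  qed simp
next
  case (25 a b)
  show ?case
    using cmod_le_supnorm[of a T] cmod_le_supnorm[of b T] 25
    by (auto intro!: supnorm_leI norm_triangle_le add_mono)
next
  case (26 a z)
  then have "bdd_above (range (\<lambda>v. cmod (a v)))" by (simp add: C0_bdd)
  have "(SUP v. cmod z * cmod (a v)) = cmod z * (SUP v. cmod (a v))"
  proof (cases "z = 0")
    case False
    show ?thesis
    proof (rule antisym)
      show "(SUP v. cmod z * cmod (a v)) \<le> cmod z * (SUP v. cmod (a v))"
        by (rule cSUP_least) (use cmod_le_supnorm[of a T] 26 in \<open>auto intro!: mult_left_mono\<close>)
      have "cmod (a v) \<le> (SUP v. cmod z * cmod (a v)) / cmod z" for v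
        using cmod_le_supnorm[OF C0_scale, of a T z v] 26 False
        by (simp add: pos_le_divide_eq norm_mult mult.commute)
      then have "(SUP v. cmod (a v)) \<le> (SUP v. cmod z * cmod (a v)) / cmod z" by (rule supnorm_leI)
      then show "cmod z * (SUP v. cmod (a v)) \<le> (SUP v. cmod z * cmod (a v))"
        using False by (simp add: pos_le_divide_eq mult.commute)
    qed
  qed simp
  then show ?case by (simp add: norm_mult)
next
  case (27 a b)
  show ?case
    using cmod_le_supnorm[of a T] cmod_le_supnorm[of b T] 27 supnorm_nonneg[of a T]
    by (auto intro!: cSUP_least mult_mono simp: norm_mult)
next
  case (28 a)
  then have a: "a \<in> C0_functions T" by simp
  have "(\<lambda>v. cnj (a v) * a v) \<in> C0_functions T" using C0_mult[OF a C0_cnj[OF a]] .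
  have "(SUP v. (cmod (a v))\<^sup>2) = (SUP v. cmod (a v))\<^sup>2"
  proof (rule antisym)
    show "(SUP v. (cmod (a v))\<^sup>2) \<le> (SUP v. cmod (a v))\<^sup>2"
      by (rule cSUP_least) (use cmod_le_supnorm[OF a] in \<open>auto intro!: power_mono\<close>)
    have "(cmod (a v))\<^sup>2 \<le> (SUP v. (cmod (a v))\<^sup>2)" for v
      using cmod_le_supnorm[OF C0_mult[OF a C0_cnj[OF a]], of v] by (simp add: norm_mult power2_eq_square)
    then have "cmod (a v) \<le> sqrt (SUP v. (cmod (a v))\<^sup>2)" for v by (simp add: real_le_rsqrt)
    then have "(SUP v. cmod (a v)) \<le> sqrt (SUP v. (cmod (a v))\<^sup>2)" by (rule supnorm_leI)
    then show "(SUP v. cmod (a v))\<^sup>2 \<le> (SUP v. (cmod (a v))\<^sup>2)"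
      using supnorm_nonneg[OF a] by (smt (verit) power_mono real_sqrt_pow2 real_sqrt_ge_0_iff zero_le_power2)
  qed
  then show ?case by (simp add: norm_mult power2_eq_square)
next
  case 29
  then show ?case by (simp add: C0_complete)
qed (auto simp: C0_zero C0_add C0_scale C0_mult C0_cnj algebra_simps)

section \<open>Fibrewise sums over a local homeomorphism\<close>

text \<open>Each level of a higher-rank graph will be an instance, so the module theory is developed
  for one graph at a time.\<close>

locale locally_compact_graph =
  fixes E :: "('v, 'e) topological_graph"
  assumes hausdorff_vertices: "Hausdorff_space (tg_vertices E)"
    and hausdorff_edges: "Hausdorff_space (tg_edges E)"
    and locally_compact_vertices: "locally_compact_space (tg_vertices E)"
    and locally_compact_edges: "locally_compact_space (tg_edges E)"
    and continuous_rng: "continuous_map (tg_edges E) (tg_vertices E) (tg_rng E)"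
    and continuous_src: "continuous_map (tg_edges E) (tg_vertices E) (tg_src E)"
    and local_homeo_src: "local_homeomorphism (tg_edges E) (tg_vertices E) (tg_src E)"
begin

abbreviation "VT \<equiv> tg_vertices E"
abbreviation "ET \<equiv> tg_edges E"
abbreviation "fib \<equiv> source_fibre E"
abbreviation "A \<equiv> C0_algebra VT"
abbreviation "X \<equiv> graph_correspondence E"

definition open_section :: "'e set \<Rightarrow> bool" where
  "open_section U \<longleftrightarrow> openin ET U \<and> openin VT (tg_src E ` U) \<and>
     homeomorphic_map (subtopology ET U) (subtopology VT (tg_src E ` U)) (tg_src E)"

lemma ex_open_section: "e \<in> topspace ET \<Longrightarrow> \<exists>U. open_section U \<and> e \<in> U"
  using local_homeo_src unfolding local_homeomorphism_def open_section_def by blast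

lemma open_section_subset: "open_section U \<Longrightarrow> U \<subseteq> topspace ET"
  unfolding open_section_def using openin_subset by blast

text \<open>The local inverse \<open>\<sigma>\<close> picks the unique edge of \<open>U\<close> over
  each vertex of its image; it moves questions about edges to neighbourhoods of vertices.\<close>

lemma open_section_inverse:
  assumes "open_section U"
  obtains \<sigma> where "continuous_map (subtopology VT (tg_src E ` U)) ET \<sigma>"
    "\<And>v. v \<in> tg_src E ` U \<Longrightarrow> \<sigma> v \<in> U \<and> tg_src E (\<sigma> v) = v" "\<And>e. e \<in> U \<Longrightarrow> \<sigma> (tg_src E e) = e"
proof -
  have U: "U \<subseteq> topspace ET" "tg_src E ` U \<subseteq> topspace VT"
    using assms unfolding open_section_def using openin_subset by blast+
  obtain \<sigma> where \<sigma>: "homeomorphic_maps (subtopology ET U) (subtopology VT (tg_src E ` U)) (tg_src E) \<sigma>"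
    using assms unfolding open_section_def homeomorphic_map_maps by blast
  then have c: "continuous_map (subtopology VT (tg_src E ` U)) (subtopology ET U) \<sigma>"
    and i: "\<And>e. e \<in> U \<Longrightarrow> \<sigma> (tg_src E e) = e"
    using U unfolding homeomorphic_maps_def by auto
  show thesis
    by (rule that[of \<sigma>]) (use c i in \<open>auto simp: continuous_map_in_subtopology\<close>)
qed

lemma fib_iff: "e \<in> fib v \<longleftrightarrow> e \<in> topspace ET \<and> tg_src E e = v"
  by (auto simp: source_fibre_def)

lemma src_in: "e \<in> topspace ET \<Longrightarrow> tg_src E e \<in> topspace VT"
  using continuous_map_image_subset_topspace[OF continuous_src] by blast

lemma fib_empty: "v \<notin> topspace VT \<Longrightarrow> fib v = {}"
  using src_in by (auto simp: fib_iff)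

text \<open>Finitely many local sections of the source map exhaust the sum of \<open>G\<close> over the fibre of \<open>v0\<close> up to
  \<open>\<epsilon>\<close>.  Continuity of the total sum spreads this to a neighbourhood, and so substitutes for the local
  uniform convergence of fibrewise sums.\<close>

lemma small_tails:
  fixes G :: "'e \<Rightarrow> real"
  assumes G: "continuous_map ET euclidean G" "\<And>e. e \<in> topspace ET \<Longrightarrow> 0 \<le> G e"
    and sG: "\<And>v. G summable_on fib v" and cG: "continuous_map VT euclidean (\<lambda>v. infsum G (fib v))"
    and v0: "v0 \<in> topspace VT" and \<epsilon>: "\<epsilon> > 0"
  shows "\<exists>N F \<sigma>. openin VT N \<and> v0 \<in> N \<and> finite F \<and>
    (\<forall>e\<in>F. continuous_map (subtopology VT N) ET (\<sigma> e)) \<and>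
    (\<forall>v\<in>N. \<forall>e\<in>F. \<sigma> e v \<in> fib v) \<and>
    (\<forall>v\<in>N. inj_on (\<lambda>e. \<sigma> e v) (F :: 'e set)) \<and>
    (\<forall>v\<in>N. infsum G (fib v - (\<lambda>e. \<sigma> e v) ` F) < \<epsilon>)"
proof -
  \<comment> \<open>\<open>\<epsilon>/2\<close> because the approximation is only
    \<open>\<le>\<close>, whereas a strict inequality at \<open>v0\<close> is needed if it is to
    persist nearby.\<close>
  obtain F where F: "finite F" "F \<subseteq> fib v0" "dist (sum G F) (infsum G (fib v0)) \<le> \<epsilon>/2"
    using infsum_finite_approximation[OF sG, of "\<epsilon>/2" v0] \<epsilon> by auto
  have Fd: "infsum G (fib v0) - sum G F < \<epsilon>" using F(3) \<epsilon> unfolding dist_real_def by linarith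
  have "\<forall>e\<in>F. \<exists>p. open_section (fst p) \<and> e \<in> fst p \<and>
      continuous_map (subtopology VT (tg_src E ` fst p)) ET (snd p) \<and>
      (\<forall>v\<in>tg_src E ` fst p. snd p v \<in> fst p \<and> tg_src E (snd p v) = v) \<and> snd p v0 = e"
  proof
    fix e assume "e \<in> F"
    then have e: "e \<in> topspace ET" "tg_src E e = v0" using F by (auto simp: fib_iff)
    obtain U where U: "open_section U" "e \<in> U" using ex_open_section e by blast
    obtain \<sigma> where \<sigma>: "continuous_map (subtopology VT (tg_src E ` U)) ET \<sigma>"
      "\<And>v. v \<in> tg_src E ` U \<Longrightarrow> \<sigma> v \<in> U \<and> tg_src E (\<sigma> v) = v" "\<And>e. e \<in> U \<Longrightarrow> \<sigma> (tg_src E e) = e"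
      using open_section_inverse[OF U(1)] by blast
    show "\<exists>p. open_section (fst p) \<and> e \<in> fst p \<and>
      continuous_map (subtopology VT (tg_src E ` fst p)) ET (snd p) \<and>
      (\<forall>v\<in>tg_src E ` fst p. snd p v \<in> fst p \<and> tg_src E (snd p v) = v) \<and> snd p v0 = e"
      by (rule exI[of _ "(U, \<sigma>)"]) (use U \<sigma> \<sigma>(3)[OF U(2)] e in auto)
  qed
  from bchoice[OF this] obtain p where p: "\<forall>e\<in>F. open_section (fst (p e)) \<and> e \<in> fst (p e) \<and>
      continuous_map (subtopology VT (tg_src E ` fst (p e))) ET (snd (p e)) \<and>
      (\<forall>v\<in>tg_src E ` fst (p e). snd (p e) v \<in> fst (p e) \<and> tg_src E (snd (p e) v) = v) \<and>
      snd (p e) v0 = e" by blast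
  define U \<sigma> where "U e = fst (p e)" and "\<sigma> e = snd (p e)" for e
  have U: "\<And>e. e \<in> F \<Longrightarrow> open_section (U e)" "\<And>e. e \<in> F \<Longrightarrow> e \<in> U e"
    and \<sigma>: "\<And>e. e \<in> F \<Longrightarrow> continuous_map (subtopology VT (tg_src E ` U e)) ET (\<sigma> e)"
      "\<And>e v. e \<in> F \<Longrightarrow> v \<in> tg_src E ` U e \<Longrightarrow> \<sigma> e v \<in> U e \<and> tg_src E (\<sigma> e v) = v"
      "\<And>e. e \<in> F \<Longrightarrow> \<sigma> e v0 = e"
    using p unfolding U_def \<sigma>_def by blast+
  have Fe: "e \<in> topspace ET" "tg_src E e = v0" if "e \<in> F" for e
    using F that by (auto simp: fib_iff)
  have oN: "openin VT (tg_src E ` U e)" if "e \<in> F" for e using U(1)[OF that] by (simp add: open_section_def)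
  have v0N: "v0 \<in> tg_src E ` U e" if "e \<in> F" for e using U(2)[OF that] Fe(2)[OF that] by blast
  have lim: "filterlim (\<sigma> e) (nhdsin ET e) (nhdsin VT v0)" if e: "e \<in> F" for e
    using filterlim_nhdsin[OF \<sigma>(1)[OF e], of v0] nhdsin_open_subtopology[OF oN[OF e] v0N[OF e]] v0 v0N[OF e]
      \<sigma>(3)[OF e] by simp
  have ev1: "\<forall>\<^sub>F v in nhdsin VT v0. \<forall>e\<in>F. v \<in> tg_src E ` U e"
    using F(1) by (rule eventually_ball_finite) (intro ballI eventually_nhdsin_openin[OF oN v0N])
  \<comment> \<open>Distinct edges over \<open>v0\<close> have disjoint neighbourhoods, so their
    continuations stay distinct nearby; only then is the sum over \<open>F\<close> the sum over the
    image set that is removed from the fibre.\<close>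
  have ev2: "\<forall>\<^sub>F v in nhdsin VT v0. \<forall>e\<in>F. \<forall>e'\<in>F. e \<noteq> e' \<longrightarrow> \<sigma> e v \<noteq> \<sigma> e' v"
  proof (intro eventually_ball_finite F(1) ballI)
    fix e e' assume e: "e \<in> F" "e' \<in> F"
    show "\<forall>\<^sub>F v in nhdsin VT v0. e \<noteq> e' \<longrightarrow> \<sigma> e v \<noteq> \<sigma> e' v"
    proof (cases "e = e'")
      case False
      then obtain S S' where S: "openin ET S" "openin ET S'" "e \<in> S" "e' \<in> S'" "disjnt S S'"
        using hausdorff_edges[unfolded Hausdorff_space_def, rule_format, of e e'] Fe(1)[OF e(1)] Fe(1)[OF e(2)]
        by auto
      have "\<forall>\<^sub>F v in nhdsin VT v0. \<sigma> e v \<in> S" "\<forall>\<^sub>F v in nhdsin VT v0. \<sigma> e' v \<in> S'"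
        by (rule eventually_compose_filterlim[OF eventually_nhdsin_openin[OF S(1,3)] lim[OF e(1)]], assumption,
          rule eventually_compose_filterlim[OF eventually_nhdsin_openin[OF S(2,4)] lim[OF e(2)]], assumption)
      then show ?thesis
        by eventually_elim (use S in \<open>auto simp: disjnt_iff\<close>)
    qed auto
  qed
  \<comment> \<open>Once the sections are distinct, this difference is the tail over
    \<open>v\<close>. It is continuous at \<open>v0\<close> because the total sum is, so the strict
    bound at \<open>v0\<close> spreads to a neighbourhood.\<close>
  have "((\<lambda>v. infsum G (fib v) - (\<Sum>e\<in>F. G (\<sigma> e v))) \<longlongrightarrow> infsum G (fib v0) - (\<Sum>e\<in>F. G e)) (nhdsin VT v0)"
  proof (intro tendsto_diff tendsto_sum)
    show "((\<lambda>v. infsum G (fib v)) \<longlongrightarrow> infsum G (fib v0)) (nhdsin VT v0)"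
      using cG v0 by (simp add: continuous_map_iff_nhdsin)
    fix e assume e: "e \<in> F"
    have "(G \<longlongrightarrow> G e) (nhdsin ET e)" using G(1) Fe[OF e] by (simp add: continuous_map_iff_nhdsin)
    then show "((\<lambda>v. G (\<sigma> e v)) \<longlongrightarrow> G e) (nhdsin VT v0)"
      using lim[OF e] by (rule filterlim_compose)
  qed
  then have ev3: "\<forall>\<^sub>F v in nhdsin VT v0. infsum G (fib v) - (\<Sum>e\<in>F. G (\<sigma> e v)) < \<epsilon>"
    by (rule order_tendstoD) (use Fd in simp)
  from eventually_conj[OF ev1 eventually_conj[OF ev2 ev3]] obtain N where N: "openin VT N" "v0 \<in> N"
    "\<And>v. v \<in> N \<Longrightarrow> (\<forall>e\<in>F. v \<in> tg_src E ` U e) \<and> (\<forall>e\<in>F. \<forall>e'\<in>F. e \<noteq> e' \<longrightarrow> \<sigma> e v \<noteq> \<sigma> e' v) \<and>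
      infsum G (fib v) - (\<Sum>e\<in>F. G (\<sigma> e v)) < \<epsilon>"
    using v0 unfolding eventually_nhdsin by auto
  have fibm: "\<sigma> e v \<in> fib v" if "e \<in> F" "v \<in> N" for e v
    using \<sigma>(2)[OF that(1)] N(3)[OF that(2)] that open_section_subset[OF U(1)[OF that(1)]] by (auto simp: fib_iff)
  have inj: "inj_on (\<lambda>e. \<sigma> e v) F" if "v \<in> N" for v
    using N(3)[OF that] by (auto simp: inj_on_def)
  have con: "continuous_map (subtopology VT N) ET (\<sigma> e)" if "e \<in> F" for e
  proof (rule continuous_map_from_subtopology_mono[OF \<sigma>(1)[OF that]])
    show "N \<subseteq> tg_src E ` U e" using N(3) that by fast
  qed
  have "infsum G (fib v - (\<lambda>e. \<sigma> e v) ` F) < \<epsilon>" if v: "v \<in> N" for v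
  proof -
    have "infsum G (fib v - (\<lambda>e. \<sigma> e v) ` F) = infsum G (fib v) - infsum G ((\<lambda>e. \<sigma> e v) ` F)"
    proof (rule infsum_Diff[OF sG])
      show "(\<lambda>e. \<sigma> e v) ` F \<subseteq> fib v" using fibm[OF _ v] by fast
      show "G summable_on (\<lambda>e. \<sigma> e v) ` F" using F(1) by simp
    qed
    also have "infsum G ((\<lambda>e. \<sigma> e v) ` F) = (\<Sum>e\<in>F. G (\<sigma> e v))"
      using F(1) inj[OF v] by (simp add: sum.reindex)
    finally show ?thesis using N(3)[OF v] by simp
  qed
  with N(1,2) F(1) con fibm inj show ?thesis
    by (intro exI[of _ N] exI[of _ F] exI[of _ \<sigma>]) simp
qed

text \<open>Near \<open>v0\<close> the sum of \<open>h\<close> differs from a finite sum of the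
  continuous functions \<open>h (\<sigma> e v)\<close> by a tail that is controlled by the tail of
  \<open>G\<close>. The majorant acts as in a dominated convergence theorem, with continuity of its
  own fibrewise sums in place of a compact support.\<close>

lemma continuous_fibre_sum:
  fixes G :: "'e \<Rightarrow> real" and h :: "'e \<Rightarrow> complex"
  assumes G: "continuous_map ET euclidean G"
    and sG: "\<And>v. G summable_on fib v" and cG: "continuous_map VT euclidean (\<lambda>v. infsum G (fib v))"
    and h: "continuous_map ET euclidean h" "\<And>e. e \<in> topspace ET \<Longrightarrow> cmod (h e) \<le> G e"
  shows "h summable_on fib v" "continuous_map VT euclidean (\<lambda>v. infsum h (fib v))"
proof -
  have abs: "(\<lambda>e. norm (h e)) summable_on S" if "S \<subseteq> fib v" for v S
    by (rule Infinite_Sum.abs_summable_on_comparison_test'[of G])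
      (use summable_on_subset_banach[OF sG that] that h(2) in \<open>auto simp: fib_iff\<close>)
  have sh: "h summable_on S" if "S \<subseteq> fib v" for v S
    using abs[OF that] by (rule abs_summable_summable)
  then show "h summable_on fib v" for v by blast
  have tail: "cmod (infsum h S) \<le> infsum G S" if "S \<subseteq> fib v" for v S
  proof -
    have "cmod (infsum h S) \<le> infsum (\<lambda>e. norm (h e)) S"
      using abs[OF that] by (rule norm_infsum_bound)
    also have "\<dots> \<le> infsum G S"
      by (rule infsum_mono[OF abs[OF that] summable_on_subset_banach[OF sG that]])
        (use that h(2) in \<open>auto simp: fib_iff\<close>)
    finally show ?thesis .
  qed
  show "continuous_map VT euclidean (\<lambda>v. infsum h (fib v))"
    unfolding continuous_map_iff_nhdsin
  proof (intro ballI tendstoI)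
    fix v0 \<epsilon> assume v0: "v0 \<in> topspace VT" and "\<epsilon> > (0::real)"
    then have e3: "\<epsilon>/3 > 0" by simp
    have G0: "0 \<le> G e" if "e \<in> topspace ET" for e using h(2)[OF that] norm_ge_zero order_trans by blast
    from small_tails[OF G G0 sG cG v0 e3]
    obtain N and F :: "'e set" and \<sigma> where N: "openin VT N" "v0 \<in> N" "finite F"
      "\<forall>e\<in>F. continuous_map (subtopology VT N) ET (\<sigma> e)"
      "\<forall>v\<in>N. \<forall>e\<in>F. \<sigma> e v \<in> fib v"
      "\<forall>v\<in>N. inj_on (\<lambda>e. \<sigma> e v) F"
      "\<forall>v\<in>N. infsum G (fib v - (\<lambda>e. \<sigma> e v) ` F) < \<epsilon>/3" by blast
    have split: "cmod (infsum h (fib v) - (\<Sum>e\<in>F. h (\<sigma> e v))) < \<epsilon>/3" if v: "v \<in> N" for v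
    proof -
      have "infsum h (fib v - (\<lambda>e. \<sigma> e v) ` F) = infsum h (fib v) - infsum h ((\<lambda>e. \<sigma> e v) ` F)"
      proof (rule infsum_Diff[OF sh[OF order_refl]])
        show "(\<lambda>e. \<sigma> e v) ` F \<subseteq> fib v" using N(5) v by fast
        show "h summable_on (\<lambda>e. \<sigma> e v) ` F" using N(3) by simp
      qed
      also have "infsum h ((\<lambda>e. \<sigma> e v) ` F) = (\<Sum>e\<in>F. h (\<sigma> e v))"
        using N(3) N(6) v by (simp add: sum.reindex)
      finally have "infsum h (fib v) - (\<Sum>e\<in>F. h (\<sigma> e v)) = infsum h (fib v - (\<lambda>e. \<sigma> e v) ` F)" by simp
      then show ?thesis using tail[of "fib v - (\<lambda>e. \<sigma> e v) ` F" v] N(7) v by fastforce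
    qed
    have "((\<lambda>v. \<Sum>e\<in>F. h (\<sigma> e v)) \<longlongrightarrow> (\<Sum>e\<in>F. h (\<sigma> e v0))) (nhdsin VT v0)"
    proof (intro tendsto_sum)
      fix e assume e: "e \<in> F"
      have "filterlim (\<sigma> e) (nhdsin ET (\<sigma> e v0)) (nhdsin VT v0)"
        using filterlim_nhdsin[OF bspec[OF N(4) e], of v0] nhdsin_open_subtopology[OF N(1,2)] v0 N(2) by simp
      moreover have "(h \<longlongrightarrow> h (\<sigma> e v0)) (nhdsin ET (\<sigma> e v0))"
        using h(1) N(2,5) e by (simp add: continuous_map_iff_nhdsin fib_iff)
      ultimately show "((\<lambda>v. h (\<sigma> e v)) \<longlongrightarrow> h (\<sigma> e v0)) (nhdsin VT v0)"
        by (rule filterlim_compose[rotated])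
    qed
    then have "\<forall>\<^sub>F v in nhdsin VT v0. dist (\<Sum>e\<in>F. h (\<sigma> e v)) (\<Sum>e\<in>F. h (\<sigma> e v0)) < \<epsilon>/3"
      using e3 by (rule tendstoD)
    moreover have "\<forall>\<^sub>F v in nhdsin VT v0. v \<in> N"
      by (rule eventually_nhdsin_openin[OF N(1,2)])
    ultimately show "\<forall>\<^sub>F v in nhdsin VT v0. dist (infsum h (fib v)) (infsum h (fib v0)) < \<epsilon>"
    proof eventually_elim
      case (elim v)
      have "dist (infsum h (fib v)) (infsum h (fib v0)) \<le> dist (infsum h (fib v)) (\<Sum>e\<in>F. h (\<sigma> e v))
          + dist (\<Sum>e\<in>F. h (\<sigma> e v)) (\<Sum>e\<in>F. h (\<sigma> e v0)) + dist (\<Sum>e\<in>F. h (\<sigma> e v0)) (infsum h (fib v0))"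
        using dist_triangle[of "infsum h (fib v)" "infsum h (fib v0)" "\<Sum>e\<in>F. h (\<sigma> e v0)"]
          dist_triangle[of "infsum h (fib v)" "\<Sum>e\<in>F. h (\<sigma> e v0)" "\<Sum>e\<in>F. h (\<sigma> e v)"] by linarith
      then show ?case using elim(1) split[OF elim(2)] split[OF N(2)] 
        by (simp add: dist_norm norm_minus_commute)
    qed
  qed
qed

section \<open>The correspondence of a topological graph is a correspondence\<close>

abbreviation fnorm :: "('e \<Rightarrow> complex) \<Rightarrow> 'v \<Rightarrow> real" where
  "fnorm f v \<equiv> l2norm f (fib v)"

lemma graph_inner_eq: "graph_inner E f g v = (\<Sum>\<^sub>\<infinity>e\<in>fib v. cnj (f e) * g e)"
  by (simp add: graph_inner_def fib_empty)

text \<open>The condition is put on \<open>fnorm\<close> rather than on its square because the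
  triangle inequality lets \<open>fnorm\<close> pass to uniform limits. Squaring and square roots
  both preserve vanishing at infinity, so the two conditions agree.\<close>

lemma graph_functions_iff:
  "f \<in> graph_functions E \<longleftrightarrow> continuous_map ET euclidean f \<and> (\<forall>e. e \<notin> topspace ET \<longrightarrow> f e = 0) \<and>
     (\<forall>v. square_summable f (fib v)) \<and> (\<lambda>v. complex_of_real (fnorm f v)) \<in> C0_functions VT"
proof -
  have "(\<forall>v\<in>topspace VT. (\<lambda>e. cnj (f e) * f e) summable_on fib v) \<longleftrightarrow> (\<forall>v. square_summable f (fib v))"
    using fib_empty square_summable_iff[of f] by (metis summable_on_empty)
  moreover have "graph_inner E f f \<in> C0_functions VT \<longleftrightarrow> (\<lambda>v. complex_of_real (fnorm f v)) \<in> C0_functions VT"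
    if sq: "\<forall>v. square_summable f (fib v)"
  proof -
    have eq: "graph_inner E f f = (\<lambda>v. complex_of_real ((fnorm f v)\<^sup>2))"
      using sq by (simp add: fun_eq_iff graph_inner_eq cnj_mult_self_infsum)
    show ?thesis
    proof
      assume "graph_inner E f f \<in> C0_functions VT"
      then have "(\<lambda>v. complex_of_real (sqrt (cmod (graph_inner E f f v)))) \<in> C0_functions VT"
      proof (rule C0_compose)
        fix \<epsilon> :: real assume "\<epsilon> > 0"
        then show "\<exists>\<delta>>0. \<forall>z. cmod z < \<delta> \<longrightarrow> cmod (complex_of_real (sqrt (cmod z))) < \<epsilon>"
          by (intro exI[of _ "\<epsilon>\<^sup>2"]) (auto simp: real_sqrt_less_iff intro!: real_less_lsqrt)
      qed (auto intro!: continuous_intros)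
      then show "(\<lambda>v. complex_of_real (fnorm f v)) \<in> C0_functions VT"
        by (simp add: eq norm_power)
    next
      assume *: "(\<lambda>v. complex_of_real (fnorm f v)) \<in> C0_functions VT"
      show "graph_inner E f f \<in> C0_functions VT"
        using C0_mult[OF * *] by (simp add: eq power2_eq_square)
    qed
  qed
  ultimately show ?thesis unfolding graph_functions_def by auto
qed

lemma
  assumes "f \<in> graph_functions E"
  shows gf_continuous: "continuous_map ET euclidean f"
    and gf_outside: "e \<notin> topspace ET \<Longrightarrow> f e = 0"
    and gf_square_summable: "square_summable f (fib v)"
    and gf_fnorm: "(\<lambda>v. complex_of_real (fnorm f v)) \<in> C0_functions VT"
  using assms unfolding graph_functions_iff by auto

lemma C0_fnorm_squares:
  assumes f: "f \<in> graph_functions E" and g: "g \<in> graph_functions E"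
  shows "(\<lambda>v. complex_of_real ((fnorm f v)\<^sup>2 + (fnorm g v)\<^sup>2)) \<in> C0_functions VT"
  using C0_add[OF C0_mult[OF gf_fnorm[OF f] gf_fnorm[OF f]] C0_mult[OF gf_fnorm[OF g] gf_fnorm[OF g]]]
  by (simp add: power2_eq_square)

text \<open>Packages the hypotheses of \<open>continuous_fibre_sum\<close> for the majorant in use;
  continuity of its fibrewise sums is membership of \<open>f\<close> and \<open>g\<close>,
  rewritten.\<close>

lemma squares_majorant:
  fixes B :: real
  assumes f: "f \<in> graph_functions E" and g: "g \<in> graph_functions E"
  shows "continuous_map ET euclidean (\<lambda>e. B * ((cmod (f e))\<^sup>2 + (cmod (g e))\<^sup>2))"
    and "(\<lambda>e. B * ((cmod (f e))\<^sup>2 + (cmod (g e))\<^sup>2)) summable_on fib v"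
    and "continuous_map VT euclidean (\<lambda>v. \<Sum>\<^sub>\<infinity>e\<in>fib v. B * ((cmod (f e))\<^sup>2 + (cmod (g e))\<^sup>2))"
    and "(\<Sum>\<^sub>\<infinity>e\<in>fib v. B * ((cmod (f e))\<^sup>2 + (cmod (g e))\<^sup>2)) = B * ((fnorm f v)\<^sup>2 + (fnorm g v)\<^sup>2)"
proof -
  show "continuous_map ET euclidean (\<lambda>e. B * ((cmod (f e))\<^sup>2 + (cmod (g e))\<^sup>2))"
    using gf_continuous[OF f] gf_continuous[OF g] unfolding continuous_map_iff_nhdsin
    by (intro ballI tendsto_mult tendsto_const tendsto_add tendsto_power tendsto_norm) blast+
  have s: "(\<lambda>e. (cmod (f e))\<^sup>2) summable_on fib v" "(\<lambda>e. (cmod (g e))\<^sup>2) summable_on fib v" for v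
    using gf_square_summable[OF f] gf_square_summable[OF g] by (auto simp: square_summable_def)
  show "(\<lambda>e. B * ((cmod (f e))\<^sup>2 + (cmod (g e))\<^sup>2)) summable_on fib v" for v
    using s by (intro summable_on_cmult_right summable_on_add)
  show eq: "(\<Sum>\<^sub>\<infinity>e\<in>fib v. B * ((cmod (f e))\<^sup>2 + (cmod (g e))\<^sup>2)) = B * ((fnorm f v)\<^sup>2 + (fnorm g v)\<^sup>2)" for v
    using s[of v] by (simp add: infsum_cmult_right' infsum_add l2norm_squared)
  have "continuous_map VT euclidean (\<lambda>v. (fnorm f v)\<^sup>2 + (fnorm g v)\<^sup>2)"
    using continuous_map_of_realD[OF C0_continuous[OF C0_fnorm_squares[OF f g]]] .
  then show "continuous_map VT euclidean (\<lambda>v. \<Sum>\<^sub>\<infinity>e\<in>fib v. B * ((cmod (f e))\<^sup>2 + (cmod (g e))\<^sup>2))"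
    unfolding eq by (intro continuous_map_times) auto
qed

text \<open>Continuity of the fibrewise norm of \<open>h\<close>, the hard part of membership, comes
  from \<open>continuous_fibre_sum\<close>, and its decay from the same majorant. Two dominating
  functions are allowed for the sake of sums.\<close>

lemma graph_functions_dominated:
  assumes f: "f \<in> graph_functions E" and g: "g \<in> graph_functions E"
    and h: "continuous_map ET euclidean h" "\<And>e. e \<notin> topspace ET \<Longrightarrow> h e = 0"
      "\<And>e. e \<in> topspace ET \<Longrightarrow> (cmod (h e))\<^sup>2 \<le> B * ((cmod (f e))\<^sup>2 + (cmod (g e))\<^sup>2)"
  shows "h \<in> graph_functions E"
proof -
  note maj = squares_majorant[OF f g, of B]
  have ch: "continuous_map ET euclidean (\<lambda>e. complex_of_real ((cmod (h e))\<^sup>2))"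
    by (rule continuous_map_compose_cont[OF h(1)]) (intro continuous_intros)
  have b: "cmod (complex_of_real ((cmod (h e))\<^sup>2)) \<le> B * ((cmod (f e))\<^sup>2 + (cmod (g e))\<^sup>2)"
    if "e \<in> topspace ET" for e using h(3)[OF that] by (simp add: norm_power)
  have sh: "square_summable h (fib v)" for v
    unfolding square_summable_def
    by (rule summable_on_comparison_test[OF maj(2)[of v]]) (use h(3) in \<open>auto simp: fib_iff\<close>)
  have "(\<Sum>\<^sub>\<infinity>e\<in>fib v. complex_of_real ((cmod (h e))\<^sup>2)) = complex_of_real ((fnorm h v)\<^sup>2)" for v
    using sh[of v] unfolding square_summable_def l2norm_squared
    by (intro infsumI has_sum_of_real has_sum_infsum)
  then have c: "continuous_map VT euclidean (\<lambda>v. complex_of_real ((fnorm h v)\<^sup>2))"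
    using continuous_fibre_sum(2)[OF maj(1) maj(2) maj(3) ch b] by simp
  have le: "(fnorm h v)\<^sup>2 \<le> B * ((fnorm f v)\<^sup>2 + (fnorm g v)\<^sup>2)" for v
    unfolding l2norm_squared[of h] maj(4)[symmetric]
    by (rule infsum_mono) (use sh maj(2) h(3) in \<open>auto simp: fib_iff square_summable_def\<close>)
  have C0sq: "(\<lambda>v. complex_of_real ((fnorm h v)\<^sup>2)) \<in> C0_functions VT"
  proof (rule C0_dominated[OF c _ C0_fnorm_squares[OF f g]])
    show "complex_of_real ((fnorm h v)\<^sup>2) = 0" if "v \<notin> topspace VT" for v
      using fib_empty[OF that] by (simp add: l2norm_def)
    show "cmod (complex_of_real ((fnorm h v)\<^sup>2)) \<le> B * cmod (complex_of_real ((fnorm f v)\<^sup>2 + (fnorm g v)\<^sup>2))" for v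
      using le[of v] by (simp only: norm_of_real abs_of_nonneg zero_le_power2 add_nonneg_nonneg)
  qed
  have "graph_inner E h h = (\<lambda>v. complex_of_real ((fnorm h v)\<^sup>2))"
    using sh by (simp add: fun_eq_iff graph_inner_eq cnj_mult_self_infsum)
  with C0sq sh h show ?thesis
    unfolding graph_functions_def by (auto simp flip: square_summable_iff)
qed

section \<open>Closure of the graph functions under the module operations\<close>

lemma gf_zero: "(\<lambda>_. 0) \<in> graph_functions E"
  unfolding graph_functions_iff by (simp add: square_summable_def l2norm_def C0_zero)

lemma gf_bounded_mult:
  assumes f: "f \<in> graph_functions E" and b: "continuous_map ET euclidean b"
    "\<And>e. e \<in> topspace ET \<Longrightarrow> cmod (b e) \<le> B"
  shows "(\<lambda>e. b e * f e) \<in> graph_functions E"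
proof (rule graph_functions_dominated[OF f gf_zero])
  show "continuous_map ET euclidean (\<lambda>e. b e * f e)"
    using b(1) gf_continuous[OF f] by (rule continuous_map_times)
  show "(cmod (b e * f e))\<^sup>2 \<le> B\<^sup>2 * ((cmod (f e))\<^sup>2 + (cmod 0)\<^sup>2)" if "e \<in> topspace ET" for e
    using b(2)[OF that] by (simp add: norm_mult power_mult_distrib power_mono mult_right_mono)
qed (simp add: gf_outside[OF f])

lemma gf_scale: "f \<in> graph_functions E \<Longrightarrow> (\<lambda>e. z * f e) \<in> graph_functions E"
  by (rule gf_bounded_mult[of _ "\<lambda>_. z"]) auto

lemma gf_add:
  assumes f: "f \<in> graph_functions E" and g: "g \<in> graph_functions E"
  shows "(\<lambda>e. f e + g e) \<in> graph_functions E"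
proof (rule graph_functions_dominated[OF f g])
  show "continuous_map ET euclidean (\<lambda>e. f e + g e)"
    using gf_continuous[OF f] gf_continuous[OF g]
    unfolding continuous_map_iff_nhdsin by (intro ballI tendsto_add) blast+
  show "(cmod (f e + g e))\<^sup>2 \<le> 2 * ((cmod (f e))\<^sup>2 + (cmod (g e))\<^sup>2)" for e
  proof -
    have "(cmod (f e + g e))\<^sup>2 \<le> (cmod (f e) + cmod (g e))\<^sup>2"
      by (intro power_mono norm_triangle_ineq) auto
    also have "\<dots> \<le> 2 * ((cmod (f e))\<^sup>2 + (cmod (g e))\<^sup>2)"
      using sum_squares_bound[of "cmod (f e)" "cmod (g e)"] by (simp add: power2_sum)
    finally show ?thesis .
  qed
qed (simp add: gf_outside[OF f] gf_outside[OF g])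

lemma gf_diff:
  assumes f: "f \<in> graph_functions E" and g: "g \<in> graph_functions E"
  shows "(\<lambda>e. f e - g e) \<in> graph_functions E"
  using gf_add[OF f gf_scale[OF g, of "-1"]] by simp

lemma continuous_map_src: "a \<in> C0_functions VT \<Longrightarrow> continuous_map ET euclidean (\<lambda>e. a (tg_src E e))"
  and continuous_map_rng: "a \<in> C0_functions VT \<Longrightarrow> continuous_map ET euclidean (\<lambda>e. a (tg_rng E e))"
  using continuous_map_compose[OF continuous_src C0_continuous] continuous_map_compose[OF continuous_rng C0_continuous]
  by (auto simp: o_def)

lemma gf_right:
  assumes "f \<in> graph_functions E" "a \<in> C0_functions VT"
  shows "(\<lambda>e. f e * a (tg_src E e)) \<in> graph_functions E"
  using gf_bounded_mult[OF assms(1) continuous_map_src[OF assms(2)] cmod_le_supnorm[OF assms(2)]]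
  by (simp add: mult.commute)

lemma gf_left:
  assumes "f \<in> graph_functions E" "a \<in> C0_functions VT"
  shows "(\<lambda>e. a (tg_rng E e) * f e) \<in> graph_functions E"
  using gf_bounded_mult[OF assms(1) continuous_map_rng[OF assms(2)] cmod_le_supnorm[OF assms(2)]] .

lemma gf_left_cnj:
  "f \<in> graph_functions E \<Longrightarrow> a \<in> C0_functions VT \<Longrightarrow> (\<lambda>e. cnj (a (tg_rng E e)) * f e) \<in> graph_functions E"
  using gf_left[OF _ C0_cnj] .

lemma inner_summable:
  "f \<in> graph_functions E \<Longrightarrow> g \<in> graph_functions E \<Longrightarrow> (\<lambda>e. cnj (f e) * g e) summable_on fib v"
  by (intro summable_cnj_mult gf_square_summable)

lemma cmod_inner_le:
  "f \<in> graph_functions E \<Longrightarrow> g \<in> graph_functions E \<Longrightarrow> cmod (graph_inner E f g v) \<le> fnorm f v * fnorm g v"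
  unfolding graph_inner_eq by (intro infsum_cnj_mult_le gf_square_summable)

lemma inner_self: "f \<in> graph_functions E \<Longrightarrow> graph_inner E f f v = complex_of_real ((fnorm f v)\<^sup>2)"
  unfolding graph_inner_eq by (intro cnj_mult_self_infsum gf_square_summable)

text \<open>Membership speaks only of the diagonal \<open>\<langle>f, f\<rangle>\<close>. The cross
  terms are dominated by the two squares, edge by edge for continuity and fibre by fibre for
  decay.\<close>

lemma inner_C0:
  assumes f: "f \<in> graph_functions E" and g: "g \<in> graph_functions E"
  shows "graph_inner E f g \<in> C0_functions VT"
proof (rule C0_dominated[OF _ _ C0_fnorm_squares[OF f g]])
  note maj = squares_majorant[OF f g, of 1]
  have "continuous_map ET euclidean (\<lambda>e. cnj (f e) * g e)"
    using gf_continuous[OF f] gf_continuous[OF g]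
    unfolding continuous_map_iff_nhdsin by (intro ballI tendsto_mult tendsto_cnj) blast+
  moreover have "cmod (cnj (f e) * g e) \<le> 1 * ((cmod (f e))\<^sup>2 + (cmod (g e))\<^sup>2)" for e
    using mult_le_sum_squares[of "cmod (f e)" "cmod (g e)"] by (simp add: norm_mult)
  ultimately have "continuous_map VT euclidean (\<lambda>v. \<Sum>\<^sub>\<infinity>e\<in>fib v. cnj (f e) * g e)"
    by (intro continuous_fibre_sum(2)[OF maj(1) maj(2) maj(3)])
  then show "continuous_map VT euclidean (graph_inner E f g)"
    by (simp add: graph_inner_eq[abs_def])
  show "graph_inner E f g v = 0" if "v \<notin> topspace VT" for v
    using that by (simp add: graph_inner_def)
  show "cmod (graph_inner E f g v) \<le> 1 * cmod (complex_of_real ((fnorm f v)\<^sup>2 + (fnorm g v)\<^sup>2))" for v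
    using order_trans[OF cmod_inner_le[OF f g, of v] mult_le_sum_squares[of "fnorm f v" "fnorm g v"]]
    by (simp only: norm_of_real abs_of_nonneg zero_le_power2 add_nonneg_nonneg mult_1 l2norm_nonneg)
qed

section \<open>The Hilbert module norm as a supremum of fibrewise norms, and completeness\<close>

definition gnorm :: "('e \<Rightarrow> complex) \<Rightarrow> real" where
  "gnorm f = sqrt (SUP v. cmod (graph_inner E f f v))"

lemma fnorm_le_gnorm:
  assumes f: "f \<in> graph_functions E"
  shows "fnorm f v \<le> gnorm f"
  using cmod_le_supnorm[OF inner_C0[OF f f], of v] unfolding gnorm_def
  by (intro real_le_rsqrt) (simp add: inner_self[OF f] norm_power)

lemma gnorm_le:
  assumes f: "f \<in> graph_functions E" and "\<And>v. v \<in> topspace VT \<Longrightarrow> fnorm f v \<le> B" "0 \<le> B"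
  shows "gnorm f \<le> B"
  unfolding gnorm_def
proof (rule real_le_lsqrt)
  have "fnorm f v \<le> B" for v
    using assms(2)[of v] assms(3) fib_empty[of v] by (cases "v \<in> topspace VT") (auto simp: l2norm_def)
  then show "(SUP v. cmod (graph_inner E f f v)) \<le> B\<^sup>2"
    by (intro cSUP_least) (auto simp: inner_self[OF f] norm_power intro!: power_mono)
qed fact

lemma gnorm_nonneg: "f \<in> graph_functions E \<Longrightarrow> 0 \<le> gnorm f"
  using fnorm_le_gnorm[of f undefined] l2norm_nonneg order_trans by blast

lemma X_simps [simp]:
  "co_set X = graph_functions E" "co_zero X = (\<lambda>_. 0)" "co_add X = (\<lambda>f g e. f e + g e)"
  "co_scale X = (\<lambda>z f e. z * f e)" "co_inner X = graph_inner E"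
  "co_right X = (\<lambda>f g e. f e * g (tg_src E e))" "co_left X = (\<lambda>g f e. g (tg_rng E e) * f e)"
  by (simp_all add: graph_correspondence_def)

lemma co_dist_X: "co_dist A X f g = gnorm (\<lambda>e. f e - g e)"
  by (simp add: co_dist_def gnorm_def Let_def)

text \<open>Every edge lies in the fibre over its own source, so one fibrewise norm bounds its
  value. Norm convergence therefore implies uniform convergence, which supplies the pointwise limits
  needed for completeness.\<close>

lemma cmod_le_gnorm:
  assumes f: "f \<in> graph_functions E"
  shows "cmod (f e) \<le> gnorm f"
proof (cases "e \<in> topspace ET")
  case True
  then have "cmod (f e) \<le> fnorm f (tg_src E e)"
    by (intro cmod_le_l2norm gf_square_summable[OF f]) (simp add: fib_iff)
  then show ?thesis using fnorm_le_gnorm[OF f, of "tg_src E e"] by simp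
qed (simp add: gf_outside[OF f] gnorm_nonneg[OF f])

lemma gnorm_triangle:
  assumes f: "f \<in> graph_functions E" and g: "g \<in> graph_functions E"
  shows "gnorm (\<lambda>e. f e + g e) \<le> gnorm f + gnorm g"
proof (rule gnorm_le[OF gf_add[OF f g]])
  show "fnorm (\<lambda>e. f e + g e) v \<le> gnorm f + gnorm g" for v
    using l2norm_triangle[OF gf_square_summable[OF f] gf_square_summable[OF g], of v]
      fnorm_le_gnorm[OF f, of v] fnorm_le_gnorm[OF g, of v] by linarith
qed (simp add: gnorm_nonneg f g)

lemma gnorm_dominated:
  assumes f: "f \<in> graph_functions E" and h: "h \<in> graph_functions E" and B: "0 \<le> B"
    "\<And>e. e \<in> topspace ET \<Longrightarrow> cmod (h e) \<le> B * cmod (f e)"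
  shows "gnorm h \<le> B * gnorm f"
proof (rule gnorm_le[OF h])
  fix v
  have "fnorm h v \<le> B * fnorm f v"
    by (rule l2norm_dominated[OF gf_square_summable[OF f]]) (use B in \<open>auto simp: fib_iff\<close>)
  also have "\<dots> \<le> B * gnorm f" using B fnorm_le_gnorm[OF f] by (intro mult_left_mono)
  finally show "fnorm h v \<le> B * gnorm f" .
qed (simp add: gnorm_nonneg f B)

lemma supnorm_inner_le:
  assumes f: "f \<in> graph_functions E" and g: "g \<in> graph_functions E"
  shows "cmod (graph_inner E f g v) \<le> gnorm f * gnorm g"
  using cmod_inner_le[OF f g, of v] mult_mono[OF fnorm_le_gnorm[OF f, of v] fnorm_le_gnorm[OF g, of v]]
    gnorm_nonneg[OF f] by simp

text \<open>The pointwise limit \<open>l\<close> is compared with \<open>u i\<close> on finite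
  subsets of a fibre, where the limit in \<open>j\<close> may be taken termwise; the resulting bound
  is uniform in the finite set and in the vertex. So \<open>u i - l\<close> has uniformly small
  fibrewise norms, which gives continuity both of \<open>l\<close> and of its norm function.\<close>

lemma graph_complete:
  assumes u: "\<And>i. u i \<in> graph_functions E"
    and c: "\<And>\<epsilon>. \<epsilon> > 0 \<Longrightarrow> \<exists>N. \<forall>i\<ge>N. \<forall>j\<ge>N. gnorm (\<lambda>e. u i e - u j e) < \<epsilon>"
  shows "\<exists>l\<in>graph_functions E. (\<lambda>i. gnorm (\<lambda>e. u i e - l e)) \<longlonglongrightarrow> (0::real)"
proof -
  have d: "(\<lambda>e. u i e - u j e) \<in> graph_functions E" for i j using u gf_diff by blast
  have "Cauchy (\<lambda>i. u i e)" for e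
  proof (rule metric_CauchyI)
    fix \<epsilon> :: real assume "\<epsilon> > 0"
    then obtain N where N: "\<forall>i\<ge>N. \<forall>j\<ge>N. gnorm (\<lambda>e. u i e - u j e) < \<epsilon>" using c by blast
    have "dist (u i e) (u j e) < \<epsilon>" if "i \<ge> N" "j \<ge> N" for i j
      using cmod_le_gnorm[OF d[of i j], of e] N that unfolding dist_norm by (meson order_le_less_trans)
    then show "\<exists>N. \<forall>i\<ge>N. \<forall>j\<ge>N. dist (u i e) (u j e) < \<epsilon>" by blast
  qed
  then have l: "(\<lambda>i. u i e) \<longlonglongrightarrow> l e" if "l = (\<lambda>e. lim (\<lambda>i. u i e))" for e l
    unfolding that by (simp add: Cauchy_convergent_iff convergent_LIMSEQ_iff)
  define l where "l = (\<lambda>e. lim (\<lambda>i. u i e))"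
  note l = l[OF l_def]
  have fin: "\<exists>N. \<forall>i\<ge>N. \<forall>v F. finite F \<longrightarrow> F \<subseteq> fib v \<longrightarrow> L2_set (\<lambda>e. cmod (u i e - l e)) F \<le> \<epsilon>"
    if "\<epsilon> > 0" for \<epsilon>
  proof -
    obtain N where N: "\<And>i j. i \<ge> N \<Longrightarrow> j \<ge> N \<Longrightarrow> gnorm (\<lambda>e. u i e - u j e) < \<epsilon>"
      using c[OF \<open>\<epsilon> > 0\<close>] by blast
    have "L2_set (\<lambda>e. cmod (u i e - l e)) F \<le> \<epsilon>" if i: "i \<ge> N" and F: "finite F" "F \<subseteq> fib v" for i v F
    proof (rule tendsto_upperbound)
      show "(\<lambda>j. L2_set (\<lambda>e. cmod (u i e - u j e)) F) \<longlonglongrightarrow> L2_set (\<lambda>e. cmod (u i e - l e)) F"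
        unfolding L2_set_def by (intro tendsto_intros l)
      have "L2_set (\<lambda>e. cmod (u i e - u j e)) F \<le> \<epsilon>" if "j \<ge> N" for j
        using L2_set_le_l2norm[OF gf_square_summable[OF d] F] fnorm_le_gnorm[OF d, of i j v] N[OF i that]
        by (meson less_imp_le order_trans)
      then show "\<forall>\<^sub>F j in sequentially. L2_set (\<lambda>e. cmod (u i e - u j e)) F \<le> \<epsilon>"
        unfolding eventually_sequentially by blast
    qed auto
    then show ?thesis by blast
  qed
  have sq: "\<exists>N. \<forall>i\<ge>N. \<forall>v. square_summable (\<lambda>e. u i e - l e) (fib v) \<and> fnorm (\<lambda>e. u i e - l e) v \<le> \<epsilon>"
    if "\<epsilon> > 0" for \<epsilon>
  proof -
    from fin[OF \<open>\<epsilon> > 0\<close>]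
    obtain N where "\<forall>i\<ge>N. \<forall>v F. finite F \<longrightarrow> F \<subseteq> fib v \<longrightarrow> L2_set (\<lambda>e. cmod (u i e - l e)) F \<le> \<epsilon>"
      by (rule exE)
    then have N: "i \<ge> N \<Longrightarrow> finite F \<Longrightarrow> F \<subseteq> fib v \<Longrightarrow> L2_set (\<lambda>e. cmod (u i e - l e)) F \<le> \<epsilon>" for i v F
      by simp
    show ?thesis
    proof (intro exI allI impI conjI)
      fix i v assume i: "N \<le> i"
      show "square_summable (\<lambda>e. u i e - l e) (fib v)" by (rule square_summableI[OF N[OF i]])
      show "fnorm (\<lambda>e. u i e - l e) v \<le> \<epsilon>" by (rule l2norm_leI[OF N[OF i]])
    qed
  qed
  have sql: "square_summable l (fib v)" for v
  proof -
    obtain i where i: "square_summable (\<lambda>e. u i e - l e) (fib v)" using sq[of 1] by auto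
    have "square_summable (\<lambda>e. - (u i e - l e)) (fib v)"
      by (rule square_summable_dominated[OF i, of 1]) (auto simp: norm_minus_commute)
    from square_summable_add[OF gf_square_summable[OF u[of i]] this] show ?thesis by simp
  qed
  have "l \<in> graph_functions E"
    unfolding graph_functions_iff
  proof (intro conjI allI impI sql)
    show "l e = 0" if "e \<notin> topspace ET" for e
      using l[of e] gf_outside[OF u that] LIMSEQ_unique[OF _ tendsto_const] by auto
    show "continuous_map ET euclidean l"
    proof (rule continuous_map_uniform_limit)
      fix \<epsilon> :: real assume "\<epsilon> > 0"
      from sq[OF this] obtain i where "\<forall>j\<ge>i. \<forall>v. square_summable (\<lambda>e. u j e - l e) (fib v) \<and> fnorm (\<lambda>e. u j e - l e) v \<le> \<epsilon>"
        by (rule exE)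
      then have i: "square_summable (\<lambda>e. u i e - l e) (fib v)" "fnorm (\<lambda>e. u i e - l e) v \<le> \<epsilon>" for v by simp_all
      have "cmod (u i e - l e) \<le> \<epsilon>" if "e \<in> topspace ET" for e
        using cmod_le_l2norm[OF i(1), of e "tg_src E e"] i(2)[of "tg_src E e"] that by (simp add: fib_iff)
      then show "\<exists>g. continuous_map ET euclidean g \<and> (\<forall>x\<in>topspace ET. cmod (l x - g x) \<le> \<epsilon>)"
        using gf_continuous[OF u] by (intro exI[of _ "u i"]) (auto simp: norm_minus_commute)
    qed
    show "(\<lambda>v. complex_of_real (fnorm l v)) \<in> C0_functions VT"
    proof (rule C0_uniform_limit)
      fix \<epsilon> :: real assume "\<epsilon> > 0"
      from sq[OF this] obtain i where "\<forall>j\<ge>i. \<forall>v. square_summable (\<lambda>e. u j e - l e) (fib v) \<and> fnorm (\<lambda>e. u j e - l e) v \<le> \<epsilon>"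
        by (rule exE)
      then have i: "square_summable (\<lambda>e. u i e - l e) (fib v)" "fnorm (\<lambda>e. u i e - l e) v \<le> \<epsilon>" for v by simp_all
      have m: "square_summable (\<lambda>e. - (u i e - l e)) (fib v)" "fnorm (\<lambda>e. - (u i e - l e)) v \<le> \<epsilon>" for v
        using square_summable_dominated[OF i(1), of 1 v "\<lambda>e. - (u i e - l e)"]
          l2norm_dominated[OF i(1), of 1 v "\<lambda>e. - (u i e - l e)"] i(2)[of v]
        by (auto simp: norm_minus_commute)
      \<comment> \<open>The reverse triangle inequality: \<open>fnorm l\<close> is a uniform limit
        of the functions \<open>fnorm (u i)\<close>, which vanish at infinity.\<close>
      have "\<bar>fnorm l v - fnorm (u i) v\<bar> \<le> \<epsilon>" for v
        using l2norm_triangle[OF gf_square_summable[OF u[of i], of v] m(1)]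
          l2norm_triangle[OF sql[of v] i(1)[of v]] m(2)[of v] i(2)[of v] by auto
      then have "cmod (complex_of_real (fnorm l v) - complex_of_real (fnorm (u i) v)) \<le> \<epsilon>" for v
        by (simp flip: of_real_diff)
      then show "\<exists>g\<in>C0_functions VT. \<forall>v. cmod (complex_of_real (fnorm l v) - g v) \<le> \<epsilon>"
        by (intro bexI[OF _ gf_fnorm[OF u[of i]]] allI)
    qed
  qed
  moreover have "(\<lambda>i. gnorm (\<lambda>e. u i e - l e)) \<longlonglongrightarrow> 0"
  proof (rule LIMSEQ_I)
    fix \<epsilon> :: real assume e: "\<epsilon> > 0"
    then have "\<epsilon>/2 > 0" by simp
    from sq[OF this] obtain N where "\<forall>i\<ge>N. \<forall>v. square_summable (\<lambda>e. u i e - l e) (fib v) \<and> fnorm (\<lambda>e. u i e - l e) v \<le> \<epsilon>/2"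
      by (rule exE)
    then have N: "i \<ge> N \<Longrightarrow> fnorm (\<lambda>e. u i e - l e) v \<le> \<epsilon>/2" for i v by simp
    have "norm (gnorm (\<lambda>e. u i e - l e) - 0) < \<epsilon>" if "i \<ge> N" for i
      using gnorm_le[OF gf_diff[OF u[of i] \<open>l \<in> graph_functions E\<close>], of "\<epsilon>/2"] N[OF that] e
        gnorm_nonneg[OF gf_diff[OF u[of i] \<open>l \<in> graph_functions E\<close>]] by simp
    then show "\<exists>N. \<forall>i\<ge>N. norm (gnorm (\<lambda>e. u i e - l e) - 0) < \<epsilon>" by blast
  qed
  ultimately show ?thesis by blast
qed

section \<open>Sesquilinearity of the inner product and the correspondence axioms\<close>

lemma inner_add_right:
  "f \<in> graph_functions E \<Longrightarrow> g \<in> graph_functions E \<Longrightarrow> h \<in> graph_functions E \<Longrightarrow>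
    graph_inner E f (\<lambda>e. g e + h e) v = graph_inner E f g v + graph_inner E f h v"
  unfolding graph_inner_eq distrib_left by (intro infsum_add inner_summable)

lemma inner_scale_right:
  "graph_inner E f (\<lambda>e. z * g e) v = z * graph_inner E f g v"
  unfolding graph_inner_eq by (simp add: mult.left_commute infsum_cmult_right')

lemma inner_right_action:
  "graph_inner E f (\<lambda>e. g e * a (tg_src E e)) v = graph_inner E f g v * a v"
proof -
  have "(\<Sum>\<^sub>\<infinity>e\<in>fib v. cnj (f e) * (g e * a (tg_src E e))) = (\<Sum>\<^sub>\<infinity>e\<in>fib v. cnj (f e) * g e * a v)"
    by (rule infsum_cong) (simp add: fib_iff)
  then show ?thesis unfolding graph_inner_eq by (simp add: infsum_cmult_left')
qed

lemma inner_cnj: "cnj (graph_inner E f g v) = graph_inner E g f v"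
  unfolding graph_inner_eq infsum_cnj[symmetric] by (simp add: mult.commute)

lemma inner_left_action:
  "graph_inner E (\<lambda>e. a (tg_rng E e) * f e) g v = graph_inner E f (\<lambda>e. cnj (a (tg_rng E e)) * g e) v"
  unfolding graph_inner_eq by (simp add: mult.assoc mult.left_commute)

lemma inner_definite_gf:
  assumes f: "f \<in> graph_functions E" and z: "graph_inner E f f = (\<lambda>_. 0)"
  shows "f = (\<lambda>_. 0)"
proof
  fix e
  have "gnorm f = 0" by (simp add: gnorm_def z)
  then show "f e = 0" using cmod_le_gnorm[OF f, of e] by simp
qed

lemma hilbert_module_X: "hilbert_module A X"
proof (intro hilbert_module.intro hilbert_module_axioms.intro cstar_algebra_C0 complex_space_on.intro)
  show "\<exists>y\<in>co_set X. co_add X x y = co_zero X" if "x \<in> co_set X" for x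
    using gf_scale[of x "-1"] that by (intro bexI[of _ "\<lambda>e. - x e"]) auto
  \<comment> \<open>The witness is the positive square root: \<open>\<langle>x, x\<rangle>\<close>
    is the square of the fibrewise norm, which itself vanishes at infinity.\<close>
  show "\<exists>b\<in>ca_set A. co_inner X x x = ca_mult A (ca_star A b) b" if "x \<in> co_set X" for x
    using gf_fnorm[of x] that
    by (intro bexI[of _ "\<lambda>v. complex_of_real (fnorm x v)"]) (auto simp: inner_self power2_eq_square)
  show "complete_wrt (co_dist A X) (co_set X)"
    unfolding complete_wrt_def cauchy_wrt_def co_dist_X using graph_complete by (auto simp: image_subset_iff)
qed (auto simp: gf_zero gf_add gf_scale gf_right inner_C0 inner_add_right inner_scale_right inner_right_action
    inner_cnj inner_definite_gf algebra_simps)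

lemma cstar_correspondence_X: "cstar_correspondence A X"
  by (intro cstar_correspondence.intro cstar_correspondence_axioms.intro hilbert_module_X)
    (auto simp: adjoint_pair_def gf_left gf_left_cnj inner_left_action distrib_right mult.assoc)

end

section \<open>Recognising a balanced tensor product\<close>

context locally_compact_graph
begin

lemma inner_diff_right:
  "f \<in> graph_functions E \<Longrightarrow> g \<in> graph_functions E \<Longrightarrow> h \<in> graph_functions E \<Longrightarrow>
    graph_inner E f (\<lambda>e. g e - h e) v = graph_inner E f g v - graph_inner E f h v"
  using inner_add_right[OF _ _ gf_scale[of h "-1"]] inner_scale_right[of f "-1" h] by simp

lemma inner_diff_left:
  assumes "f \<in> graph_functions E" "g \<in> graph_functions E" "h \<in> graph_functions E"
  shows "graph_inner E (\<lambda>e. f e - g e) h v = graph_inner E f h v - graph_inner E g h v"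
  using inner_diff_right[OF assms(3,1,2), of v] by (metis inner_cnj complex_cnj_diff)

lemma inner_add_left:
  assumes "f \<in> graph_functions E" "g \<in> graph_functions E" "h \<in> graph_functions E"
  shows "graph_inner E (\<lambda>e. f e + g e) h v = graph_inner E f h v + graph_inner E g h v"
  using inner_add_right[OF assms(3,1,2), of v] by (metis inner_cnj complex_cnj_add)

lemma gnorm_minus_commute:
  assumes f: "f \<in> graph_functions E" and g: "g \<in> graph_functions E"
  shows "gnorm (\<lambda>e. f e - g e) = gnorm (\<lambda>e. g e - f e)"
  using gnorm_dominated[OF gf_diff[OF f g] gf_diff[OF g f], of 1]
    gnorm_dominated[OF gf_diff[OF g f] gf_diff[OF f g], of 1]
  by (auto simp: norm_minus_commute)

lemma gnorm_diff_triangle: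
  assumes "f \<in> graph_functions E" "g \<in> graph_functions E" "h \<in> graph_functions E"
  shows "gnorm (\<lambda>e. f e - h e) \<le> gnorm (\<lambda>e. f e - g e) + gnorm (\<lambda>e. g e - h e)"
  using gnorm_triangle[OF gf_diff[OF assms(1,2)] gf_diff[OF assms(2,3)]] by simp

end

text \<open>A criterion for the graph correspondence to be the balanced tensor product of
  \<open>Y\<close> and \<open>Z\<close>: isometry on elementary tensors and density of their span
  fix the underlying module, and the compatibility assumptions carry the operations on
  representatives through \<open>M\<close>.\<close>

locale isometric_product = locally_compact_graph E
  for E :: "('v, 'e) topological_graph" +
  fixes Y :: "('v \<Rightarrow> complex, 'x) correspondence" and Z :: "('v \<Rightarrow> complex, 'y) correspondence"
    and M :: "'x \<Rightarrow> 'y \<Rightarrow> 'e \<Rightarrow> complex"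
  assumes Y: "cstar_correspondence (C0_algebra (tg_vertices E)) Y"
    and Z: "cstar_correspondence (C0_algebra (tg_vertices E)) Z"
    and M_closed: "x \<in> co_set Y \<Longrightarrow> y \<in> co_set Z \<Longrightarrow> M x y \<in> graph_functions E"
    and M_scale: "x \<in> co_set Y \<Longrightarrow> y \<in> co_set Z \<Longrightarrow> M (co_scale Y z x) y = (\<lambda>e. z * M x y e)"
    and M_left: "a \<in> C0_functions (tg_vertices E) \<Longrightarrow> x \<in> co_set Y \<Longrightarrow> y \<in> co_set Z \<Longrightarrow>
      M (co_left Y a x) y = (\<lambda>e. a (tg_rng E e) * M x y e)"
    and M_right: "a \<in> C0_functions (tg_vertices E) \<Longrightarrow> x \<in> co_set Y \<Longrightarrow> y \<in> co_set Z \<Longrightarrow>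
      M x (co_right Z y a) = (\<lambda>e. M x y e * a (tg_src E e))"
    and M_inner: "x \<in> co_set Y \<Longrightarrow> y \<in> co_set Z \<Longrightarrow> x' \<in> co_set Y \<Longrightarrow> y' \<in> co_set Z \<Longrightarrow>
      graph_inner E (M x y) (M x' y') = co_inner Z y (co_left Z (co_inner Y x x') y')"
    and M_dense: "h \<in> graph_functions E \<Longrightarrow> \<epsilon> > 0 \<Longrightarrow>
      \<exists>u\<in>formal_sums Y Z. gnorm (\<lambda>e. (\<Sum>(x, y)\<leftarrow>u. M x y e) - h e) < \<epsilon>"
begin

definition S :: "('x \<times> 'y) list \<Rightarrow> 'e \<Rightarrow> complex" where
  "S u e = (\<Sum>(x, y)\<leftarrow>u. M x y e)"

abbreviation "FS \<equiv> formal_sums Y Z"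

lemma FS_iff: "u \<in> FS \<longleftrightarrow> (\<forall>p\<in>set u. fst p \<in> co_set Y \<and> snd p \<in> co_set Z)"
  by (auto simp: formal_sums_def)

lemma S_Nil: "S [] = (\<lambda>_. 0)" and S_Cons: "S (p # u) = (\<lambda>e. M (fst p) (snd p) e + S u e)"
  by (auto simp: S_def fun_eq_iff split_beta)

lemma S_append: "S (u @ v) = (\<lambda>e. S u e + S v e)"
  by (simp add: S_def fun_eq_iff)

lemma S_closed: "u \<in> FS \<Longrightarrow> S u \<in> graph_functions E"
  by (induction u) (auto simp: S_Nil S_Cons gf_zero FS_iff intro!: gf_add M_closed)

text \<open>Scalar multiplication and both module actions change each summand of a formal sum so
  that its image is multiplied by a fixed function \<open>b\<close>; this treats the three cases at
  once.\<close>

lemma S_map: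
  assumes "u \<in> FS" "\<And>p e. p \<in> set u \<Longrightarrow> M (fst (t p)) (snd (t p)) e = b e * M (fst p) (snd p) e"
  shows "S (map t u) = (\<lambda>e. b e * S u e)"
  using assms
proof (induction u)
  case (Cons p u)
  then have "S (map t u) = (\<lambda>e. b e * S u e)" by (auto simp: FS_iff)
  with Cons show ?case by (simp add: S_Cons algebra_simps)
qed (simp add: S_Nil)

lemma Y_scale_closed: "x \<in> co_set Y \<Longrightarrow> co_scale Y z x \<in> co_set Y"
  using Y unfolding cstar_correspondence_def hilbert_module_def
  by (auto intro: complex_space_on.scale_closed)

lemma Y_left_closed: "a \<in> C0_functions VT \<Longrightarrow> x \<in> co_set Y \<Longrightarrow> co_left Y a x \<in> co_set Y"
  using cstar_correspondence.left_star[OF Y] unfolding adjoint_pair_def by (auto simp: image_subset_iff)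

lemma Z_right_closed: "a \<in> C0_functions VT \<Longrightarrow> y \<in> co_set Z \<Longrightarrow> co_right Z y a \<in> co_set Z"
  using Z unfolding cstar_correspondence_def by (auto intro: hilbert_module.right_closed)

lemma
  assumes u: "u \<in> FS"
  shows FS_scale: "formal_scale Y z u \<in> FS" and S_scale: "S (formal_scale Y z u) = (\<lambda>e. z * S u e)"
  unfolding formal_scale_def using u
  by (auto simp: FS_iff Y_scale_closed split_beta M_scale intro!: S_map)

lemma
  assumes u: "u \<in> FS" and a: "a \<in> C0_functions VT"
  shows FS_left: "map (\<lambda>(x, y). (co_left Y a x, y)) u \<in> FS"
    and S_left: "S (map (\<lambda>(x, y). (co_left Y a x, y)) u) = (\<lambda>e. a (tg_rng E e) * S u e)"
  using u a by (auto simp: FS_iff Y_left_closed split_beta M_left intro!: S_map)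

lemma
  assumes u: "u \<in> FS" and a: "a \<in> C0_functions VT"
  shows FS_right: "map (\<lambda>(x, y). (x, co_right Z y a)) u \<in> FS"
    and S_right: "S (map (\<lambda>(x, y). (x, co_right Z y a)) u) = (\<lambda>e. S u e * a (tg_src E e))"
proof -
  show "map (\<lambda>(x, y). (x, co_right Z y a)) u \<in> FS"
    using u a by (auto simp: FS_iff Z_right_closed)
  have "S (map (\<lambda>(x, y). (x, co_right Z y a)) u) = (\<lambda>e. a (tg_src E e) * S u e)"
    using u a by (auto simp: FS_iff split_beta M_right intro!: S_map)
  then show "S (map (\<lambda>(x, y). (x, co_right Z y a)) u) = (\<lambda>e. S u e * a (tg_src E e))"
    by (simp add: mult.commute)
qed

lemma FS_append: "u \<in> FS \<Longrightarrow> v \<in> FS \<Longrightarrow> u @ v \<in> FS"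
  by (auto simp: FS_iff)

lemma inner_S_right:
  assumes f: "f \<in> graph_functions E" and v: "v \<in> FS"
  shows "graph_inner E f (S v) w = (\<Sum>p\<leftarrow>v. graph_inner E f (M (fst p) (snd p)) w)"
  using v
proof (induction v)
  case Nil
  show ?case by (simp add: S_Nil graph_inner_eq)
next
  case (Cons p v)
  then have "M (fst p) (snd p) \<in> graph_functions E" "v \<in> FS" by (auto simp: FS_iff M_closed)
  then show ?case using Cons.IH f S_closed by (simp add: S_Cons inner_add_right)
qed

lemma foldr_C0_add: "foldr (ca_add A) L (ca_zero A) = (\<lambda>w. \<Sum>g\<leftarrow>L. g w)"
  by (induction L) auto

text \<open>Both sides are additive in each list, so the identity reduces to \<open>M_inner\<close>
  on pairs of summands. It turns the formal distance into the norm distance of the images under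
  \<open>S\<close>, so that null vectors are exactly the formal sums with image 0.\<close>

lemma formal_inner_eq:
  assumes u: "u \<in> FS" and v: "v \<in> FS"
  shows "formal_inner A Y Z u v = graph_inner E (S u) (S v)"
proof
  fix w
  have "formal_inner A Y Z u v w =
      (\<Sum>p\<leftarrow>u. \<Sum>q\<leftarrow>v. co_inner Z (snd p) (co_left Z (co_inner Y (fst p) (fst q)) (snd q)) w)"
    unfolding formal_inner_def foldr_C0_add
    by (induction u) (simp_all add: o_def split_beta)
  also have "\<dots> = graph_inner E (S u) (S v) w"
    using u
  proof (induction u)
    case Nil
    show ?case by (simp add: S_Nil graph_inner_eq)
  next
    case (Cons p u)
    then have p: "fst p \<in> co_set Y" "snd p \<in> co_set Z" "u \<in> FS" by (auto simp: FS_iff)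
    have "(\<Sum>q\<leftarrow>v. co_inner Z (snd p) (co_left Z (co_inner Y (fst p) (fst q)) (snd q)) w)
        = graph_inner E (M (fst p) (snd p)) (S v) w"
      unfolding inner_S_right[OF M_closed[OF p(1,2)] v]
      by (rule arg_cong[of _ _ sum_list], rule map_cong)
        (use v p in \<open>auto simp: FS_iff M_inner\<close>)
    then show ?case using Cons.IH[OF p(3)]
      by (simp add: S_Cons inner_add_left M_closed p S_closed v)
  qed
  finally show "formal_inner A Y Z u v w = graph_inner E (S u) (S v) w" .
qed

lemma formal_dist_eq:
  assumes "u \<in> FS" "v \<in> FS"
  shows "formal_dist A Y Z u v = gnorm (\<lambda>e. S u e - S v e)"
  using assms by (simp add: formal_dist_def Let_def formal_inner_eq FS_append FS_scale S_append S_scale gnorm_def)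

section \<open>Limits of Cauchy sequences of formal sums\<close>

definition tends :: "(nat \<Rightarrow> ('x \<times> 'y) list) \<Rightarrow> ('e \<Rightarrow> complex) \<Rightarrow> bool" where
  "tends w f \<longleftrightarrow> (\<forall>i. w i \<in> FS) \<and> f \<in> graph_functions E \<and> (\<lambda>i. gnorm (\<lambda>e. S (w i) e - f e)) \<longlonglongrightarrow> 0"

lemma
  assumes "tends w f"
  shows tends_FS: "w i \<in> FS" and tends_gf: "f \<in> graph_functions E"
    and tends_lim: "(\<lambda>i. gnorm (\<lambda>e. S (w i) e - f e)) \<longlonglongrightarrow> 0"
  using assms by (auto simp: tends_def)

lemma tendsI:
  assumes "\<And>i. w i \<in> FS" "f \<in> graph_functions E"
    and "\<And>i. gnorm (\<lambda>e. S (w i) e - f e) \<le> b i" "b \<longlonglongrightarrow> 0"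
  shows "tends w f"
  unfolding tends_def
proof (intro conjI allI assms(1,2))
  show "(\<lambda>i. gnorm (\<lambda>e. S (w i) e - f e)) \<longlonglongrightarrow> 0"
    by (rule tendsto_sandwich[OF _ _ tendsto_const assms(4)])
      (use assms(3) gnorm_nonneg[OF gf_diff[OF S_closed[OF assms(1)] assms(2)]] in auto)
qed

lemma formal_cauchy_iff:
  "w \<in> formal_cauchy A Y Z \<longleftrightarrow> (\<forall>i. w i \<in> FS) \<and>
     (\<forall>\<epsilon>>0. \<exists>N. \<forall>i\<ge>N. \<forall>j\<ge>N. gnorm (\<lambda>e. S (w i) e - S (w j) e) < \<epsilon>)"
proof (cases "\<forall>i. w i \<in> FS")
  case True
  then show ?thesis by (auto simp: formal_cauchy_def cauchy_wrt_def formal_dist_eq)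
next
  case False
  then show ?thesis by (auto simp: formal_cauchy_def image_subset_iff)
qed

lemma tends_cauchy:
  assumes w: "tends w f"
  shows "w \<in> formal_cauchy A Y Z"
  unfolding formal_cauchy_iff
proof (intro conjI allI impI tends_FS[OF w])
  fix \<epsilon> :: real assume "\<epsilon> > 0"
  then have "\<epsilon>/2 > 0" by simp
  from LIMSEQ_D[OF tends_lim[OF w] this] obtain N
    where N: "\<forall>i\<ge>N. norm (gnorm (\<lambda>e. S (w i) e - f e) - 0) < \<epsilon>/2" by blast
  note Sw = S_closed[OF tends_FS[OF w]] and f = tends_gf[OF w]
  have "gnorm (\<lambda>e. S (w i) e - S (w j) e) < \<epsilon>" if "i \<ge> N" "j \<ge> N" for i j
  proof -
    have "gnorm (\<lambda>e. S (w i) e - f e) < \<epsilon>/2" "gnorm (\<lambda>e. S (w j) e - f e) < \<epsilon>/2"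
      using N that by auto
    then show ?thesis
      using gnorm_diff_triangle[OF Sw[of i] f Sw[of j]] gnorm_minus_commute[OF f Sw[of j]] by simp
  qed
  then show "\<exists>N. \<forall>i\<ge>N. \<forall>j\<ge>N. gnorm (\<lambda>e. S (w i) e - S (w j) e) < \<epsilon>" by blast
qed

text \<open>Completeness of the target enters here: \<open>S\<close> carries Cauchy sequences of
  formal sums to norm Cauchy sequences of functions.\<close>

lemma cauchy_tends:
  assumes "w \<in> formal_cauchy A Y Z"
  obtains f where "tends w f"
proof -
  have w: "\<forall>i. w i \<in> FS" "\<forall>\<epsilon>>0. \<exists>N. \<forall>i\<ge>N. \<forall>j\<ge>N. gnorm (\<lambda>e. S (w i) e - S (w j) e) < \<epsilon>"
    using assms unfolding formal_cauchy_iff by auto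
  have "\<exists>l\<in>graph_functions E. (\<lambda>i. gnorm (\<lambda>e. S (w i) e - l e)) \<longlonglongrightarrow> 0"
    by (rule graph_complete[of "\<lambda>i. S (w i)"]) (use w S_closed in auto)
  then show thesis using w(1) that unfolding tends_def by blast
qed

text \<open>The formal distance is the norm distance of the images, so it tends to 0 exactly when
  the images share their limit; \<open>cmod_le_gnorm\<close> turns distance 0 into equality.
  Equivalence classes are thereby indexed by their limits.\<close>

lemma tends_rel:
  assumes w: "tends w f" and w': "tends w' g"
  shows "(\<lambda>i. formal_dist A Y Z (w i) (w' i)) \<longlonglongrightarrow> 0 \<longleftrightarrow> f = g"
proof -
  note Sw = S_closed[OF tends_FS[OF w]] and Sw' = S_closed[OF tends_FS[OF w']]
    and f = tends_gf[OF w] and g = tends_gf[OF w']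
  have eq: "formal_dist A Y Z (w i) (w' i) = gnorm (\<lambda>e. S (w i) e - S (w' i) e)" for i
    by (rule formal_dist_eq[OF tends_FS[OF w] tends_FS[OF w']])
  have lim: "(\<lambda>i. gnorm (\<lambda>e. S (w i) e - f e) + gnorm (\<lambda>e. S (w' i) e - g e)) \<longlonglongrightarrow> 0"
    using tendsto_add[OF tends_lim[OF w] tends_lim[OF w']] by simp
  show ?thesis unfolding eq
  proof
    assume "f = g"
    then have "gnorm (\<lambda>e. S (w i) e - S (w' i) e) \<le> gnorm (\<lambda>e. S (w i) e - f e) + gnorm (\<lambda>e. S (w' i) e - g e)" for i
      using gnorm_diff_triangle[OF Sw[of i] f Sw'[of i]] gnorm_minus_commute[OF f Sw'[of i]] by simp
    then show "(\<lambda>i. gnorm (\<lambda>e. S (w i) e - S (w' i) e)) \<longlonglongrightarrow> 0"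
      by (intro tendsto_sandwich[OF _ _ tendsto_const lim]) (simp_all add: gnorm_nonneg gf_diff Sw Sw')
  next
    assume 0: "(\<lambda>i. gnorm (\<lambda>e. S (w i) e - S (w' i) e)) \<longlonglongrightarrow> 0"
    have *: "gnorm (\<lambda>e. f e - g e) \<le> (gnorm (\<lambda>e. S (w i) e - f e) + gnorm (\<lambda>e. S (w' i) e - g e)) +
        gnorm (\<lambda>e. S (w i) e - S (w' i) e)" for i
      using gnorm_diff_triangle[OF f Sw[of i] g] gnorm_diff_triangle[OF Sw[of i] Sw'[of i] g]
        gnorm_minus_commute[OF f Sw[of i]] by simp
    have "gnorm (\<lambda>e. f e - g e) \<le> 0 + 0"
      by (rule tendsto_lowerbound[OF tendsto_add[OF lim 0]]) (use * in auto)
    then have "cmod (f e - g e) \<le> 0" for e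
      using cmod_le_gnorm[OF gf_diff[OF f g], of e] by linarith
    then show "f = g" by (simp add: fun_eq_iff)
  qed
qed

lemma tends_exists:
  assumes h: "h \<in> graph_functions E"
  obtains w where "tends w h"
proof -
  have "\<forall>i. \<exists>u. u \<in> FS \<and> gnorm (\<lambda>e. S u e - h e) < inverse (real (Suc i))"
  proof
    fix i
    have "inverse (real (Suc i)) > 0" by simp
    from M_dense[OF h this] show "\<exists>u. u \<in> FS \<and> gnorm (\<lambda>e. S u e - h e) < inverse (real (Suc i))"
      unfolding S_def by (simp only: Bex_def)
  qed
  from choice[OF this] obtain w where w: "\<forall>i. w i \<in> FS \<and> gnorm (\<lambda>e. S (w i) e - h e) < inverse (real (Suc i))"
    by blast
  have "tends w h"
    by (rule tendsI[OF _ h _ LIMSEQ_inverse_real_of_nat]) (use w less_imp_le in auto)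
  then show thesis by (rule that)
qed

text \<open>The class belonging to \<open>f\<close>, that is, the inverse of the isomorphism sought.
  Passing from functions to classes makes choices harmless: of the sequence that
  \<open>tensor_rep\<close> picks from \<open>K f\<close>, it matters only that it tends to
  \<open>f\<close>.\<close>

definition K :: "('e \<Rightarrow> complex) \<Rightarrow> (nat \<Rightarrow> ('x \<times> 'y) list) set" where
  "K f = {w. tends w f}"

lemma tensor_class_eq:
  assumes w: "tends w f"
  shows "tensor_class A Y Z w = K f"
proof (intro set_eqI iffI)
  fix w' assume "w' \<in> tensor_class A Y Z w"
  then have *: "w' \<in> formal_cauchy A Y Z" "(\<lambda>i. formal_dist A Y Z (w i) (w' i)) \<longlonglongrightarrow> 0"
    by (auto simp: tensor_class_def tensor_rel_def)
  then obtain g where g: "tends w' g" using cauchy_tends by blast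
  then show "w' \<in> K f" using tends_rel[OF w g] * by (simp add: K_def)
next
  fix w' assume "w' \<in> K f"
  then have w': "tends w' f" by (simp add: K_def)
  show "w' \<in> tensor_class A Y Z w"
    using tends_rel[OF w w'] tends_cauchy[OF w] tends_cauchy[OF w']
    by (simp add: tensor_class_def tensor_rel_def)
qed

lemma tensor_set: "co_set (tensor_product A Y Z) = K ` graph_functions E"
proof -
  have "formal_cauchy A Y Z // tensor_rel A Y Z = (\<lambda>w. tensor_class A Y Z w) ` formal_cauchy A Y Z"
    by (auto simp: quotient_def tensor_class_def)
  also have "\<dots> = K ` graph_functions E"
  proof (intro equalityI subsetI)
    fix P assume "P \<in> (\<lambda>w. tensor_class A Y Z w) ` formal_cauchy A Y Z"
    then obtain w where w: "w \<in> formal_cauchy A Y Z" "P = tensor_class A Y Z w" by blast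
    obtain f where f: "tends w f" using cauchy_tends[OF w(1)] by blast
    then show "P \<in> K ` graph_functions E" using w(2) tensor_class_eq[OF f] tends_gf[OF f] by blast
  next
    fix P assume "P \<in> K ` graph_functions E"
    then obtain f where f: "f \<in> graph_functions E" "P = K f" by blast
    obtain w where w: "tends w f" using tends_exists[OF f(1)] by blast
    show "P \<in> (\<lambda>w. tensor_class A Y Z w) ` formal_cauchy A Y Z"
      using tends_cauchy[OF w] tensor_class_eq[OF w] f(2) by blast
  qed
  finally show ?thesis by (simp add: tensor_product_def)
qed

lemma tends_rep: "f \<in> graph_functions E \<Longrightarrow> tends (tensor_rep (K f)) f"
  unfolding tensor_rep_def K_def using tends_exists[of f] by (metis mem_Collect_eq someI_ex)

lemma tends_unique: "tends w f \<Longrightarrow> tends w g \<Longrightarrow> f = g"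
  using tends_rel[of w f w f] tends_rel[of w f w g] by simp

lemma inj_K: "inj_on K (graph_functions E)"
proof (rule inj_onI)
  fix f g assume "f \<in> graph_functions E" "g \<in> graph_functions E" "K f = K g"
  then show "f = g" using tends_rep[of f] tends_rep[of g] tends_unique by simp
qed

section \<open>The operations of the tensor product, read off from limits\<close>

lemma tensor_add:
  assumes f: "f \<in> graph_functions E" and g: "g \<in> graph_functions E"
  shows "co_add (tensor_product A Y Z) (K f) (K g) = K (\<lambda>e. f e + g e)"
proof -
  let ?u = "tensor_rep (K f)" and ?w = "tensor_rep (K g)"
  note u = tends_rep[OF f] and w = tends_rep[OF g]
  have "tends (\<lambda>i. ?u i @ ?w i) (\<lambda>e. f e + g e)"
  proof (rule tendsI)
    show "gnorm (\<lambda>e. S (?u i @ ?w i) e - (f e + g e)) \<le> gnorm (\<lambda>e. S (?u i) e - f e) + gnorm (\<lambda>e. S (?w i) e - g e)" for i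
      using gnorm_triangle[OF gf_diff[OF S_closed[OF tends_FS[OF u, of i]] f] gf_diff[OF S_closed[OF tends_FS[OF w, of i]] g]]
      by (simp add: S_append algebra_simps)
    show "(\<lambda>i. gnorm (\<lambda>e. S (?u i) e - f e) + gnorm (\<lambda>e. S (?w i) e - g e)) \<longlonglongrightarrow> 0"
      using tendsto_add[OF tends_lim[OF u] tends_lim[OF w]] by simp
  qed (auto intro: FS_append tends_FS[OF u] tends_FS[OF w] gf_add f g)
  then show ?thesis by (simp add: tensor_product_def tensor_class_eq)
qed

text \<open>Scalars and both actions multiply functions on edges by a bounded function, so one
  estimate covers the three operations.\<close>

lemma tends_bounded_mult:
  assumes w: "tends w f" and w': "\<And>i. w' i \<in> FS" "\<And>i. S (w' i) = (\<lambda>e. b e * S (w i) e)"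
    and b: "(\<lambda>e. b e * f e) \<in> graph_functions E" "\<And>e. e \<in> topspace ET \<Longrightarrow> cmod (b e) \<le> B" "0 \<le> B"
  shows "tends w' (\<lambda>e. b e * f e)"
proof (rule tendsI[OF w'(1) b(1)])
  show "gnorm (\<lambda>e. S (w' i) e - b e * f e) \<le> B * gnorm (\<lambda>e. S (w i) e - f e)" for i
    by (rule gnorm_dominated[OF gf_diff[OF S_closed[OF tends_FS[OF w]] tends_gf[OF w]]
          gf_diff[OF S_closed[OF w'(1)] b(1)] b(3)])
      (use b(2) in \<open>simp add: w'(2) norm_mult mult_right_mono flip: right_diff_distrib\<close>)
  show "(\<lambda>i. B * gnorm (\<lambda>e. S (w i) e - f e)) \<longlonglongrightarrow> 0"
    using tendsto_mult[OF tendsto_const tends_lim[OF w]] by simp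
qed

lemma tensor_scale:
  assumes f: "f \<in> graph_functions E"
  shows "co_scale (tensor_product A Y Z) z (K f) = K (\<lambda>e. z * f e)"
proof -
  note u = tends_rep[OF f]
  have "tends (\<lambda>i. formal_scale Y z (tensor_rep (K f) i)) (\<lambda>e. z * f e)"
    by (rule tends_bounded_mult[OF u, of _ "\<lambda>_. z" "cmod z"])
      (auto simp: FS_scale S_scale tends_FS[OF u] gf_scale f)
  then show ?thesis by (simp add: tensor_product_def tensor_class_eq)
qed

lemma tensor_left:
  assumes f: "f \<in> graph_functions E" and a: "a \<in> C0_functions VT"
  shows "co_left (tensor_product A Y Z) a (K f) = K (\<lambda>e. a (tg_rng E e) * f e)"
proof -
  note u = tends_rep[OF f]
  have "tends (\<lambda>i. map (\<lambda>(x, y). (co_left Y a x, y)) (tensor_rep (K f) i)) (\<lambda>e. a (tg_rng E e) * f e)"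
    by (rule tends_bounded_mult[OF u, of _ "\<lambda>e. a (tg_rng E e)" "SUP v. cmod (a v)"])
      (auto simp: FS_left S_left tends_FS[OF u] gf_left f a cmod_le_supnorm[OF a] supnorm_nonneg[OF a])
  then show ?thesis by (simp add: tensor_product_def tensor_class_eq)
qed

lemma tensor_right:
  assumes f: "f \<in> graph_functions E" and a: "a \<in> C0_functions VT"
  shows "co_right (tensor_product A Y Z) (K f) a = K (\<lambda>e. f e * a (tg_src E e))"
proof -
  note u = tends_rep[OF f]
  have "tends (\<lambda>i. map (\<lambda>(x, y). (x, co_right Z y a)) (tensor_rep (K f) i)) (\<lambda>e. a (tg_src E e) * f e)"
    by (rule tends_bounded_mult[OF u, of _ "\<lambda>e. a (tg_src E e)" "SUP v. cmod (a v)"])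
      (use gf_right[OF f a] in \<open>auto simp: FS_right S_right tends_FS[OF u] f a cmod_le_supnorm[OF a] supnorm_nonneg[OF a] mult.commute\<close>)
  then show ?thesis by (simp add: tensor_product_def tensor_class_eq mult.commute)
qed

lemma tensor_inner:
  assumes f: "f \<in> graph_functions E" and g: "g \<in> graph_functions E"
  shows "co_inner (tensor_product A Y Z) (K f) (K g) = graph_inner E f g"
proof -
  define u w where "u = tensor_rep (K f)" and "w = tensor_rep (K g)"
  have u: "tends u f" and w: "tends w g" unfolding u_def w_def by (rule tends_rep[OF f], rule tends_rep[OF g])
  note Su = S_closed[OF tends_FS[OF u]] and Sw = S_closed[OF tends_FS[OF w]]
  have eq: "formal_inner A Y Z (u i) (w i) = graph_inner E (S (u i)) (S (w i))" for i
    by (rule formal_inner_eq[OF tends_FS[OF u] tends_FS[OF w]])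
  \<comment> \<open>Writing \<open>u\<close> and \<open>w\<close> for their images under
    \<open>S\<close>, this comes from \<open>\<langle>u, w\<rangle> - \<langle>f, g\<rangle> =
    \<langle>u - f, w\<rangle> + \<langle>f, w - g\<rangle>\<close> and
    \<open>|w| \<le> |w - g| + |g|\<close>; the last estimate saves a separate bound on the norms of
    \<open>w\<close>.\<close>
  define b where "b i = gnorm (\<lambda>e. S (u i) e - f e) * (gnorm (\<lambda>e. S (w i) e - g e) + gnorm g) +
      gnorm f * gnorm (\<lambda>e. S (w i) e - g e)" for i
  have "b \<longlonglongrightarrow> 0 * (0 + gnorm g) + gnorm f * 0"
    unfolding b_def by (intro tendsto_intros tends_lim[OF u] tends_lim[OF w])
  then have b: "b \<longlonglongrightarrow> 0" by simp
  have le: "ca_dist A (graph_inner E (S (u i)) (S (w i))) (graph_inner E f g) \<le> b i" for i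
    unfolding ca_dist_C0
  proof (rule supnorm_leI)
    fix v
    have "graph_inner E (S (u i)) (S (w i)) v - graph_inner E f g v =
        graph_inner E (\<lambda>e. S (u i) e - f e) (S (w i)) v + graph_inner E f (\<lambda>e. S (w i) e - g e) v"
      using inner_diff_left[OF Su[of i] f Sw[of i], of v] inner_diff_right[OF f Sw[of i] g, of v] by simp
    then have "cmod (graph_inner E (S (u i)) (S (w i)) v - graph_inner E f g v) \<le>
       cmod (graph_inner E (\<lambda>e. S (u i) e - f e) (S (w i)) v) + cmod (graph_inner E f (\<lambda>e. S (w i) e - g e) v)"
      by (simp add: norm_triangle_ineq)
    also have "\<dots> \<le> gnorm (\<lambda>e. S (u i) e - f e) * gnorm (S (w i)) + gnorm f * gnorm (\<lambda>e. S (w i) e - g e)"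
      by (intro add_mono supnorm_inner_le gf_diff Su Sw f g)
    also have "\<dots> \<le> b i"
      unfolding b_def
      by (intro add_mono mult_left_mono order_refl gnorm_nonneg gf_diff Su f)
        (use gnorm_triangle[OF gf_diff[OF Sw[of i] g] g] in simp)
    finally show "cmod (graph_inner E (S (u i)) (S (w i)) v - graph_inner E f g v) \<le> b i" .
  qed
  have lim: "(\<lambda>i. ca_dist A (graph_inner E (S (u i)) (S (w i))) (graph_inner E f g)) \<longlonglongrightarrow> 0"
  proof (rule tendsto_sandwich[OF _ _ tendsto_const b])
    have "0 \<le> ca_dist A (graph_inner E (S (u i)) (S (w i))) (graph_inner E f g)" for i
      unfolding ca_dist_C0 by (rule supnorm_nonneg[OF C0_diff[OF inner_C0[OF Su Sw] inner_C0[OF f g]]])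
    then show "\<forall>\<^sub>F i in sequentially. 0 \<le> ca_dist A (graph_inner E (S (u i)) (S (w i))) (graph_inner E f g)" by simp
  qed (simp add: le)
  have "co_inner (tensor_product A Y Z) (K f) (K g) =
      (THE a. a \<in> ca_set A \<and> (\<lambda>i. ca_dist A (graph_inner E (S (u i)) (S (w i))) a) \<longlonglongrightarrow> 0)"
    by (simp add: tensor_product_def eq flip: u_def w_def)
  also have "\<dots> = graph_inner E f g"
  proof (rule the_equality)
    fix a assume a: "a \<in> ca_set A \<and> (\<lambda>i. ca_dist A (graph_inner E (S (u i)) (S (w i))) a) \<longlonglongrightarrow> 0"
    show "a = graph_inner E f g"
      by (rule ca_dist_C0_unique[OF inner_C0[OF Su Sw] _ inner_C0[OF f g] _ lim]) (use a in auto)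
  qed (use lim inner_C0[OF f g] in simp)
  finally show ?thesis .
qed

theorem tensor_product_iso:
  "\<exists>U. correspondence_iso A (tensor_product A Y Z) X U \<and>
     (\<forall>x\<in>co_set Y. \<forall>y\<in>co_set Z. U (elementary_tensor A Y Z x y) = M x y)"
proof (intro exI conjI ballI)
  let ?U = "the_inv_into (graph_functions E) K"
  have UK: "?U (K f) = f" if "f \<in> graph_functions E" for f
    using inj_K that by (rule the_inv_into_f_f)
  show "correspondence_iso A (tensor_product A Y Z) X ?U"
    unfolding correspondence_iso_def tensor_set
  proof (intro conjI)
    show "bij_betw ?U (K ` graph_functions E) (co_set X)"
      using bij_betw_the_inv_into[OF inj_on_imp_bij_betw[OF inj_K]] by simp
  qed (auto simp: UK tensor_add tensor_scale tensor_left tensor_right tensor_inner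
      gf_add gf_scale gf_left gf_right)
  fix x y assume xy: "x \<in> co_set Y" "y \<in> co_set Z"
  \<comment> \<open>The terms of the constant sequence already have image \<open>M x y\<close>, so
    all distances are 0.\<close>
  have "tends (\<lambda>_. [(x, y)]) (M x y)"
    using xy M_closed[OF xy] by (simp add: tends_def FS_iff S_Cons S_Nil gnorm_def graph_inner_eq)
  then show "?U (elementary_tensor A Y Z x y) = M x y"
    using UK[OF M_closed[OF xy]] by (simp add: elementary_tensor_def tensor_class_eq)
qed

end

section \<open>Compactly supported functions\<close>

context locally_compact_graph
begin

text \<open>Each fibre meets \<open>U\<close> in at most one point \<open>\<sigma> v\<close>, so no
  infinite sum occurs and the fibrewise norm is the modulus of \<open>f (\<sigma> v)\<close>. It
  vanishes off the image of \<open>C\<close>, which is compact and hence closed, so it extends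
  continuously by zero.\<close>

lemma gf_section_support:
  assumes U: "open_section U" and C: "compactin ET C" "C \<subseteq> U"
    and f: "continuous_map ET euclidean f" "\<And>e. e \<notin> C \<Longrightarrow> f e = 0"
  shows "f \<in> graph_functions E"
proof -
  obtain \<sigma> where \<sigma>: "continuous_map (subtopology VT (tg_src E ` U)) ET \<sigma>"
    "\<And>v. v \<in> tg_src E ` U \<Longrightarrow> \<sigma> v \<in> U \<and> tg_src E (\<sigma> v) = v" "\<And>e. e \<in> U \<Longrightarrow> \<sigma> (tg_src E e) = e"
    using open_section_inverse[OF U] by blast
  have UW: "U \<subseteq> topspace ET" by (rule open_section_subset[OF U])
  have one: "(\<lambda>e. (cmod (f e))\<^sup>2) summable_on fib v \<and>
      (\<Sum>\<^sub>\<infinity>e\<in>fib v. (cmod (f e))\<^sup>2) = (if v \<in> tg_src E ` C then (cmod (f (\<sigma> v)))\<^sup>2 else 0)" for v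
  proof (cases "v \<in> tg_src E ` C")
    case True
    then have v: "\<sigma> v \<in> U" "tg_src E (\<sigma> v) = v" using \<sigma>(2) C by auto
    have z: "f e = 0" if "e \<in> fib v" "e \<noteq> \<sigma> v" for e
      using f(2)[of e] \<sigma>(3)[of e] C(2) that by (auto simp: fib_iff)
    have in1: "\<sigma> v \<in> fib v" using v UW by (auto simp: fib_iff)
    have "(\<lambda>e. (cmod (f e))\<^sup>2) summable_on fib v \<longleftrightarrow> (\<lambda>e. (cmod (f e))\<^sup>2) summable_on {\<sigma> v}"
      by (rule summable_on_cong_neutral) (use z in1 in auto)
    moreover have "(\<Sum>\<^sub>\<infinity>e\<in>fib v. (cmod (f e))\<^sup>2) = (\<Sum>\<^sub>\<infinity>e\<in>{\<sigma> v}. (cmod (f e))\<^sup>2)"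
      by (rule infsum_cong_neutral) (use z in1 in auto)
    ultimately show ?thesis using True by simp
  next
    case False
    then have z: "f e = 0" if "e \<in> fib v" for e
      using f(2)[of e] that by (auto simp: fib_iff)
    have "(\<lambda>e. (cmod (f e))\<^sup>2) summable_on fib v \<longleftrightarrow> (\<lambda>_. 0::real) summable_on fib v"
      by (rule summable_on_cong) (use z in auto)
    then show ?thesis using False z by (simp add: infsum_0)
  qed
  then have sq: "square_summable f (fib v)" for v by (simp add: square_summable_def)
  have fn: "fnorm f v = (if v \<in> tg_src E ` C then cmod (f (\<sigma> v)) else 0)" for v
    using one[of v] by (simp add: l2norm_def)
  have K: "compactin VT (tg_src E ` C)" using image_compactin[OF C(1) continuous_src] .
  then have Kc: "closedin VT (tg_src E ` C)" by (rule compactin_imp_closedin[OF hausdorff_vertices])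
  have "continuous_map VT euclidean (\<lambda>v. complex_of_real (fnorm f v))"
  proof (rule continuous_map_glue_zero[OF _ Kc])
    show "openin VT (tg_src E ` U)" using U by (simp add: open_section_def)
    show "tg_src E ` C \<subseteq> tg_src E ` U" using C(2) by blast
    have "continuous_map (subtopology VT (tg_src E ` U)) euclidean (f \<circ> \<sigma>)"
      using \<sigma>(1) f(1) by (rule continuous_map_compose)
    then have "continuous_map (subtopology VT (tg_src E ` U)) euclidean (\<lambda>v. complex_of_real (cmod ((f \<circ> \<sigma>) v)))"
      by (rule continuous_map_compose_cont) (intro continuous_intros)
    then show "continuous_map (subtopology VT (tg_src E ` U)) euclidean (\<lambda>v. complex_of_real (fnorm f v))"
    proof (rule continuous_map_cong_topspace)
      fix v assume "v \<in> topspace (subtopology VT (tg_src E ` U))"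
      then have v: "v \<in> tg_src E ` U" by simp
      have "f (\<sigma> v) = 0" if "v \<notin> tg_src E ` C"
        using f(2)[of "\<sigma> v"] \<sigma>(2)[OF v] that by (metis image_eqI)
      then show "complex_of_real (cmod ((f \<circ> \<sigma>) v)) = complex_of_real (fnorm f v)"
        by (simp add: fn)
    qed
  qed (simp add: fn)
  then have "(\<lambda>v. complex_of_real (fnorm f v)) \<in> C0_functions VT"
  proof (rule C0_I)
    show "complex_of_real (fnorm f v) = 0" if "v \<notin> topspace VT" for v
      using compactin_subset_topspace[OF K] that by (auto simp: fn)
    show "\<exists>K. compactin VT K \<and> {v \<in> topspace VT. \<epsilon> \<le> cmod (complex_of_real (fnorm f v))} \<subseteq> K" if "\<epsilon> > 0" for \<epsilon>
      by (rule exI[of _ "tg_src E ` C"]) (use K that in \<open>auto simp: fn split: if_splits\<close>)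
  qed
  moreover have "f e = 0" if "e \<notin> topspace ET" for e
    using f(2)[of e] that C UW by blast
  ultimately show ?thesis unfolding graph_functions_iff using f sq by blast
qed

text \<open>The finitely many sections that exhaust a fibre up to \<open>\<epsilon>\<close> sweep
  out a compact set of edges when they run over a compact neighbourhood of \<open>v\<close>.\<close>

lemma compactly_concentrated:
  assumes h: "h \<in> graph_functions E" and \<epsilon>: "\<epsilon> > 0" and v: "v \<in> topspace VT"
  shows "\<exists>O' L. openin VT O' \<and> v \<in> O' \<and> compactin ET L \<and>
    (\<forall>w\<in>O'. (\<Sum>\<^sub>\<infinity>e\<in>fib w - L. (cmod (h e))\<^sup>2) < \<epsilon>)"
proof -
  let ?G = "\<lambda>e. (cmod (h e))\<^sup>2"
  note maj = squares_majorant[OF h gf_zero, of 1, simplified]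
  have "\<exists>N F \<sigma>. openin VT N \<and> v \<in> N \<and> finite F \<and>
    (\<forall>e\<in>F. continuous_map (subtopology VT N) ET (\<sigma> e)) \<and>
    (\<forall>v\<in>N. \<forall>e\<in>F. \<sigma> e v \<in> fib v) \<and>
    (\<forall>v\<in>N. inj_on (\<lambda>e. \<sigma> e v) (F :: 'e set)) \<and>
    (\<forall>v\<in>N. infsum ?G (fib v - (\<lambda>e. \<sigma> e v) ` F) < \<epsilon>)"
    by (rule small_tails[OF maj(1) _ maj(2,3) v \<epsilon>]) simp
  then obtain N and F :: "'e set" and \<sigma> where N: "openin VT N" "v \<in> N" "finite F"
      "\<forall>e\<in>F. continuous_map (subtopology VT N) ET (\<sigma> e)"
      "\<forall>v\<in>N. \<forall>e\<in>F. \<sigma> e v \<in> fib v"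
      "\<forall>v\<in>N. infsum ?G (fib v - (\<lambda>e. \<sigma> e v) ` F) < \<epsilon>" by blast
  have "compactin VT {v}" "{v} \<subseteq> N" using v N(2) by auto
  from bump_function[OF locally_compact_vertices hausdorff_vertices this N(1)]
  obtain \<phi> :: "'v \<Rightarrow> real" and C where \<phi>: "continuous_map VT euclidean \<phi>" "\<phi> v = 1" "compactin VT C" "C \<subseteq> N"
    "\<forall>x\<in>topspace VT. x \<notin> C \<longrightarrow> \<phi> x = 0"
    by (metis singletonI)
  \<comment> \<open>The positivity set of the bump function is an open neighbourhood of
    \<open>v\<close> inside the compact set \<open>C \<subseteq> N\<close>.\<close>
  define O' where "O' = {x \<in> topspace VT. \<phi> x \<in> {0<..}}"
  have "openin VT O'" unfolding O'_def by (rule openin_continuous_map_preimage[OF \<phi>(1)]) auto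
  have "v \<in> O'" "O' \<subseteq> C" using v \<phi> by (auto simp: O'_def)
  define L where "L = (\<Union>e\<in>F. \<sigma> e ` C)"
  have "compactin ET L"
    unfolding L_def
  proof (rule compactin_Union)
    show "finite ((\<lambda>e. \<sigma> e ` C) ` F)" using N(3) by simp
    fix S assume "S \<in> (\<lambda>e. \<sigma> e ` C) ` F"
    then obtain e where e: "e \<in> F" "S = \<sigma> e ` C" by blast
    have "compactin (subtopology VT N) C" using \<phi> by (simp add: compactin_subtopology)
    then show "compactin ET S" using image_compactin N(4) e by blast
  qed
  have "(\<Sum>\<^sub>\<infinity>e\<in>fib w - L. ?G e) < \<epsilon>" if w: "w \<in> O'" for w
  proof -
    have wC: "w \<in> C" "w \<in> N" using w \<open>O' \<subseteq> C\<close> \<phi>(4) by auto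
    have "(\<Sum>\<^sub>\<infinity>e\<in>fib w - L. ?G e) \<le> infsum ?G (fib w - (\<lambda>e. \<sigma> e w) ` F)"
    proof (rule infsum_mono2)
      show "fib w - L \<subseteq> fib w - (\<lambda>e. \<sigma> e w) ` F" using wC by (auto simp: L_def)
    qed (auto intro: summable_on_subset_banach[OF maj(2)])
    also have "\<dots> < \<epsilon>" using N(6) wC by blast
    finally show ?thesis .
  qed
  with \<open>openin VT O'\<close> \<open>v \<in> O'\<close> \<open>compactin ET L\<close> show ?thesis by blast
qed

text \<open>The norm is a supremum over all vertices, but where \<open>fnorm h\<close> is below
  \<open>\<epsilon>\<close> a cut-off with values in [0, 1] costs at most \<open>\<epsilon>\<close>.
  The remaining vertices form a compact set \<open>K\<close>, covered by finitely many
  neighbourhoods over which \<open>h\<close> has small tails.\<close>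

lemma compact_support_dense:
  assumes h: "h \<in> graph_functions E" and \<epsilon>: "\<epsilon> > 0"
  shows "\<exists>h' L. h' \<in> graph_functions E \<and> compactin ET L \<and> (\<forall>e. e \<notin> L \<longrightarrow> h' e = 0) \<and>
    gnorm (\<lambda>e. h' e - h e) \<le> \<epsilon>"
proof -
  let ?G = "\<lambda>e. (cmod (h e))\<^sup>2"
  note maj = squares_majorant[OF h gf_zero, of 1, simplified]
  define K where "K = {v \<in> topspace VT. \<epsilon> \<le> fnorm h v}"
  have K: "compactin VT K" using C0_compact[OF gf_fnorm[OF h] \<epsilon>] by (simp add: K_def)
  \<comment> \<open>Tails are sums of squares, whereas the norm is a square root.\<close>
  have "\<epsilon>\<^sup>2 > 0" using \<epsilon> by simp
  from compactly_concentrated[OF h this]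
  have "\<forall>v\<in>K. \<exists>p. openin VT (fst p) \<and> v \<in> fst p \<and> compactin ET (snd p) \<and>
    (\<forall>w\<in>fst p. (\<Sum>\<^sub>\<infinity>e\<in>fib w - snd p. ?G e) < \<epsilon>\<^sup>2)"
    unfolding K_def by fastforce
  from bchoice[OF this] obtain p where p: "\<forall>v\<in>K. openin VT (fst (p v)) \<and> v \<in> fst (p v) \<and>
    compactin ET (snd (p v)) \<and> (\<forall>w\<in>fst (p v). (\<Sum>\<^sub>\<infinity>e\<in>fib w - snd (p v). ?G e) < \<epsilon>\<^sup>2)" by blast
  have "\<forall>U\<in>(fst \<circ> p) ` K. openin VT U" "K \<subseteq> \<Union>((fst \<circ> p) ` K)" using p by auto
  then obtain J where J: "finite J" "J \<subseteq> K" "K \<subseteq> \<Union>((fst \<circ> p) ` J)"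
    using K unfolding compactin_def by (metis finite_subset_image)
  define L where "L = (\<Union>j\<in>J. snd (p j))"
  have L: "compactin ET L" unfolding L_def by (rule compactin_Union) (use J p in auto)
  have tail: "(\<Sum>\<^sub>\<infinity>e\<in>fib w - L. ?G e) \<le> \<epsilon>\<^sup>2" if w: "w \<in> K" for w
  proof -
    obtain j where j: "j \<in> J" "w \<in> fst (p j)" using J(3) w by auto
    have "(\<Sum>\<^sub>\<infinity>e\<in>fib w - L. ?G e) \<le> (\<Sum>\<^sub>\<infinity>e\<in>fib w - snd (p j). ?G e)"
    proof (rule infsum_mono2)
      show "fib w - L \<subseteq> fib w - snd (p j)" using j by (auto simp: L_def)
    qed (auto intro: summable_on_subset_banach[OF maj(2)])
    also have "\<dots> \<le> \<epsilon>\<^sup>2" using p J(2) j by (meson less_imp_le subsetD)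
    finally show ?thesis .
  qed
  have "L \<subseteq> topspace ET" using L compactin_subset_topspace by blast
  from bump_function[OF locally_compact_edges hausdorff_edges L this openin_topspace]
  obtain \<psi> :: "'e \<Rightarrow> real" and C where \<psi>: "continuous_map ET euclidean \<psi>" "\<forall>x. 0 \<le> \<psi> x" "\<forall>x. \<psi> x \<le> 1"
    "\<forall>x\<in>L. \<psi> x = 1" "compactin ET C" "\<forall>x\<in>topspace ET. x \<notin> C \<longrightarrow> \<psi> x = 0" by metis
  define h' where "h' e = complex_of_real (\<psi> e) * h e" for e
  have "continuous_map ET euclidean (\<lambda>e. complex_of_real (\<psi> e))"
    using \<psi>(1) by (rule continuous_map_compose_cont) (intro continuous_intros)
  then have h': "h' \<in> graph_functions E"
    unfolding h'_def by (rule gf_bounded_mult[OF h, of _ 1]) (use \<psi> in auto)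
  have z: "h' e = 0" if "e \<notin> C" for e
    using \<psi>(6) that gf_outside[OF h, of e] by (cases "e \<in> topspace ET") (auto simp: h'_def)
  have d: "h' e - h e = complex_of_real (\<psi> e - 1) * h e" for e by (simp add: h'_def algebra_simps)
  have dn: "cmod (h' e - h e) \<le> cmod (h e)" for e
    using \<psi>(2,3) unfolding d norm_mult norm_of_real by (auto intro!: mult_left_le_one_le)
  have d0: "h' e - h e = 0" if "e \<in> L" for e
    using \<psi>(4) that unfolding d by simp
  have "gnorm (\<lambda>e. h' e - h e) \<le> \<epsilon>"
  proof (rule gnorm_le[OF gf_diff[OF h' h]])
    fix w assume w: "w \<in> topspace VT"
    show "fnorm (\<lambda>e. h' e - h e) w \<le> \<epsilon>"
    proof (cases "w \<in> K")
      case True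
      have "(\<Sum>\<^sub>\<infinity>e\<in>fib w. (cmod (h' e - h e))\<^sup>2) = (\<Sum>\<^sub>\<infinity>e\<in>fib w - L. (cmod (h' e - h e))\<^sup>2)"
        by (rule infsum_cong_neutral) (use d0 in auto)
      also have "\<dots> \<le> (\<Sum>\<^sub>\<infinity>e\<in>fib w - L. ?G e)"
      proof (rule infsum_mono)
        show "(\<lambda>e. (cmod (h' e - h e))\<^sup>2) summable_on fib w - L"
          using gf_square_summable[OF gf_diff[OF h' h], of w] summable_on_subset_banach
          unfolding square_summable_def by blast
        show "?G summable_on fib w - L" by (rule summable_on_subset_banach[OF maj(2)]) auto
      qed (use dn in \<open>auto intro: power_mono\<close>)
      also have "\<dots> \<le> \<epsilon>\<^sup>2" by (rule tail[OF True])
      finally show ?thesis using \<epsilon> by (simp add: l2norm_def real_le_lsqrt infsum_nonneg)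
    next
      case False
      have "fnorm (\<lambda>e. h' e - h e) w \<le> 1 * fnorm h w"
        by (rule l2norm_dominated[OF gf_square_summable[OF h]]) (use dn in auto)
      then show ?thesis using False w by (simp add: K_def)
    qed
  qed (use \<epsilon> in simp)
  with h' \<psi>(5) z show ?thesis by blast
qed

end

section \<open>Factorisation in a topological higher-rank graph\<close>

locale twisted_k_graph =
  fixes \<Lambda> :: "('o, 'm, 'k::finite) topological_k_graph" and c :: "'m \<times> 'm \<Rightarrow> complex"
  assumes graph: "is_topological_k_graph \<Lambda>"
    and cocycle: "continuous_cocycle \<Lambda> c"
begin

abbreviation "r \<equiv> kg_rng \<Lambda>"
abbreviation "s \<equiv> kg_src \<Lambda>"
abbreviation "P \<equiv> kg_paths \<Lambda>"
abbreviation comp (infixl \<open>\<odot>\<close> 70) where "\<mu> \<odot> \<nu> \<equiv> kg_comp \<Lambda> \<mu> \<nu>"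
abbreviation "Obj \<equiv> topspace (kg_obj \<Lambda>)"
abbreviation "Mor \<equiv> topspace (kg_mor \<Lambda>)"
abbreviation "level \<equiv> kg_level \<Lambda>"

section \<open>Unique factorisation and path segments\<close>

lemma is_cat: "is_category \<Lambda>" and deg_functor: "degree_functor \<Lambda>"
  and obj_lc: "locally_compact_space (kg_obj \<Lambda>)" and obj_haus: "Hausdorff_space (kg_obj \<Lambda>)"
  and mor_lc: "locally_compact_space (kg_mor \<Lambda>)" and mor_haus: "Hausdorff_space (kg_mor \<Lambda>)"
  and r_cont: "continuous_map (kg_mor \<Lambda>) (kg_obj \<Lambda>) r"
  and s_cont: "continuous_map (kg_mor \<Lambda>) (kg_obj \<Lambda>) s"
  and s_local_homeo: "local_homeomorphism (kg_mor \<Lambda>) (kg_obj \<Lambda>) s"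
  and comp_cont: "continuous_map (composable_topology \<Lambda>) (kg_mor \<Lambda>) (\<lambda>(\<kappa>, \<mu>). \<kappa> \<odot> \<mu>)"
  and comp_open: "open_map (composable_topology \<Lambda>) (kg_mor \<Lambda>) (\<lambda>(\<kappa>, \<mu>). \<kappa> \<odot> \<mu>)"
  and deg_cont: "continuous_map (kg_mor \<Lambda>) (discrete_topology UNIV) (kg_deg \<Lambda>)"
  and factorisation: "\<forall>\<kappa>\<in>Mor. \<forall>m n. kg_deg \<Lambda> \<kappa> = m + n \<longrightarrow>
        (\<exists>!p. p \<in> composable_pairs \<Lambda> \<and> \<kappa> = fst p \<odot> snd p \<and>
              kg_deg \<Lambda> (fst p) = m \<and> kg_deg \<Lambda> (snd p) = n)"
  using graph unfolding is_topological_k_graph_def by auto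

lemma P_iff: "\<kappa> \<in> P n \<longleftrightarrow> \<kappa> \<in> Mor \<and> kg_deg \<Lambda> \<kappa> = n"
  by (simp add: kg_paths_def)

lemma P_Mor: "\<kappa> \<in> P n \<Longrightarrow> \<kappa> \<in> Mor"
  by (simp add: P_iff)

lemma r_Obj: "\<kappa> \<in> Mor \<Longrightarrow> r \<kappa> \<in> Obj" and s_Obj: "\<kappa> \<in> Mor \<Longrightarrow> s \<kappa> \<in> Obj"
  using is_cat unfolding is_category_def Let_def by auto

lemma id_P: "v \<in> Obj \<Longrightarrow> kg_id \<Lambda> v \<in> P 0"
  and r_id: "v \<in> Obj \<Longrightarrow> r (kg_id \<Lambda> v) = v" and s_id: "v \<in> Obj \<Longrightarrow> s (kg_id \<Lambda> v) = v"
  using is_cat deg_functor unfolding is_category_def degree_functor_def Let_def P_iff by auto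

lemma id_comp: "\<kappa> \<in> Mor \<Longrightarrow> kg_id \<Lambda> (r \<kappa>) \<odot> \<kappa> = \<kappa>"
  and comp_id: "\<kappa> \<in> Mor \<Longrightarrow> \<kappa> \<odot> kg_id \<Lambda> (s \<kappa>) = \<kappa>"
  using is_cat unfolding is_category_def Let_def by auto

lemma composable_iff:
  "(\<mu>, \<nu>) \<in> composable_pairs \<Lambda> \<longleftrightarrow> \<mu> \<in> Mor \<and> \<nu> \<in> Mor \<and> s \<mu> = r \<nu>"
  by (simp add: composable_pairs_def)

lemma
  assumes "\<mu> \<in> P m" "\<nu> \<in> P n" "s \<mu> = r \<nu>"
  shows comp_P: "\<mu> \<odot> \<nu> \<in> P (m + n)" and r_comp: "r (\<mu> \<odot> \<nu>) = r \<mu>" and s_comp: "s (\<mu> \<odot> \<nu>) = s \<nu>"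
proof -
  have *: "(\<mu>, \<nu>) \<in> composable_pairs \<Lambda>" using assms by (simp add: composable_iff P_iff)
  have "\<forall>(\<kappa>, \<mu>)\<in>composable_pairs \<Lambda>. \<kappa> \<odot> \<mu> \<in> Mor \<and> r (\<kappa> \<odot> \<mu>) = r \<kappa> \<and> s (\<kappa> \<odot> \<mu>) = s \<mu>"
    using is_cat unfolding is_category_def Let_def by auto
  moreover have "\<forall>(\<kappa>, \<mu>)\<in>composable_pairs \<Lambda>. kg_deg \<Lambda> (\<kappa> \<odot> \<mu>) = kg_deg \<Lambda> \<kappa> + kg_deg \<Lambda> \<mu>"
    using deg_functor unfolding degree_functor_def by auto
  ultimately have "\<mu> \<odot> \<nu> \<in> Mor \<and> r (\<mu> \<odot> \<nu>) = r \<mu> \<and> s (\<mu> \<odot> \<nu>) = s \<nu> \<and> kg_deg \<Lambda> (\<mu> \<odot> \<nu>) = m + n"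
    using * assms by (auto simp: P_iff)
  then show "\<mu> \<odot> \<nu> \<in> P (m + n)" "r (\<mu> \<odot> \<nu>) = r \<mu>" "s (\<mu> \<odot> \<nu>) = s \<nu>" by (auto simp: P_iff)
qed

lemma comp_assoc:
  assumes "\<kappa> \<in> Mor" "\<mu> \<in> Mor" "\<nu> \<in> Mor" "s \<kappa> = r \<mu>" "s \<mu> = r \<nu>"
  shows "(\<kappa> \<odot> \<mu>) \<odot> \<nu> = \<kappa> \<odot> (\<mu> \<odot> \<nu>)"
proof -
  have "\<forall>\<kappa> \<mu> \<nu>. (\<kappa>, \<mu>) \<in> composable_pairs \<Lambda> \<longrightarrow> (\<mu>, \<nu>) \<in> composable_pairs \<Lambda> \<longrightarrow>
         (\<kappa> \<odot> \<mu>) \<odot> \<nu> = \<kappa> \<odot> (\<mu> \<odot> \<nu>)"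
    using is_cat unfolding is_category_def Let_def by auto
  then show ?thesis using assms by (simp add: composable_iff)
qed

lemma factor_ex:
  assumes "\<kappa> \<in> P (m + n)"
  obtains \<mu> \<nu> where "\<mu> \<in> P m" "\<nu> \<in> P n" "s \<mu> = r \<nu>" "\<kappa> = \<mu> \<odot> \<nu>"
proof -
  have "\<exists>p. p \<in> composable_pairs \<Lambda> \<and> \<kappa> = fst p \<odot> snd p \<and> kg_deg \<Lambda> (fst p) = m \<and> kg_deg \<Lambda> (snd p) = n"
    using factorisation assms unfolding P_iff by (meson ex1_implies_ex)
  then obtain \<mu> \<nu> where "(\<mu>, \<nu>) \<in> composable_pairs \<Lambda>" "\<kappa> = \<mu> \<odot> \<nu>" "kg_deg \<Lambda> \<mu> = m" "kg_deg \<Lambda> \<nu> = n"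
    by auto
  then show thesis by (intro that[of \<mu> \<nu>]) (simp_all add: composable_iff P_iff)
qed

lemma factor_unique:
  assumes "\<mu> \<in> P m" "\<nu> \<in> P n" "s \<mu> = r \<nu>" "\<mu>' \<in> P m" "\<nu>' \<in> P n" "s \<mu>' = r \<nu>'" "\<mu> \<odot> \<nu> = \<mu>' \<odot> \<nu>'"
  shows "\<mu> = \<mu>'" "\<nu> = \<nu>'"
proof -
  have "\<mu> \<odot> \<nu> \<in> Mor" "kg_deg \<Lambda> (\<mu> \<odot> \<nu>) = m + n"
    using comp_P[OF assms(1-3)] by (simp_all add: P_iff)
  then have "\<exists>!p. p \<in> composable_pairs \<Lambda> \<and> \<mu> \<odot> \<nu> = fst p \<odot> snd p \<and> kg_deg \<Lambda> (fst p) = m \<and> kg_deg \<Lambda> (snd p) = n"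
    using factorisation by blast
  then have "(\<mu>, \<nu>) = (\<mu>', \<nu>')"
  proof (rule ex1E)
    fix q
    assume "\<forall>p. p \<in> composable_pairs \<Lambda> \<and> \<mu> \<odot> \<nu> = fst p \<odot> snd p \<and> kg_deg \<Lambda> (fst p) = m \<and> kg_deg \<Lambda> (snd p) = n \<longrightarrow> p = q"
    from this[rule_format, of "(\<mu>, \<nu>)"] this[rule_format, of "(\<mu>', \<nu>')"] show ?thesis
      using assms by (simp add: composable_iff P_iff)
  qed
  then show "\<mu> = \<mu>'" "\<nu> = \<nu>'" by auto
qed

text \<open>A path of degree 0 is an identity followed by itself and also itself followed by an
  identity, both times in degrees 0 and 0; uniqueness of the factorisation equates the first
  factors.\<close>

lemma P0_id:
  assumes "\<kappa> \<in> P 0"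
  shows "kg_id \<Lambda> (r \<kappa>) = \<kappa>" "s \<kappa> = r \<kappa>"
proof -
  have M: "\<kappa> \<in> Mor" using assms by (simp add: P_iff)
  have "kg_id \<Lambda> (r \<kappa>) \<odot> \<kappa> = \<kappa> \<odot> kg_id \<Lambda> (s \<kappa>)" using id_comp comp_id M by simp
  from factor_unique(1)[OF _ _ _ _ _ _ this, of 0 0]
  show *: "kg_id \<Lambda> (r \<kappa>) = \<kappa>" using assms M by (simp add: id_P r_Obj s_Obj r_id s_id)
  show "s \<kappa> = r \<kappa>" using s_id[OF r_Obj[OF M]] * by simp
qed

text \<open>A segment is defined by three factors. For the initial and the final segment one outer
  factor has degree 0 and is an identity, so the other two are fixed by unique
  factorisation.\<close>

lemma segment_comp:
  assumes \<mu>: "\<mu> \<in> P m" and \<nu>: "\<nu> \<in> P n" and sr: "s \<mu> = r \<nu>"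
  shows "kg_segment \<Lambda> (\<mu> \<odot> \<nu>) 0 m = \<mu>" and "kg_segment \<Lambda> (\<mu> \<odot> \<nu>) m (m + n) = \<nu>"
proof -
  have M: "\<mu> \<in> Mor" "\<nu> \<in> Mor" using \<mu> \<nu> by (simp_all add: P_iff)
  have d: "kg_deg \<Lambda> (\<mu> \<odot> \<nu>) = m + n" using comp_P[OF assms] by (simp add: P_iff)
  show "kg_segment \<Lambda> (\<mu> \<odot> \<nu>) 0 m = \<mu>"
    unfolding kg_segment_def d diff_zero add_diff_cancel_left'
  proof (rule the_equality)
    show "\<mu> \<in> P m \<and> (\<exists>\<alpha>\<in>P 0. \<exists>\<gamma>\<in>P n. s \<alpha> = r \<mu> \<and> s \<mu> = r \<gamma> \<and> \<mu> \<odot> \<nu> = \<alpha> \<odot> \<mu> \<odot> \<gamma>)"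
      using \<mu> \<nu> sr M
      by (intro conjI bexI[of _ "kg_id \<Lambda> (r \<mu>)"] bexI[of _ \<nu>]) (simp_all add: id_comp id_P r_Obj s_id)
    fix \<beta> assume "\<beta> \<in> P m \<and> (\<exists>\<alpha>\<in>P 0. \<exists>\<gamma>\<in>P n. s \<alpha> = r \<beta> \<and> s \<beta> = r \<gamma> \<and> \<mu> \<odot> \<nu> = \<alpha> \<odot> \<beta> \<odot> \<gamma>)"
    then obtain \<alpha> \<gamma> where *: "\<beta> \<in> P m" "\<alpha> \<in> P 0" "\<gamma> \<in> P n" "s \<alpha> = r \<beta>" "s \<beta> = r \<gamma>" "\<mu> \<odot> \<nu> = \<alpha> \<odot> \<beta> \<odot> \<gamma>"
      by blast
    have "\<alpha> = kg_id \<Lambda> (r \<beta>)" using P0_id[OF *(2)] *(4) by simp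
    then have "\<alpha> \<odot> \<beta> = \<beta>" using *(1) by (simp add: id_comp P_iff)
    then have "\<mu> \<odot> \<nu> = \<beta> \<odot> \<gamma>" using *(6) by simp
    from factor_unique(1)[OF \<mu> \<nu> sr *(1,3,5) this] show "\<beta> = \<mu>" by simp
  qed
  show "kg_segment \<Lambda> (\<mu> \<odot> \<nu>) m (m + n) = \<nu>"
    unfolding kg_segment_def d diff_self add_diff_cancel_left' cancel_comm_monoid_add_class.diff_cancel
  proof (rule the_equality)
    show "\<nu> \<in> P n \<and> (\<exists>\<alpha>\<in>P m. \<exists>\<gamma>\<in>P 0. s \<alpha> = r \<nu> \<and> s \<nu> = r \<gamma> \<and> \<mu> \<odot> \<nu> = \<alpha> \<odot> \<nu> \<odot> \<gamma>)"
      using \<mu> \<nu> sr M comp_id[OF P_Mor[OF comp_P[OF assms]]] s_comp[OF assms]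
      by (intro conjI bexI[of _ \<mu>] bexI[of _ "kg_id \<Lambda> (s \<nu>)"]) (simp_all add: id_P s_Obj r_id)
    fix \<beta> assume "\<beta> \<in> P n \<and> (\<exists>\<alpha>\<in>P m. \<exists>\<gamma>\<in>P 0. s \<alpha> = r \<beta> \<and> s \<beta> = r \<gamma> \<and> \<mu> \<odot> \<nu> = \<alpha> \<odot> \<beta> \<odot> \<gamma>)"
    then obtain \<alpha> \<gamma> where *: "\<beta> \<in> P n" "\<alpha> \<in> P m" "\<gamma> \<in> P 0" "s \<alpha> = r \<beta>" "s \<beta> = r \<gamma>" "\<mu> \<odot> \<nu> = \<alpha> \<odot> \<beta> \<odot> \<gamma>"
      by blast
    have "\<gamma> = kg_id \<Lambda> (s (\<alpha> \<odot> \<beta>))" using P0_id[OF *(3)] *(5) s_comp[OF *(2,1,4)] by simp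
    then have "\<alpha> \<odot> \<beta> \<odot> \<gamma> = \<alpha> \<odot> \<beta>" using comp_id[OF P_Mor[OF comp_P[OF *(2,1,4)]]] by simp
    then have "\<mu> \<odot> \<nu> = \<alpha> \<odot> \<beta>" using *(6) by simp
    from factor_unique(2)[OF \<mu> \<nu> sr *(2,1,4) this] show "\<beta> = \<nu>" by simp
  qed
qed

lemma twisted_product_comp:
  assumes "\<mu> \<in> P m" "\<nu> \<in> P n" "s \<mu> = r \<nu>"
  shows "twisted_product \<Lambda> c m n f g (\<mu> \<odot> \<nu>) = c (\<mu>, \<nu>) * f \<mu> * g \<nu>"
  unfolding twisted_product_def segment_comp[OF assms] using comp_P[OF assms] by simp

lemma twisted_product_outside: "\<kappa> \<notin> P (m + n) \<Longrightarrow> twisted_product \<Lambda> c m n f g \<kappa> = 0"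
  by (simp add: twisted_product_def)

section \<open>The levels as topological graphs\<close>

lemma openin_P: "openin (kg_mor \<Lambda>) (P n)"
proof -
  have "openin (kg_mor \<Lambda>) {\<kappa> \<in> Mor. kg_deg \<Lambda> \<kappa> \<in> {n}}"
    by (rule openin_continuous_map_preimage[OF deg_cont]) auto
  then show ?thesis by (simp add: kg_paths_def)
qed

lemma P_subset: "P n \<subseteq> Mor"
  by (auto simp: P_iff)

abbreviation "PT n \<equiv> subtopology (kg_mor \<Lambda>) (P n)"

lemma topspace_PT: "topspace (PT n) = P n"
  using P_subset by auto

lemma level_simps [simp]:
  "tg_vertices (level n) = kg_obj \<Lambda>" "tg_edges (level n) = PT n" "tg_rng (level n) = r" "tg_src (level n) = s"
  by (simp_all add: kg_level_def)

text \<open>The set \<open>P n\<close> is open because the degree is continuous into a discrete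
  space, so the local inverses of the source map restrict to it.\<close>

lemma locally_compact_level: "locally_compact_graph (level n)"
proof
  show "local_homeomorphism (tg_edges (level n)) (tg_vertices (level n)) (tg_src (level n))"
    unfolding local_homeomorphism_def
  proof
    fix x assume "x \<in> topspace (tg_edges (level n))"
    then have x: "x \<in> P n" "x \<in> Mor" using P_subset by auto
    obtain U where U: "openin (kg_mor \<Lambda>) U" "x \<in> U" "openin (kg_obj \<Lambda>) (s ` U)"
      "homeomorphic_map (subtopology (kg_mor \<Lambda>) U) (subtopology (kg_obj \<Lambda>) (s ` U)) s"
      using s_local_homeo x unfolding local_homeomorphism_def by blast
    let ?V = "U \<inter> P n"
    have V: "openin (kg_mor \<Lambda>) ?V" using U openin_P by blast
    have UM: "U \<subseteq> Mor" "s ` U \<subseteq> Obj" using U openin_subset by blast+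
    have "openin (subtopology (kg_mor \<Lambda>) U) ?V" using V U(1) by (simp add: openin_open_subtopology)
    then have "openin (subtopology (kg_obj \<Lambda>) (s ` U)) (s ` ?V)"
      using homeomorphic_imp_open_map[OF U(4)] unfolding open_map_def by blast
    then have oV: "openin (kg_obj \<Lambda>) (s ` ?V)" using U(3) openin_trans_full by blast
    have "homeomorphic_map (subtopology (subtopology (kg_mor \<Lambda>) U) ?V)
        (subtopology (subtopology (kg_obj \<Lambda>) (s ` U)) (s ` ?V)) s"
    proof (rule homeomorphic_map_subtopologies[OF U(4)])
      show "s ` (topspace (subtopology (kg_mor \<Lambda>) U) \<inter> ?V) = topspace (subtopology (kg_obj \<Lambda>) (s ` U)) \<inter> s ` ?V"
        using UM by auto
    qed
    moreover have "U \<inter> ?V = P n \<inter> ?V" "s ` U \<inter> s ` ?V = s ` ?V" by auto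
    ultimately have "homeomorphic_map (subtopology (PT n) ?V) (subtopology (kg_obj \<Lambda>) (s ` ?V)) s"
      by (simp add: subtopology_subtopology)
    moreover have "openin (PT n) ?V" using V openin_P by (simp add: openin_open_subtopology)
    ultimately show "\<exists>U. openin (tg_edges (level n)) U \<and> x \<in> U \<and> openin (tg_vertices (level n)) (tg_src (level n) ` U) \<and>
        homeomorphic_map (subtopology (tg_edges (level n)) U)
          (subtopology (tg_vertices (level n)) (tg_src (level n) ` U)) (tg_src (level n))"
      using x U(2) oV by (intro exI[of _ ?V]) simp
  qed
qed (use obj_haus obj_lc r_cont s_cont mor_haus mor_lc openin_P in
    \<open>auto intro: Hausdorff_space_subtopology locally_compact_space_open_subset continuous_map_from_subtopology\<close>)

text \<open>Leaving \<open>n\<close> free gives the module theory for all levels at once, as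
  products involve three of them; the rewrites state its facts directly in terms of the higher-rank
  graph.\<close>

sublocale level: locally_compact_graph "level n"
  rewrites "tg_vertices (level n) = kg_obj \<Lambda>" and "tg_edges (level n) = PT n"
    and "tg_rng (level n) = r" and "tg_src (level n) = s"
  for n
  by (rule locally_compact_level) simp_all

text \<open>Unique factorisation alone gives a continuous bijection; openness of composition is what
  makes its inverse, the pair of segments, continuous. Openness survives restriction to degrees
  \<open>m\<close> and \<open>n\<close> since these pairs form an open set.\<close>

lemma continuous_segments:
  shows "continuous_map (PT (m + n)) (PT m) (\<lambda>\<kappa>. kg_segment \<Lambda> \<kappa> 0 m)"
    and "continuous_map (PT (m + n)) (PT n) (\<lambda>\<kappa>. kg_segment \<Lambda> \<kappa> m (m + n))"
    and "continuous_map (PT (m + n)) (composable_topology \<Lambda>) (\<lambda>\<kappa>. (kg_segment \<Lambda> \<kappa> 0 m, kg_segment \<Lambda> \<kappa> m (m + n)))"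
proof -
  let ?q = "\<lambda>\<kappa>. (kg_segment \<Lambda> \<kappa> 0 m, kg_segment \<Lambda> \<kappa> m (m + n))"
  let ?D = "(P m \<times> P n) \<inter> composable_pairs \<Lambda>"
  let ?C = "\<lambda>(\<kappa>, \<mu>). \<kappa> \<odot> \<mu>"
  have tD: "topspace (subtopology (composable_topology \<Lambda>) ?D) = ?D"
    using P_subset unfolding composable_topology_def by auto
  have D_iff: "(\<mu>, \<nu>) \<in> ?D \<longleftrightarrow> \<mu> \<in> P m \<and> \<nu> \<in> P n \<and> s \<mu> = r \<nu>" for \<mu> \<nu>
    by (auto simp: composable_iff P_iff)
  have "openin (prod_topology (kg_mor \<Lambda>) (kg_mor \<Lambda>)) (P m \<times> P n)"
    using openin_P by (simp add: openin_prod_Times_iff)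
  then have oD: "openin (composable_topology \<Lambda>) ?D"
    unfolding composable_topology_def by (auto simp: openin_subtopology)
  have img: "?C ` ?D = P (m + n)"
  proof (intro equalityI subsetI)
    fix \<kappa> assume "\<kappa> \<in> ?C ` ?D"
    then show "\<kappa> \<in> P (m + n)" by (auto simp: composable_iff intro: comp_P)
  next
    fix \<kappa> assume "\<kappa> \<in> P (m + n)"
    then obtain \<mu> \<nu> where "\<mu> \<in> P m" "\<nu> \<in> P n" "s \<mu> = r \<nu>" "\<kappa> = \<mu> \<odot> \<nu>" by (rule factor_ex)
    then show "\<kappa> \<in> ?C ` ?D" using D_iff by (intro image_eqI[of _ _ "(\<mu>, \<nu>)"]) auto
  qed
  have inj: "inj_on ?C ?D"
  proof (rule inj_onI)
    fix p q assume pq: "p \<in> ?D" "q \<in> ?D" "?C p = ?C q"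
    obtain \<mu> \<nu> \<mu>' \<nu>' where e: "p = (\<mu>, \<nu>)" "q = (\<mu>', \<nu>')" by (metis surj_pair)
    show "p = q" using factor_unique[of \<mu> m \<nu> n \<mu>' \<nu>'] pq D_iff unfolding e by simp
  qed
  have "homeomorphic_map (subtopology (composable_topology \<Lambda>) ?D) (PT (m + n)) ?C"
  proof (rule bijective_open_imp_homeomorphic_map)
    show "continuous_map (subtopology (composable_topology \<Lambda>) ?D) (PT (m + n)) ?C"
      unfolding continuous_map_in_subtopology
      using continuous_map_from_subtopology[OF comp_cont] img tD by auto
    show "open_map (subtopology (composable_topology \<Lambda>) ?D) (PT (m + n)) ?C"
      by (rule open_map_into_subtopology[OF open_map_from_subtopology[OF comp_open oD]])
        (use img tD in blast)
  qed (simp_all only: tD img inj topspace_PT)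
  then obtain q where q: "homeomorphic_maps (subtopology (composable_topology \<Lambda>) ?D) (PT (m + n)) ?C q"
    unfolding homeomorphic_map_maps by blast
  have eq: "q \<kappa> = ?q \<kappa>" if "\<kappa> \<in> P (m + n)" for \<kappa>
  proof -
    obtain \<mu> \<nu> where \<mu>\<nu>: "\<mu> \<in> P m" "\<nu> \<in> P n" "s \<mu> = r \<nu>" "\<kappa> = \<mu> \<odot> \<nu>" using factor_ex[OF \<open>\<kappa> \<in> P (m + n)\<close>] .
    then have "(\<mu>, \<nu>) \<in> topspace (subtopology (composable_topology \<Lambda>) ?D)" unfolding tD using D_iff by blast
    then have "q (?C (\<mu>, \<nu>)) = (\<mu>, \<nu>)" using q unfolding homeomorphic_maps_def by blast
    then show ?thesis using \<mu>\<nu> segment_comp[OF \<mu>\<nu>(1-3)] by simp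
  qed
  have cq: "continuous_map (PT (m + n)) (subtopology (composable_topology \<Lambda>) ?D) ?q"
    by (rule continuous_map_cong_topspace[of _ _ q])
      (use q eq topspace_PT in \<open>auto simp: homeomorphic_maps_def\<close>)
  then show cqc: "continuous_map (PT (m + n)) (composable_topology \<Lambda>) ?q"
    by (rule continuous_map_into_fulltopology)
  then have "continuous_map (PT (m + n)) (prod_topology (kg_mor \<Lambda>) (kg_mor \<Lambda>)) ?q"
    unfolding composable_topology_def by (rule continuous_map_into_fulltopology)
  then have c2: "continuous_map (PT (m + n)) (kg_mor \<Lambda>) (\<lambda>\<kappa>. kg_segment \<Lambda> \<kappa> 0 m)"
    "continuous_map (PT (m + n)) (kg_mor \<Lambda>) (\<lambda>\<kappa>. kg_segment \<Lambda> \<kappa> m (m + n))"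
    unfolding continuous_map_paired by auto
  have mem: "kg_segment \<Lambda> \<kappa> 0 m \<in> P m" "kg_segment \<Lambda> \<kappa> m (m + n) \<in> P n" if "\<kappa> \<in> P (m + n)" for \<kappa>
    using factor_ex[OF that] segment_comp by metis+
  show "continuous_map (PT (m + n)) (PT m) (\<lambda>\<kappa>. kg_segment \<Lambda> \<kappa> 0 m)"
    "continuous_map (PT (m + n)) (PT n) (\<lambda>\<kappa>. kg_segment \<Lambda> \<kappa> m (m + n))"
    using c2 mem by (auto simp: continuous_map_in_subtopology topspace_PT simp del: topspace_subtopology)
qed

section \<open>The twisted product of two fibres\<close>

abbreviation "F n \<equiv> graph_functions (level n)"
abbreviation "fib n \<equiv> source_fibre (level n)"
abbreviation "tw m n f g \<equiv> twisted_product \<Lambda> c m n f g"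

lemma fib_iff: "\<kappa> \<in> fib n v \<longleftrightarrow> \<kappa> \<in> P n \<and> s \<kappa> = v"
  using P_subset by (auto simp: source_fibre_def)

lemma cocycle_norm: "s \<mu> = r \<nu> \<Longrightarrow> \<mu> \<in> Mor \<Longrightarrow> \<nu> \<in> Mor \<Longrightarrow> cmod (c (\<mu>, \<nu>)) = 1"
proof -
  assume "s \<mu> = r \<nu>" "\<mu> \<in> Mor" "\<nu> \<in> Mor"
  then have "(\<mu>, \<nu>) \<in> topspace (composable_topology \<Lambda>)"
    by (simp add: composable_topology_def composable_iff)
  moreover have "continuous_map (composable_topology \<Lambda>) (top_of_set (sphere 0 1)) c"
    using cocycle by (simp add: continuous_cocycle_def)
  ultimately have "c (\<mu>, \<nu>) \<in> sphere 0 1"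
    using continuous_map_image_subset_topspace by fastforce
  then show ?thesis by simp
qed

lemma continuous_twisted_product:
  assumes f: "continuous_map (PT m) euclidean f" and g: "continuous_map (PT n) euclidean g"
  shows "continuous_map (PT (m + n)) euclidean (tw m n f g)"
proof -
  have cc: "continuous_map (composable_topology \<Lambda>) euclidean c"
    using cocycle by (auto simp: continuous_cocycle_def continuous_map_in_subtopology)
  have "continuous_map (PT (m + n)) euclidean (\<lambda>\<kappa>. c (kg_segment \<Lambda> \<kappa> 0 m, kg_segment \<Lambda> \<kappa> m (m + n)) *
           f (kg_segment \<Lambda> \<kappa> 0 m) * g (kg_segment \<Lambda> \<kappa> m (m + n)))"
    using continuous_map_compose[OF continuous_segments(1) f] continuous_map_compose[OF continuous_segments(2) g]
      continuous_map_compose[OF continuous_segments(3) cc]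
    by (intro continuous_map_times) (simp_all add: o_def)
  then show ?thesis
    by (rule continuous_map_cong_topspace) (simp add: twisted_product_def topspace_PT del: topspace_subtopology)
qed

text \<open>Pairs list the second factor first because its range determines the fibre in which the
  first factor may vary.\<close>

lemma bij_fibres:
  "bij_betw (\<lambda>(\<nu>, \<mu>). \<mu> \<odot> \<nu>) (SIGMA \<nu>:fib n v. fib m (r \<nu>)) (fib (m + n) v)"
proof (rule bij_betwI')
  fix p q assume pq: "p \<in> (SIGMA \<nu>:fib n v. fib m (r \<nu>))" "q \<in> (SIGMA \<nu>:fib n v. fib m (r \<nu>))"
  obtain \<nu> \<mu> \<nu>' \<mu>' where e: "p = (\<nu>, \<mu>)" "q = (\<nu>', \<mu>')" by (metis surj_pair)
  show "((case p of (\<nu>, \<mu>) \<Rightarrow> \<mu> \<odot> \<nu>) = (case q of (\<nu>, \<mu>) \<Rightarrow> \<mu> \<odot> \<nu>)) = (p = q)"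
    using factor_unique[of \<mu> m \<nu> n \<mu>' \<nu>'] pq unfolding e by (auto simp: fib_iff)
next
  fix p assume "p \<in> (SIGMA \<nu>:fib n v. fib m (r \<nu>))"
  then show "(case p of (\<nu>, \<mu>) \<Rightarrow> \<mu> \<odot> \<nu>) \<in> fib (m + n) v"
    by (auto simp: fib_iff comp_P s_comp)
next
  fix \<kappa> assume "\<kappa> \<in> fib (m + n) v"
  then have k: "\<kappa> \<in> P (m + n)" "s \<kappa> = v" by (auto simp: fib_iff)
  obtain \<mu> \<nu> where "\<mu> \<in> P m" "\<nu> \<in> P n" "s \<mu> = r \<nu>" "\<kappa> = \<mu> \<odot> \<nu>" using factor_ex[OF k(1)] .
  then show "\<exists>p\<in>(SIGMA \<nu>:fib n v. fib m (r \<nu>)). \<kappa> = (case p of (\<nu>, \<mu>) \<Rightarrow> \<mu> \<odot> \<nu>)"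
    using k by (intro bexI[of _ "(\<nu>, \<mu>)"]) (auto simp: fib_iff s_comp)
qed

lemma infsum_fibres:
  "(\<Sum>\<^sub>\<infinity>\<kappa>\<in>fib (m + n) v. h \<kappa>) = (\<Sum>\<^sub>\<infinity>(\<nu>, \<mu>)\<in>(SIGMA \<nu>:fib n v. fib m (r \<nu>)). h (\<mu> \<odot> \<nu>))"
  using infsum_reindex_bij_betw[OF bij_fibres, of h n v m] by (simp add: case_prod_unfold)

lemma summable_fibres:
  "h summable_on fib (m + n) v \<longleftrightarrow> (\<lambda>(\<nu>, \<mu>). h (\<mu> \<odot> \<nu>)) summable_on (SIGMA \<nu>:fib n v. fib m (r \<nu>))"
  using summable_on_reindex_bij_betw[OF bij_fibres, of h n v m] by (simp add: case_prod_unfold)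

lemma norm_twisted_product:
  assumes "(\<nu>, \<mu>) \<in> (SIGMA \<nu>:fib n v. fib m (r \<nu>))"
  shows "cmod (tw m n f g (\<mu> \<odot> \<nu>)) = cmod (f \<mu>) * cmod (g \<nu>)"
  using assms by (auto simp: fib_iff twisted_product_comp norm_mult cocycle_norm P_Mor)

text \<open>Summing over the first factor turns the fibrewise norm of the product into that of
  \<open>\<lambda>\<nu>. a (r \<nu>) * g \<nu>\<close>, with \<open>a\<close> the fibrewise norm of
  \<open>f\<close>. As \<open>a\<close> vanishes at infinity, membership reduces to the left action
  on \<open>g\<close>.\<close>

lemma twisted_product_closed:
  assumes f: "f \<in> F m" and g: "g \<in> F n"
  shows "tw m n f g \<in> F (m + n)"
proof -
  define a where "a v = complex_of_real (level.fnorm m f v)" for v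
  have a: "a \<in> C0_functions (kg_obj \<Lambda>)" unfolding a_def by (rule level.gf_fnorm[OF f])
  have ag: "(\<lambda>\<nu>. a (r \<nu>) * g \<nu>) \<in> F n" by (rule level.gf_left[OF g a])
  have sum: "((\<lambda>\<mu>. (cmod (f \<mu>) * cmod (g \<nu>))\<^sup>2) has_sum (cmod (a (r \<nu>) * g \<nu>))\<^sup>2) (fib m (r \<nu>))" for \<nu>
  proof -
    have "((\<lambda>\<mu>. (cmod (f \<mu>))\<^sup>2) has_sum (level.fnorm m f (r \<nu>))\<^sup>2) (fib m (r \<nu>))"
      using level.gf_square_summable[OF f, of "r \<nu>"] unfolding square_summable_def l2norm_squared
      by (rule has_sum_infsum)
    from has_sum_cmult_left[OF this, of "(cmod (g \<nu>))\<^sup>2"] show ?thesis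
      by (simp add: a_def norm_mult power_mult_distrib)
  qed
  \<comment> \<open>Squares are nonnegative, so summability over the pairs may be checked on
    iterated sums.\<close>
  have S: "(\<lambda>(\<nu>, \<mu>). (cmod (f \<mu>) * cmod (g \<nu>))\<^sup>2) summable_on (SIGMA \<nu>:fib n v. fib m (r \<nu>))" for v
    by (rule summable_on_SigmaI[where g = "\<lambda>\<nu>. (cmod (a (r \<nu>) * g \<nu>))\<^sup>2"])
      (use sum level.gf_square_summable[OF ag, of v] in \<open>auto simp: square_summable_def\<close>)
  have eq: "(\<lambda>(\<nu>, \<mu>). (cmod (tw m n f g (\<mu> \<odot> \<nu>)))\<^sup>2) p = (\<lambda>(\<nu>, \<mu>). (cmod (f \<mu>) * cmod (g \<nu>))\<^sup>2) p"
    if "p \<in> (SIGMA \<nu>:fib n v. fib m (r \<nu>))" for p v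
    using that by (cases p) (simp only: split_conv norm_twisted_product)
  have sq: "square_summable (tw m n f g) (fib (m + n) v)" for v
    unfolding square_summable_def summable_fibres by (rule summable_on_cong[THEN iffD2, OF eq S])
  have "level.fnorm (m + n) (tw m n f g) v = level.fnorm n (\<lambda>\<nu>. a (r \<nu>) * g \<nu>) v" for v
  proof -
    have "(\<Sum>\<^sub>\<infinity>\<kappa>\<in>fib (m + n) v. (cmod (tw m n f g \<kappa>))\<^sup>2) =
        (\<Sum>\<^sub>\<infinity>(\<nu>, \<mu>)\<in>(SIGMA \<nu>:fib n v. fib m (r \<nu>)). (cmod (f \<mu>) * cmod (g \<nu>))\<^sup>2)"
      unfolding infsum_fibres by (rule infsum_cong[OF eq])
    also have "\<dots> = (\<Sum>\<^sub>\<infinity>\<nu>\<in>fib n v. \<Sum>\<^sub>\<infinity>\<mu>\<in>fib m (r \<nu>). (cmod (f \<mu>) * cmod (g \<nu>))\<^sup>2)"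
      using infsum_Sigma_banach[OF S[of v]] by simp
    also have "\<dots> = (\<Sum>\<^sub>\<infinity>\<nu>\<in>fib n v. (cmod (a (r \<nu>) * g \<nu>))\<^sup>2)"
      by (rule infsum_cong, rule infsumI, rule sum)
    finally show ?thesis by (simp add: l2norm_def)
  qed
  then have "(\<lambda>v. complex_of_real (level.fnorm (m + n) (tw m n f g) v)) \<in> C0_functions (kg_obj \<Lambda>)"
    using level.gf_fnorm[OF ag] by simp
  moreover have "continuous_map (PT (m + n)) euclidean (tw m n f g)"
    using level.gf_continuous[OF f] level.gf_continuous[OF g] by (rule continuous_twisted_product)
  moreover have "\<forall>\<kappa>. \<kappa> \<notin> topspace (PT (m + n)) \<longrightarrow> tw m n f g \<kappa> = 0"
    unfolding topspace_PT using twisted_product_outside by blast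
  ultimately show ?thesis
    unfolding level.graph_functions_iff using sq by blast
qed

lemma twisted_product_inner:
  assumes f: "f \<in> F m" and g: "g \<in> F n" and f': "f' \<in> F m" and g': "g' \<in> F n"
  shows "graph_inner (level (m + n)) (tw m n f g) (tw m n f' g') =
    graph_inner (level n) g (\<lambda>\<nu>. graph_inner (level m) f f' (r \<nu>) * g' \<nu>)"
proof
  fix v
  let ?h = "\<lambda>\<kappa>. cnj (tw m n f g \<kappa>) * tw m n f' g' \<kappa>"
  let ?S = "SIGMA \<nu>:fib n v. fib m (r \<nu>)"
  \<comment> \<open>Summability over the pairs, known because both products are graph functions, is
    what allows the double sum to be iterated.\<close>
  have S: "(\<lambda>(\<nu>, \<mu>). ?h (\<mu> \<odot> \<nu>)) summable_on ?S"
    using level.inner_summable[OF twisted_product_closed[OF f g] twisted_product_closed[OF f' g'], of v]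
    by (simp only: summable_fibres)
  have val: "?h (\<mu> \<odot> \<nu>) = cnj (g \<nu>) * g' \<nu> * (cnj (f \<mu>) * f' \<mu>)"
    if "\<nu> \<in> fib n v" "\<mu> \<in> fib m (r \<nu>)" for \<nu> \<mu>
  proof -
    have *: "\<mu> \<in> P m" "\<nu> \<in> P n" "s \<mu> = r \<nu>" using that by (auto simp: fib_iff)
    have "cnj (c (\<mu>, \<nu>)) * c (\<mu>, \<nu>) = 1"
      using cocycle_norm[OF *(3) P_Mor[OF *(1)] P_Mor[OF *(2)]] complex_norm_square[of "c (\<mu>, \<nu>)"]
      by (simp add: mult.commute)
    then show ?thesis
      by (simp add: twisted_product_comp[OF *] algebra_simps)
  qed
  have "graph_inner (level (m + n)) (tw m n f g) (tw m n f' g') v = (\<Sum>\<^sub>\<infinity>(\<nu>, \<mu>)\<in>?S. ?h (\<mu> \<odot> \<nu>))"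
    unfolding level.graph_inner_eq infsum_fibres ..
  also have "\<dots> = (\<Sum>\<^sub>\<infinity>\<nu>\<in>fib n v. \<Sum>\<^sub>\<infinity>\<mu>\<in>fib m (r \<nu>). ?h (\<mu> \<odot> \<nu>))"
    using infsum_Sigma_banach[OF S] by simp
  also have "\<dots> = (\<Sum>\<^sub>\<infinity>\<nu>\<in>fib n v. cnj (g \<nu>) * (graph_inner (level m) f f' (r \<nu>) * g' \<nu>))"
  proof (rule infsum_cong)
    fix \<nu> assume \<nu>: "\<nu> \<in> fib n v"
    have "(\<Sum>\<^sub>\<infinity>\<mu>\<in>fib m (r \<nu>). ?h (\<mu> \<odot> \<nu>)) = (\<Sum>\<^sub>\<infinity>\<mu>\<in>fib m (r \<nu>). cnj (g \<nu>) * g' \<nu> * (cnj (f \<mu>) * f' \<mu>))"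
      by (rule infsum_cong, rule val[OF \<nu>])
    also have "\<dots> = cnj (g \<nu>) * g' \<nu> * graph_inner (level m) f f' (r \<nu>)"
      unfolding level.graph_inner_eq by (rule infsum_cmult_right')
    finally show "(\<Sum>\<^sub>\<infinity>\<mu>\<in>fib m (r \<nu>). ?h (\<mu> \<odot> \<nu>)) = cnj (g \<nu>) * (graph_inner (level m) f f' (r \<nu>) * g' \<nu>)"
      by (simp add: mult.commute mult.left_commute)
  qed
  finally show "graph_inner (level (m + n)) (tw m n f g) (tw m n f' g') v =
      graph_inner (level n) g (\<lambda>\<nu>. graph_inner (level m) f f' (r \<nu>) * g' \<nu>) v"
    unfolding level.graph_inner_eq .
qed

text \<open>Identities between functions on paths are checked on factored paths, where
  \<open>segment_comp\<close> has disposed of the definite descriptions in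
  \<open>kg_segment\<close>.\<close>

lemma paths_eqI:
  assumes "\<And>\<kappa>. \<kappa> \<notin> P (m + n) \<Longrightarrow> h \<kappa> = h' \<kappa>"
    and "\<And>\<mu> \<nu>. \<mu> \<in> P m \<Longrightarrow> \<nu> \<in> P n \<Longrightarrow> s \<mu> = r \<nu> \<Longrightarrow> h (\<mu> \<odot> \<nu>) = h' (\<mu> \<odot> \<nu>)"
  shows "h = h'"
proof
  fix \<kappa>
  show "h \<kappa> = h' \<kappa>"
  proof (cases "\<kappa> \<in> P (m + n)")
    case True
    then obtain \<mu> \<nu> where "\<mu> \<in> P m" "\<nu> \<in> P n" "s \<mu> = r \<nu>" "\<kappa> = \<mu> \<odot> \<nu>" by (rule factor_ex)
    then show ?thesis using assms(2) by simp
  qed (rule assms(1))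
qed

lemma twisted_product_assoc:
  "tw (l + m) n (tw l m f g) h = tw l (m + n) f (tw m n g h)"
proof (rule paths_eqI[of "l + m" n])
  show "\<kappa> \<notin> P (l + m + n) \<Longrightarrow> tw (l + m) n (tw l m f g) h \<kappa> = tw l (m + n) f (tw m n g h) \<kappa>" for \<kappa>
    by (simp add: twisted_product_def add.assoc)
  fix \<kappa> \<rho> assume \<kappa>: "\<kappa> \<in> P (l + m)" and \<rho>: "\<rho> \<in> P n" "s \<kappa> = r \<rho>"
  obtain \<mu> \<nu> where \<mu>\<nu>: "\<mu> \<in> P l" "\<nu> \<in> P m" "s \<mu> = r \<nu>" "\<kappa> = \<mu> \<odot> \<nu>" using factor_ex[OF \<kappa>] .
  have \<nu>\<rho>: "s \<nu> = r \<rho>" using s_comp[OF \<mu>\<nu>(1-3)] \<rho> \<mu>\<nu>(4) by simp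
  have M: "\<mu> \<in> Mor" "\<nu> \<in> Mor" "\<rho> \<in> Mor" using P_Mor \<mu>\<nu> \<rho> by blast+
  have assoc: "\<kappa> \<odot> \<rho> = \<mu> \<odot> (\<nu> \<odot> \<rho>)" using comp_assoc[OF M \<mu>\<nu>(3) \<nu>\<rho>] \<mu>\<nu>(4) by simp
  have co: "c (\<mu>, \<nu>) * c (\<kappa>, \<rho>) = c (\<mu>, \<nu> \<odot> \<rho>) * c (\<nu>, \<rho>)"
    using cocycle M \<mu>\<nu>(3,4) \<nu>\<rho> unfolding continuous_cocycle_def by (simp add: composable_iff)
  have "tw (l + m) n (tw l m f g) h (\<kappa> \<odot> \<rho>) = (c (\<mu>, \<nu>) * c (\<kappa>, \<rho>)) * f \<mu> * g \<nu> * h \<rho>"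
    using twisted_product_comp[OF \<kappa> \<rho>] twisted_product_comp[OF \<mu>\<nu>(1-3)] \<mu>\<nu>(4) by simp
  also have "\<dots> = tw l (m + n) f (tw m n g h) (\<mu> \<odot> (\<nu> \<odot> \<rho>))"
    unfolding co
    using twisted_product_comp[OF \<mu>\<nu>(1) comp_P[OF \<mu>\<nu>(2) \<rho>(1) \<nu>\<rho>]] r_comp[OF \<mu>\<nu>(2) \<rho>(1) \<nu>\<rho>]
      twisted_product_comp[OF \<mu>\<nu>(2) \<rho>(1) \<nu>\<rho>] \<mu>\<nu>(3) by simp
  finally show "tw (l + m) n (tw l m f g) h (\<kappa> \<odot> \<rho>) = tw l (m + n) f (tw m n g h) (\<kappa> \<odot> \<rho>)"
    unfolding assoc .
qed

lemma twisted_product_scale: "tw m n (\<lambda>\<mu>. z * f \<mu>) g = (\<lambda>\<kappa>. z * tw m n f g \<kappa>)"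
  by (auto simp: twisted_product_def)

lemma twisted_product_left: "tw m n (\<lambda>\<mu>. a (r \<mu>) * f \<mu>) g = (\<lambda>\<kappa>. a (r \<kappa>) * tw m n f g \<kappa>)"
  by (rule paths_eqI[of m n]) (auto simp: twisted_product_outside twisted_product_comp r_comp)

lemma twisted_product_right: "tw m n f (\<lambda>\<nu>. g \<nu> * a (s \<nu>)) = (\<lambda>\<kappa>. tw m n f g \<kappa> * a (s \<kappa>))"
  by (rule paths_eqI[of m n]) (auto simp: twisted_product_outside twisted_product_comp s_comp)

section \<open>The fibre over zero\<close>

text \<open>The axioms do not list continuity of the identity map. It follows because the source map
  restricted to \<open>P 0\<close> is a bijection onto the objects and open as a local
  homeomorphism, with \<open>kg_id\<close> as its inverse.\<close>

lemma continuous_id: "continuous_map (kg_obj \<Lambda>) (PT 0) (kg_id \<Lambda>)"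
proof -
  have img: "s ` P 0 = Obj"
  proof (intro equalityI subsetI)
    show "v \<in> s ` P 0" if "v \<in> Obj" for v using id_P[OF that] s_id[OF that] by (metis image_eqI)
  qed (auto simp: s_Obj P_Mor)
  have inj: "inj_on s (P 0)" by (rule inj_onI) (metis P0_id)
  have "open_map (PT 0) (kg_obj \<Lambda>) s"
    unfolding open_map_def
  proof (intro allI impI)
    fix W assume W: "openin (PT 0) W"
    show "openin (kg_obj \<Lambda>) (s ` W)"
    proof (subst openin_subopen, intro ballI)
      fix v assume "v \<in> s ` W"
      then obtain \<kappa> where \<kappa>: "\<kappa> \<in> W" "v = s \<kappa>" by blast
      then have "\<kappa> \<in> topspace (PT 0)" using W openin_subset by blast
      then obtain U where U: "level.open_section 0 U" "\<kappa> \<in> U" using level.ex_open_section by blast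
      have UU: "openin (PT 0) U" "openin (kg_obj \<Lambda>) (s ` U)"
        "homeomorphic_map (subtopology (PT 0) U) (subtopology (kg_obj \<Lambda>) (s ` U)) s"
        using U(1) unfolding level.open_section_def by auto
      have "openin (subtopology (PT 0) U) (U \<inter> W)"
        using UU(1) W by (simp add: openin_open_subtopology openin_Int)
      then have "openin (subtopology (kg_obj \<Lambda>) (s ` U)) (s ` (U \<inter> W))"
        using homeomorphic_imp_open_map[OF UU(3)] unfolding open_map_def by blast
      then have "openin (kg_obj \<Lambda>) (s ` (U \<inter> W))" using UU(2) openin_trans_full by blast
      then show "\<exists>T. openin (kg_obj \<Lambda>) T \<and> v \<in> T \<and> T \<subseteq> s ` W"
        using \<kappa> U(2) by (intro exI[of _ "s ` (U \<inter> W)"]) auto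
    qed
  qed
  then have "homeomorphic_map (PT 0) (kg_obj \<Lambda>) s"
    using continuous_map_from_subtopology[OF s_cont] img inj
    by (intro bijective_open_imp_homeomorphic_map) (simp_all only: topspace_PT)
  then obtain q where q: "homeomorphic_maps (PT 0) (kg_obj \<Lambda>) s q"
    unfolding homeomorphic_map_maps by blast
  then have qs: "q (s \<kappa>) = \<kappa>" if "\<kappa> \<in> P 0" for \<kappa>
    using that topspace_PT unfolding homeomorphic_maps_def by blast
  have "q v = kg_id \<Lambda> v" if "v \<in> Obj" for v
    using qs[OF id_P[OF that]] s_id[OF that] by simp
  then show ?thesis using q continuous_map_cong_topspace unfolding homeomorphic_maps_def by blast
qed

lemma fib_0: "v \<in> Obj \<Longrightarrow> fib 0 v = {kg_id \<Lambda> v}"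
  using id_P s_id P0_id by (auto simp: fib_iff)

lemma inner_0:
  assumes "v \<in> Obj"
  shows "graph_inner (level 0) f g v = cnj (f (kg_id \<Lambda> v)) * g (kg_id \<Lambda> v)"
  unfolding level.graph_inner_eq fib_0[OF assms] by simp

lemma vertex_embedding_id: "v \<in> Obj \<Longrightarrow> vertex_embedding \<Lambda> a (kg_id \<Lambda> v) = a v"
  by (simp add: vertex_embedding_def id_P r_id)

lemma vertex_embedding_inner:
  assumes a: "a \<in> C0_functions (kg_obj \<Lambda>)"
  shows "graph_inner (level 0) (vertex_embedding \<Lambda> a) (vertex_embedding \<Lambda> b) = (\<lambda>v. cnj (a v) * b v)"
proof
  fix v
  show "graph_inner (level 0) (vertex_embedding \<Lambda> a) (vertex_embedding \<Lambda> b) v = cnj (a v) * b v"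
  proof (cases "v \<in> Obj")
    case True
    then show ?thesis by (simp add: inner_0 vertex_embedding_id)
  next
    case False
    then show ?thesis by (simp add: graph_inner_def C0_outside[OF a])
  qed
qed

lemma vertex_embedding_closed:
  assumes a: "a \<in> C0_functions (kg_obj \<Lambda>)"
  shows "vertex_embedding \<Lambda> a \<in> F 0"
proof -
  have "continuous_map (PT 0) euclidean (\<lambda>\<kappa>. a (r \<kappa>))"
    using continuous_map_compose[OF continuous_map_from_subtopology[OF r_cont] C0_continuous[OF a]]
    by (simp add: o_def)
  then have c: "continuous_map (PT 0) euclidean (vertex_embedding \<Lambda> a)"
    by (rule continuous_map_cong_topspace)
      (simp add: vertex_embedding_def topspace_PT del: topspace_subtopology)
  have "graph_inner (level 0) (vertex_embedding \<Lambda> a) (vertex_embedding \<Lambda> a) \<in> C0_functions (kg_obj \<Lambda>)"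
    unfolding vertex_embedding_inner[OF a] using C0_mult[OF a C0_cnj[OF a]] .
  moreover have "\<forall>v\<in>Obj. (\<lambda>e. cnj (vertex_embedding \<Lambda> a e) * vertex_embedding \<Lambda> a e) summable_on fib 0 v"
    by (simp add: fib_0)
  moreover have "\<forall>e. e \<notin> topspace (PT 0) \<longrightarrow> vertex_embedding \<Lambda> a e = 0"
    by (simp add: vertex_embedding_def topspace_PT del: topspace_subtopology)
  ultimately show ?thesis using c unfolding graph_functions_def by simp
qed

text \<open>Fibres in degree 0 are single points, so the fibrewise norm of \<open>f\<close> is the
  modulus of its pullback along \<open>kg_id\<close>; decay is inherited from it, and continuity
  comes from \<open>continuous_id\<close>.\<close>

lemma vertex_embedding_surj:
  assumes f: "f \<in> F 0"
  obtains a where "a \<in> C0_functions (kg_obj \<Lambda>)" "vertex_embedding \<Lambda> a = f"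
proof -
  define a where "a v = (if v \<in> Obj then f (kg_id \<Lambda> v) else 0)" for v
  have norm: "cmod (a v) = level.fnorm 0 f v" for v
    using level.fib_empty[of v] by (cases "v \<in> Obj") (simp_all add: a_def l2norm_def fib_0)
  have "continuous_map (kg_obj \<Lambda>) euclidean (f \<circ> kg_id \<Lambda>)"
    using continuous_id level.gf_continuous[OF f] by (rule continuous_map_compose)
  then have c: "continuous_map (kg_obj \<Lambda>) euclidean a"
    by (rule continuous_map_cong_topspace) (simp add: a_def)
  have "a \<in> C0_functions (kg_obj \<Lambda>)"
    by (rule C0_dominated[OF c _ level.gf_fnorm[OF f], of 1]) (simp_all add: a_def norm flip: norm)
  moreover have "vertex_embedding \<Lambda> a \<kappa> = f \<kappa>" for \<kappa>
  proof (cases "\<kappa> \<in> P 0")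
    case True
    then show ?thesis using P0_id[OF True] r_Obj[OF P_Mor[OF True]] by (simp add: vertex_embedding_def a_def)
  next
    case False
    then have "\<kappa> \<notin> topspace (PT 0)" unfolding topspace_PT .
    then show ?thesis using level.gf_outside[OF f] False by (simp add: vertex_embedding_def)
  qed
  ultimately show thesis using that by blast
qed

lemma X_level: "kg_correspondence \<Lambda> n = graph_correspondence (level n)"
  by (simp add: kg_correspondence_def)

lemma vertex_embedding_iso:
  "correspondence_iso (C0_algebra (kg_obj \<Lambda>)) (self_correspondence (C0_algebra (kg_obj \<Lambda>)))
     (kg_correspondence \<Lambda> 0) (vertex_embedding \<Lambda>)"
  unfolding correspondence_iso_def self_correspondence_def X_level
proof (simp, intro conjI ballI allI)
  show "bij_betw (vertex_embedding \<Lambda>) (C0_functions (kg_obj \<Lambda>)) (F 0)"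
    unfolding bij_betw_def
  proof
    show "inj_on (vertex_embedding \<Lambda>) (C0_functions (kg_obj \<Lambda>))"
    proof (rule inj_onI)
      fix a b assume a: "a \<in> C0_functions (kg_obj \<Lambda>)" and b: "b \<in> C0_functions (kg_obj \<Lambda>)"
        and eq: "vertex_embedding \<Lambda> a = vertex_embedding \<Lambda> b"
      show "a = b"
      proof
        fix v
        show "a v = b v"
          using vertex_embedding_id[of v a] vertex_embedding_id[of v b] eq C0_outside[OF a, of v] C0_outside[OF b, of v]
          by (cases "v \<in> Obj") simp_all
      qed
    qed
    show "vertex_embedding \<Lambda> ` C0_functions (kg_obj \<Lambda>) = F 0"
      using vertex_embedding_closed vertex_embedding_surj by blast
  qed
qed (auto simp: vertex_embedding_def fun_eq_iff P0_id(2) vertex_embedding_inner)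

text \<open>Normalisation of the cocycle: the first factor is the identity at
  \<open>r \<nu>\<close>, where \<open>c\<close> takes the value 1 and composition returns
  \<open>\<nu>\<close>.\<close>

lemma vertex_embedding_left:
  assumes f: "f \<in> F n"
  shows "tw 0 n (vertex_embedding \<Lambda> a) f = (\<lambda>\<kappa>. a (r \<kappa>) * f \<kappa>)"
proof (rule paths_eqI[of 0 n])
  fix \<kappa> assume \<kappa>: "\<kappa> \<notin> P (0 + n)"
  then have "\<kappa> \<notin> topspace (PT n)" unfolding topspace_PT by simp
  then show "tw 0 n (vertex_embedding \<Lambda> a) f \<kappa> = a (r \<kappa>) * f \<kappa>"
    using level.gf_outside[OF f] \<kappa> by (simp add: twisted_product_outside)
next
  fix \<mu> \<nu> assume *: "\<mu> \<in> P 0" "\<nu> \<in> P n" "s \<mu> = r \<nu>"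
  have \<mu>: "\<mu> = kg_id \<Lambda> (r \<nu>)" "r \<mu> = r \<nu>" using P0_id[OF *(1)] *(3) by simp_all
  have "c (\<mu>, \<nu>) = 1" using cocycle P_Mor[OF *(2)] unfolding \<mu>(1) continuous_cocycle_def by blast
  moreover have "\<mu> \<odot> \<nu> = \<nu>" using id_comp[OF P_Mor[OF *(2)]] \<mu>(1) by simp
  ultimately show "tw 0 n (vertex_embedding \<Lambda> a) f (\<mu> \<odot> \<nu>) = a (r (\<mu> \<odot> \<nu>)) * f (\<mu> \<odot> \<nu>)"
    using twisted_product_comp[OF *] *(1) \<mu>(2) by (simp add: vertex_embedding_def)
qed

lemma vertex_embedding_right:
  assumes f: "f \<in> F n"
  shows "tw n 0 f (vertex_embedding \<Lambda> a) = (\<lambda>\<kappa>. f \<kappa> * a (s \<kappa>))"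
proof (rule paths_eqI[of n 0])
  fix \<kappa> assume \<kappa>: "\<kappa> \<notin> P (n + 0)"
  then have "\<kappa> \<notin> topspace (PT n)" unfolding topspace_PT by simp
  then show "tw n 0 f (vertex_embedding \<Lambda> a) \<kappa> = f \<kappa> * a (s \<kappa>)"
    using level.gf_outside[OF f] \<kappa> by (simp add: twisted_product_outside)
next
  fix \<mu> \<nu> assume *: "\<mu> \<in> P n" "\<nu> \<in> P 0" "s \<mu> = r \<nu>"
  have \<nu>: "\<nu> = kg_id \<Lambda> (s \<mu>)" using P0_id[OF *(2)] *(3) by simp
  have "c (\<mu>, \<nu>) = 1" using cocycle P_Mor[OF *(1)] unfolding \<nu> continuous_cocycle_def by blast
  moreover have "\<mu> \<odot> \<nu> = \<mu>" using comp_id[OF P_Mor[OF *(1)]] \<nu> by simp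
  ultimately show "tw n 0 f (vertex_embedding \<Lambda> a) (\<mu> \<odot> \<nu>) = f (\<mu> \<odot> \<nu>) * a (s (\<mu> \<odot> \<nu>))"
    using twisted_product_comp[OF *] * by (simp add: vertex_embedding_def)
qed

end

section \<open>Products span a dense subspace\<close>

context twisted_k_graph
begin

text \<open>On an open section the first factor of a path is determined by the range of the second one, so
  all of \<open>h\<close> can be carried by the second factor \<open>g\<close>, with \<open>f\<close> a mere cut-off function.\<close>

lemma factor_section_supported:
  assumes h: "continuous_map (PT (m + n)) euclidean h" "\<And>\<kappa>. \<kappa> \<notin> C \<Longrightarrow> h \<kappa> = 0"
    and C: "compactin (PT (m + n)) C"
    and U: "level.open_section m U" and U': "level.open_section n U'"
    and CU: "\<And>\<mu> \<nu>. \<mu> \<in> P m \<Longrightarrow> \<nu> \<in> P n \<Longrightarrow> s \<mu> = r \<nu> \<Longrightarrow> \<mu> \<odot> \<nu> \<in> C \<Longrightarrow> \<mu> \<in> U \<and> \<nu> \<in> U'"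
  shows "\<exists>f\<in>F m. \<exists>g\<in>F n. tw m n f g = h"
proof -
  \<comment> \<open>The first and the second factors of the paths in \<open>C\<close>; as continuous
    images both sets are compact.\<close>
  define L1 where "L1 = (\<lambda>\<kappa>. kg_segment \<Lambda> \<kappa> 0 m) ` C"
  define L2 where "L2 = (\<lambda>\<kappa>. kg_segment \<Lambda> \<kappa> m (m + n)) ` C"
  have CP: "C \<subseteq> P (m + n)" using compactin_subset_topspace[OF C] topspace_PT by blast
  have L1: "compactin (PT m) L1" and L2: "compactin (PT n) L2"
    unfolding L1_def L2_def by (rule image_compactin[OF C continuous_segments(1)], rule image_compactin[OF C continuous_segments(2)])
  have inL: "\<mu> \<in> L1" "\<nu> \<in> L2" if "\<mu> \<in> P m" "\<nu> \<in> P n" "s \<mu> = r \<nu>" "\<mu> \<odot> \<nu> \<in> C" for \<mu> \<nu>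
    unfolding L1_def L2_def using segment_comp[OF that(1-3)] that(4) by (metis image_eqI)+
  have L_ex: "\<exists>\<mu> \<nu>. \<mu> \<in> P m \<and> \<nu> \<in> P n \<and> s \<mu> = r \<nu> \<and> \<mu> \<odot> \<nu> = \<kappa> \<and>
      kg_segment \<Lambda> \<kappa> 0 m = \<mu> \<and> kg_segment \<Lambda> \<kappa> m (m + n) = \<nu>" if "\<kappa> \<in> C" for \<kappa>
  proof -
    have "\<kappa> \<in> P (m + n)" using CP that by blast
    then obtain \<mu> \<nu> where "\<mu> \<in> P m" "\<nu> \<in> P n" "s \<mu> = r \<nu>" "\<kappa> = \<mu> \<odot> \<nu>" by (rule factor_ex)
    then show ?thesis using segment_comp[of \<mu> m \<nu> n] by (intro exI[of _ \<mu>] exI[of _ \<nu>]) simp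
  qed
  have L1U: "L1 \<subseteq> U"
  proof
    fix \<mu> assume "\<mu> \<in> L1"
    then obtain \<kappa> where \<kappa>: "\<kappa> \<in> C" "\<mu> = kg_segment \<Lambda> \<kappa> 0 m" unfolding L1_def by blast
    obtain \<mu>' \<nu>' where "\<mu>' \<in> P m" "\<nu>' \<in> P n" "s \<mu>' = r \<nu>'" "\<mu>' \<odot> \<nu>' = \<kappa>" "kg_segment \<Lambda> \<kappa> 0 m = \<mu>'"
      using L_ex[OF \<kappa>(1)] by blast
    then show "\<mu> \<in> U" using CU[of \<mu>' \<nu>'] \<kappa> by simp
  qed
  have L2U: "\<nu> \<in> U' \<and> \<nu> \<in> P n \<and> r \<nu> \<in> s ` U" if "\<nu> \<in> L2" for \<nu>
  proof -
    obtain \<kappa> where \<kappa>: "\<kappa> \<in> C" "\<nu> = kg_segment \<Lambda> \<kappa> m (m + n)" using \<open>\<nu> \<in> L2\<close> unfolding L2_def by blast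
    obtain \<mu>' \<nu>' where *: "\<mu>' \<in> P m" "\<nu>' \<in> P n" "s \<mu>' = r \<nu>'" "\<mu>' \<odot> \<nu>' = \<kappa>" "kg_segment \<Lambda> \<kappa> m (m + n) = \<nu>'"
      using L_ex[OF \<kappa>(1)] by blast
    then have "\<mu>' \<in> U \<and> \<nu>' \<in> U'" using CU[of \<mu>' \<nu>'] \<kappa> by simp
    then show ?thesis using * \<kappa>(2) by (metis image_eqI)
  qed
  have oU: "openin (PT m) U" "openin (kg_obj \<Lambda>) (s ` U)" using U unfolding level.open_section_def by auto
  have UP: "U \<subseteq> P m" using level.open_section_subset[OF U] topspace_PT by blast
  obtain \<sigma> where \<sigma>: "continuous_map (subtopology (kg_obj \<Lambda>) (s ` U)) (PT m) \<sigma>"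
    "\<And>v. v \<in> s ` U \<Longrightarrow> \<sigma> v \<in> U \<and> s (\<sigma> v) = v" "\<And>e. e \<in> U \<Longrightarrow> \<sigma> (s e) = e"
    using level.open_section_inverse[OF U] by blast
  obtain \<phi> :: "'m \<Rightarrow> real" and C1 where \<phi>: "continuous_map (PT m) euclidean \<phi>"
    "\<forall>x\<in>L1. \<phi> x = 1" "compactin (PT m) C1" "C1 \<subseteq> U" "\<forall>x\<in>topspace (PT m). x \<notin> C1 \<longrightarrow> \<phi> x = 0"
    using bump_function[OF level.locally_compact_edges level.hausdorff_edges L1 L1U oU(1)] by metis
  define f where "f \<mu> = (if \<mu> \<in> P m then complex_of_real (\<phi> \<mu>) else 0)" for \<mu>
  have f0: "f \<mu> = 0" if "\<mu> \<notin> C1" for \<mu>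
    using \<phi>(5) that unfolding topspace_PT by (simp add: f_def)
  have "continuous_map (PT m) euclidean (\<lambda>\<mu>. complex_of_real (\<phi> \<mu>))"
    using \<phi>(1) by (rule continuous_map_compose_cont) (intro continuous_intros)
  then have "continuous_map (PT m) euclidean f"
    by (rule continuous_map_cong_topspace) (simp add: f_def topspace_PT del: topspace_subtopology)
  then have fF: "f \<in> F m" using level.gf_section_support[OF U \<phi>(3,4)] f0 by blast
  \<comment> \<open>\<open>\<sigma> (r \<nu>)\<close> is the only path in \<open>U\<close> that can
    precede \<open>\<nu>\<close>. The conjugate cancels the cocycle value, of modulus 1, that the
    twisted product introduces.\<close>
  define g where "g \<nu> = (if \<nu> \<in> P n \<and> r \<nu> \<in> s ` U then cnj (c (\<sigma> (r \<nu>), \<nu>)) * h (\<sigma> (r \<nu>) \<odot> \<nu>) else 0)" for \<nu>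
  have g0: "g \<nu> = 0" if "\<nu> \<notin> L2" for \<nu>
  proof (cases "\<nu> \<in> P n \<and> r \<nu> \<in> s ` U")
    case True
    then have \<sigma>': "\<sigma> (r \<nu>) \<in> P m" "s (\<sigma> (r \<nu>)) = r \<nu>" using \<sigma>(2)[of "r \<nu>"] UP by auto
    have "\<sigma> (r \<nu>) \<odot> \<nu> \<notin> C" using inL(2)[OF \<sigma>'(1) _ \<sigma>'(2)] True that by blast
    then show ?thesis using h(2) by (simp add: g_def)
  next
    case False
    then show ?thesis unfolding g_def by (rule if_not_P)
  qed
  define O' where "O' = {\<nu> \<in> P n. r \<nu> \<in> s ` U}"
  have r_PT: "continuous_map (PT n) (kg_obj \<Lambda>) r" by (rule continuous_map_from_subtopology[OF r_cont])
  \<comment> \<open>The formula for \<open>g\<close> is meaningful only over the open set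
    \<open>O'\<close>, where \<open>\<sigma>\<close> is defined. Since \<open>g\<close> vanishes off
    the compact set \<open>L2 \<subseteq> O'\<close>, extension by zero stays continuous.\<close>
  have "continuous_map (PT n) euclidean g"
  proof (rule continuous_map_glue_zero)
    have "openin (PT n) {\<nu> \<in> topspace (PT n). r \<nu> \<in> s ` U}"
      using r_PT oU(2) by (rule openin_continuous_map_preimage)
    then show "openin (PT n) O'" by (simp only: O'_def topspace_PT)
    show "closedin (PT n) L2" by (rule compactin_imp_closedin[OF level.hausdorff_edges L2])
    show "L2 \<subseteq> O'" using L2U by (auto simp: O'_def)
    let ?T = "subtopology (PT n) O'"
    have tT: "topspace ?T = O'" using P_subset by (auto simp: O'_def)
    have mem: "\<sigma> (r \<nu>) \<in> P m" "s (\<sigma> (r \<nu>)) = r \<nu>" "\<nu> \<in> P n" if "\<nu> \<in> O'" for \<nu>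
      using \<sigma>(2)[of "r \<nu>"] UP that by (auto simp: O'_def)
    have "continuous_map ?T (subtopology (kg_obj \<Lambda>) (s ` U)) r"
      unfolding continuous_map_in_subtopology tT
      using continuous_map_from_subtopology[OF r_PT] by (auto simp: O'_def)
    from continuous_map_compose[OF this \<sigma>(1)]
    have "continuous_map ?T (kg_mor \<Lambda>) (\<lambda>\<nu>. \<sigma> (r \<nu>))"
      by (simp add: o_def continuous_map_into_fulltopology)
    moreover have "continuous_map ?T (kg_mor \<Lambda>) (\<lambda>\<nu>. \<nu>)"
      by (intro continuous_map_from_subtopology continuous_map_id[unfolded id_def])
    ultimately have pair: "continuous_map ?T (composable_topology \<Lambda>) (\<lambda>\<nu>. (\<sigma> (r \<nu>), \<nu>))"
      unfolding composable_topology_def continuous_map_in_subtopology continuous_map_paired tT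
      using mem mem(1,3)[THEN P_Mor] by (auto simp: composable_iff)
    have cc: "continuous_map (composable_topology \<Lambda>) euclidean c"
      using cocycle by (auto simp: continuous_cocycle_def continuous_map_in_subtopology)
    have "continuous_map ?T (PT (m + n)) (\<lambda>\<nu>. \<sigma> (r \<nu>) \<odot> \<nu>)"
      unfolding continuous_map_in_subtopology tT
      using continuous_map_compose[OF pair comp_cont] mem by (auto simp: o_def comp_P)
    from continuous_map_compose[OF this h(1)]
    have "continuous_map ?T euclidean (\<lambda>\<nu>. h (\<sigma> (r \<nu>) \<odot> \<nu>))" by (simp add: o_def)
    moreover have "continuous_map ?T euclidean (\<lambda>\<nu>. cnj (c (\<sigma> (r \<nu>), \<nu>)))"
      using continuous_map_compose_cont[OF continuous_map_compose[OF pair cc], of cnj]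
      by (simp add: o_def continuous_on_cnj)
    ultimately have "continuous_map ?T euclidean (\<lambda>\<nu>. cnj (c (\<sigma> (r \<nu>), \<nu>)) * h (\<sigma> (r \<nu>) \<odot> \<nu>))"
      by (rule continuous_map_times[rotated])
    then show "continuous_map ?T euclidean g"
      by (rule continuous_map_cong_topspace) (simp only: tT, simp add: g_def O'_def)
  qed (rule g0)
  then have gF: "g \<in> F n" using level.gf_section_support[OF U' L2] g0 L2U by blast
  have "tw m n f g = h"
  proof (rule paths_eqI[of m n])
    show "tw m n f g \<kappa> = h \<kappa>" if "\<kappa> \<notin> P (m + n)" for \<kappa>
      using that CP h(2)[of \<kappa>] twisted_product_outside by auto
    fix \<mu> \<nu> assume *: "\<mu> \<in> P m" "\<nu> \<in> P n" "s \<mu> = r \<nu>"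
    have gv: "g \<nu> = cnj (c (\<mu>, \<nu>)) * h (\<mu> \<odot> \<nu>)" if "\<mu> \<in> U"
    proof -
      have "r \<nu> \<in> s ` U" "\<sigma> (r \<nu>) = \<mu>" using that *(3) \<sigma>(3)[OF that] by (metis image_eqI, simp)
      then show ?thesis using *(2) by (simp add: g_def)
    qed
    show "tw m n f g (\<mu> \<odot> \<nu>) = h (\<mu> \<odot> \<nu>)"
    proof (cases "\<mu> \<odot> \<nu> \<in> C")
      case True
      then have \<mu>: "\<mu> \<in> L1" "\<mu> \<in> U" using inL[OF *] L1U by auto
      have "c (\<mu>, \<nu>) * cnj (c (\<mu>, \<nu>)) = 1"
        using cocycle_norm[OF *(3) P_Mor[OF *(1)] P_Mor[OF *(2)]] complex_norm_square[of "c (\<mu>, \<nu>)"] by simp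
      moreover have "f \<mu> = 1" using \<phi>(2) \<mu> *(1) by (simp add: f_def)
      ultimately show ?thesis using gv[OF \<mu>(2)] twisted_product_comp[OF *] by simp
    next
      case False
      then have "h (\<mu> \<odot> \<nu>) = 0" by (rule h(2))
      \<comment> \<open>Either \<open>\<mu>\<close> lies outside the support of \<open>f\<close>, or
        \<open>\<mu> \<in> U\<close> and \<open>g \<nu>\<close> is a multiple of
        \<open>h (\<mu> \<odot> \<nu>)\<close>.\<close>
      moreover have "f \<mu> * g \<nu> = 0"
        using f0[of \<mu>] gv \<phi>(4) \<open>h (\<mu> \<odot> \<nu>) = 0\<close> by (cases "\<mu> \<in> C1") auto
      ultimately show ?thesis using twisted_product_comp[OF *, of f g] by simp
    qed
  qed
  with fF gF show ?thesis by blast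
qed

lemma compact_support_factors:
  assumes h: "continuous_map (PT (m + n)) euclidean h" "\<And>\<kappa>. \<kappa> \<notin> L \<Longrightarrow> h \<kappa> = 0"
    and L: "compactin (PT (m + n)) L"
  shows "\<exists>u\<in>formal_sums (kg_correspondence \<Lambda> m) (kg_correspondence \<Lambda> n).
    h = (\<lambda>\<kappa>. \<Sum>(f, g)\<leftarrow>u. tw m n f g \<kappa>)"
proof -
  have LP: "L \<subseteq> P (m + n)" using compactin_subset_topspace[OF L] topspace_PT by blast
  let ?hd = "\<lambda>\<kappa>. kg_segment \<Lambda> \<kappa> 0 m" and ?tl = "\<lambda>\<kappa>. kg_segment \<Lambda> \<kappa> m (m + n)"
  have mem: "?hd \<kappa> \<in> topspace (PT m)" "?tl \<kappa> \<in> topspace (PT n)" if "\<kappa> \<in> P (m + n)" for \<kappa>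
    using continuous_map_image_subset_topspace[OF continuous_segments(1)[of m n]]
      continuous_map_image_subset_topspace[OF continuous_segments(2)[of m n]] that topspace_PT by blast+
  have "\<forall>\<kappa>\<in>L. \<exists>p. level.open_section m (fst p) \<and> ?hd \<kappa> \<in> fst p \<and> level.open_section n (snd p) \<and> ?tl \<kappa> \<in> snd p"
  proof
    fix \<kappa> assume "\<kappa> \<in> L"
    then have "\<kappa> \<in> P (m + n)" using LP by blast
    with level.ex_open_section[OF mem(1)] level.ex_open_section[OF mem(2)]
    obtain U U' where "level.open_section m U" "?hd \<kappa> \<in> U" "level.open_section n U'" "?tl \<kappa> \<in> U'" by metis
    then show "\<exists>p. level.open_section m (fst p) \<and> ?hd \<kappa> \<in> fst p \<and> level.open_section n (snd p) \<and> ?tl \<kappa> \<in> snd p"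
      by (intro exI[of _ "(U, U')"]) simp
  qed
  from bchoice[OF this] obtain p where p: "\<forall>\<kappa>\<in>L. level.open_section m (fst (p \<kappa>)) \<and> ?hd \<kappa> \<in> fst (p \<kappa>) \<and>
    level.open_section n (snd (p \<kappa>)) \<and> ?tl \<kappa> \<in> snd (p \<kappa>)" by blast
  \<comment> \<open>The neighbourhood of \<open>\<kappa>\<close> cut out by sections around its two
    segments: a piece of \<open>h\<close> supported in it meets the hypotheses of
    \<open>factor_section_supported\<close>.\<close>
  define O' where "O' \<kappa> = {\<kappa>' \<in> topspace (PT (m + n)). ?hd \<kappa>' \<in> fst (p \<kappa>)} \<inter>
      {\<kappa>' \<in> topspace (PT (m + n)). ?tl \<kappa>' \<in> snd (p \<kappa>)}" for \<kappa>
  have O': "openin (PT (m + n)) (O' \<kappa>) \<and> \<kappa> \<in> O' \<kappa>" if "\<kappa> \<in> L" for \<kappa>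
  proof
    show "openin (PT (m + n)) (O' \<kappa>)"
      unfolding O'_def
      by (intro openin_Int openin_continuous_map_preimage[OF continuous_segments(1)]
          openin_continuous_map_preimage[OF continuous_segments(2)])
        (use p that in \<open>auto simp: level.open_section_def\<close>)
    show "\<kappa> \<in> O' \<kappa>" using p that LP unfolding O'_def topspace_PT by blast
  qed
  obtain J hh C where J: "finite J" "J \<subseteq> L" "\<forall>j\<in>J. continuous_map (PT (m + n)) euclidean (hh j)"
    "\<forall>j\<in>J. compactin (PT (m + n)) (C j) \<and> C j \<subseteq> O' j"
    "\<forall>j\<in>J. \<forall>x. x \<notin> C j \<longrightarrow> hh j x = 0" "\<forall>x. h x = (\<Sum>j\<in>J. hh j x)"
    using decompose_compact_support[OF level.locally_compact_edges level.hausdorff_edges h L O'] by metis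
  have "\<forall>j\<in>J. \<exists>q. fst q \<in> F m \<and> snd q \<in> F n \<and> tw m n (fst q) (snd q) = hh j"
  proof
    fix j assume j: "j \<in> J"
    have "\<exists>f\<in>F m. \<exists>g\<in>F n. tw m n f g = hh j"
    proof (rule factor_section_supported[of m n "hh j" "C j" "fst (p j)" "snd (p j)"])
      fix \<mu> \<nu> assume *: "\<mu> \<in> P m" "\<nu> \<in> P n" "s \<mu> = r \<nu>" "\<mu> \<odot> \<nu> \<in> C j"
      then have "\<mu> \<odot> \<nu> \<in> O' j" using J(4) j by blast
      then show "\<mu> \<in> fst (p j) \<and> \<nu> \<in> snd (p j)"
        unfolding O'_def using segment_comp[OF *(1-3)] by simp
    qed (use J p j in auto)
    then show "\<exists>q. fst q \<in> F m \<and> snd q \<in> F n \<and> tw m n (fst q) (snd q) = hh j" by auto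
  qed
  from bchoice[OF this] obtain q where q: "\<forall>j\<in>J. fst (q j) \<in> F m \<and> snd (q j) \<in> F n \<and> tw m n (fst (q j)) (snd (q j)) = hh j"
    by blast
  \<comment> \<open>Formal sums are lists, so the finite index set is enumerated without
    repetition.\<close>
  obtain js where js: "set js = J" "distinct js" using finite_distinct_list[OF J(1)] by blast
  show ?thesis
  proof (intro bexI ext)
    show "map q js \<in> formal_sums (kg_correspondence \<Lambda> m) (kg_correspondence \<Lambda> n)"
      using q js by (simp add: formal_sums_def X_level in_lists_conv_set mem_Times_iff)
    fix \<kappa>
    have "(\<Sum>(f, g)\<leftarrow>map q js. tw m n f g \<kappa>) = (\<Sum>j\<leftarrow>js. tw m n (fst (q j)) (snd (q j)) \<kappa>)"
      by (simp add: o_def split_beta)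
    also have "\<dots> = (\<Sum>j\<in>J. hh j \<kappa>)"
      using q js by (simp add: sum_list_distinct_conv_sum_set)
    finally show "h \<kappa> = (\<Sum>(f, g)\<leftarrow>map q js. tw m n f g \<kappa>)" using J(6) by simp
  qed
qed

section \<open>Assembling the product system\<close>

lemma cstar_correspondence_level:
  "cstar_correspondence (C0_algebra (kg_obj \<Lambda>)) (kg_correspondence \<Lambda> n)"
  unfolding X_level by (rule level.cstar_correspondence_X)

text \<open>Compactly supported functions are exact finite sums of products, so the whole error in
  the density condition is that of the cut-off; taking it at most \<open>\<epsilon>/2\<close> makes
  the inequality strict.\<close>

lemma isometric_product_levels:
  "isometric_product (level (m + n)) (kg_correspondence \<Lambda> m) (kg_correspondence \<Lambda> n) (tw m n)"
proof (intro isometric_product.intro isometric_product_axioms.intro locally_compact_level, unfold level_simps)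
  fix h and \<epsilon> :: real assume h: "h \<in> F (m + n)" and "\<epsilon> > 0"
  then have "\<epsilon>/2 > 0" by simp
  from level.compact_support_dense[OF h this] obtain h' L where h': "h' \<in> F (m + n)"
    "compactin (PT (m + n)) L" "\<forall>\<kappa>. \<kappa> \<notin> L \<longrightarrow> h' \<kappa> = 0" "level.gnorm (m + n) (\<lambda>\<kappa>. h' \<kappa> - h \<kappa>) \<le> \<epsilon>/2"
    by blast
  obtain u where u: "u \<in> formal_sums (kg_correspondence \<Lambda> m) (kg_correspondence \<Lambda> n)"
    "h' = (\<lambda>\<kappa>. \<Sum>(f, g)\<leftarrow>u. tw m n f g \<kappa>)"
    using compact_support_factors[OF level.gf_continuous[OF h'(1)] _ h'(2)] h'(3) by metis
  have "level.gnorm (m + n) (\<lambda>\<kappa>. (\<Sum>(f, g)\<leftarrow>u. tw m n f g \<kappa>) - h \<kappa>) < \<epsilon>"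
    using h'(4) \<open>\<epsilon> > 0\<close> unfolding u(2) by linarith
  with u(1) show "\<exists>u\<in>formal_sums (kg_correspondence \<Lambda> m) (kg_correspondence \<Lambda> n).
      level.gnorm (m + n) (\<lambda>\<kappa>. (\<Sum>(f, g)\<leftarrow>u. tw m n f g \<kappa>) - h \<kappa>) < \<epsilon>" by blast
qed (simp_all add: cstar_correspondence_level[unfolded X_level] X_level twisted_product_closed twisted_product_scale
    twisted_product_left twisted_product_right twisted_product_inner)

lemma product_system_levels:
  "product_system (C0_algebra (kg_obj \<Lambda>)) (kg_correspondence \<Lambda>) (twisted_product \<Lambda> c) (vertex_embedding \<Lambda>)"
  unfolding product_system_def
proof (intro conjI allI impI ballI)
  show "semigroup_on (disjoint_union (kg_correspondence \<Lambda>)) (graded_mult (twisted_product \<Lambda> c))"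
    unfolding semigroup_on_def disjoint_union_def graded_mult_def
    by (auto simp: X_level twisted_product_closed twisted_product_assoc add.assoc)
  show "\<exists>U. correspondence_iso (C0_algebra (kg_obj \<Lambda>))
      (tensor_product (C0_algebra (kg_obj \<Lambda>)) (kg_correspondence \<Lambda> m) (kg_correspondence \<Lambda> n))
      (kg_correspondence \<Lambda> (m + n)) U \<and>
      (\<forall>x\<in>co_set (kg_correspondence \<Lambda> m). \<forall>y\<in>co_set (kg_correspondence \<Lambda> n).
        U (elementary_tensor (C0_algebra (kg_obj \<Lambda>)) (kg_correspondence \<Lambda> m) (kg_correspondence \<Lambda> n) x y) =
        twisted_product \<Lambda> c m n x y)" for m n
    using isometric_product.tensor_product_iso[OF isometric_product_levels, of m n]
    by (simp only: level_simps X_level)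
qed (simp_all add: cstar_algebra_C0 cstar_correspondence_level[unfolded X_level]
    vertex_embedding_iso[unfolded X_level] X_level
    vertex_embedding_left vertex_embedding_right)

end

theorem proposition4p1:
  fixes \<Lambda> :: "('o, 'm, 'k::finite) topological_k_graph"
    and c :: "'m \<times> 'm \<Rightarrow> complex"
  assumes "is_topological_k_graph \<Lambda>"
    and "proper_k_graph \<Lambda>"
    and "source_free \<Lambda>"
    and "continuous_cocycle \<Lambda> c"
  shows "(\<forall>m n. \<forall>f\<in>co_set (kg_correspondence \<Lambda> m). \<forall>g\<in>co_set (kg_correspondence \<Lambda> n).
            twisted_product \<Lambda> c m n f g \<in> co_set (kg_correspondence \<Lambda> (m + n))) \<and>
         product_system (C0_algebra (kg_obj \<Lambda>)) (kg_correspondence \<Lambda>) (twisted_product \<Lambda> c)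
           (vertex_embedding \<Lambda>)"
proof -
  interpret twisted_k_graph \<Lambda> c by unfold_locales fact+
  show ?thesis using product_system_levels twisted_product_closed by (simp add: X_level)
qed

end
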